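(* Let $G$ be a non-complete connected chordal accessible graph. Then there exists a cut vertex $v$ of $G$ such that $J_{G\setminus\{v\}}$ is unmixed.
   Context: All graphs are finite and simple. A graph is chordal if all its induced cycles have length three. For $S\subseteq V(G)$, $G\setminus S$ is the induced subgraph on $V(G)\setminus S$, and $c_G(S)$ is the number of connected components of $G\setminus S$. A vertex $v$ is a cut vertex of $G$ if $G\setminus\{v\}$ has more connected components than $G$. A set $S\subseteq V(G)$ is a cut set of $G$ if $S=\emptyset$ or $c_G(S\setminus\{s\})<c_G(S)$ for every $s\in S$; $\mathcal C(G)$ is the collection of cut sets of $G$. Let $K$ be a field. The binomial edge ideal of a graph $G$ on $[n]=\{1,\dots,n\}$ is $J_G=(x_iy_j-x_jy_i : \{i,j\}\in E(G))\subseteq K[x_1,\dots,x_n,y_1,\dots,y_n]$ (and similarly for any finite vertex set, with one pair of variables per vertex). $J_G$ is unmixed if all its minimal primes have the same height; equivalently (a known fact), $c_G(S)=|S|+c$ for every $S\in\mathcal C(G)$, where $c$ is the number of connected components of $G$. A graph $G$ is accessible if $J_G$ is unmixed and $\mathcal C(G)$ is an accessible set system, i.e. for every non-empty $S\in\mathcal C(G)$ there exists $s\in S$ such that $S\setminus\{s\}\in\mathcal C(G)$. *)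

theory Defs
  imports
    "HOL-Algebra.Ideal"
    "HOL-Library.Poly_Mapping"
    "HOL-Library.Extended_Nat"
    "Graph_Theory.Graph_Theory"
begin

section \<open>Graphs\<close>

text \<open>
  A finite simple graph is a symmetric finite digraph without loops and parallel arcs
  (locale \<^locale>\<open>graph\<close>); each edge is present as a pair of opposite arcs, and
  adjacency is \<open>u \<rightarrow>\<^bsub>G\<^esub> v\<close>. Since the arcs are symmetric, the strongly connected
  components \<open>pre_digraph.sccs\<close> are the connected components.
\<close>

definition del_verts :: "('a, 'b) pre_digraph \<Rightarrow> 'a set \<Rightarrow> ('a, 'b) pre_digraph" where
  "del_verts G S = G \<restriction> (verts G - S)"

definition num_components :: "('a, 'b) pre_digraph \<Rightarrow> nat" where
  "num_components G = card (pre_digraph.sccs G)"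

definition cut_vertex :: "('a, 'b) pre_digraph \<Rightarrow> 'a \<Rightarrow> bool" where
  "cut_vertex G v \<longleftrightarrow> v \<in> verts G \<and> num_components G < num_components (del_verts G {v})"

definition cut_set :: "('a, 'b) pre_digraph \<Rightarrow> 'a set \<Rightarrow> bool" where
  "cut_set G S \<longleftrightarrow> S \<subseteq> verts G \<and>
     (S = {} \<or>
      (\<forall>s\<in>S. num_components (del_verts G (S - {s})) < num_components (del_verts G S)))"

text \<open>
  An induced cycle is given by a cyclic listing of its vertices: the adjacencies of \<open>G\<close>
  among them are exactly those between cyclically consecutive entries.
\<close>

definition induced_cycle :: "('a, 'b) pre_digraph \<Rightarrow> 'a list \<Rightarrow> bool" where
  "induced_cycle G vs \<longleftrightarrow>
     3 \<le> length vs \<and> distinct vs \<and> set vs \<subseteq> verts G \<and>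
     (\<forall>i<length vs. \<forall>j<length vs.
        vs ! i \<rightarrow>\<^bsub>G\<^esub> vs ! j \<longleftrightarrow>
        j = Suc i mod length vs \<or> i = Suc j mod length vs)"

definition chordal_graph :: "('a, 'b) pre_digraph \<Rightarrow> bool" where
  "chordal_graph G \<longleftrightarrow> (\<forall>vs. induced_cycle G vs \<longrightarrow> length vs = 3)"


section \<open>Minimal primes, height, unmixedness\<close>

definition minimal_primes :: "('r, 'm) ring_scheme \<Rightarrow> 'r set \<Rightarrow> 'r set set" where
  "minimal_primes R I =
     {P. primeideal P R \<and> I \<subseteq> P \<and>
         (\<forall>Q. primeideal Q R \<and> I \<subseteq> Q \<and> Q \<subseteq> P \<longrightarrow> Q = P)}"

definition prime_height :: "('r, 'm) ring_scheme \<Rightarrow> 'r set \<Rightarrow> enat" where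
  "prime_height R P =
     (SUP n \<in> {n. \<exists>C :: nat \<Rightarrow> 'r set. C n = P \<and>
                 (\<forall>i\<le>n. primeideal (C i) R) \<and> (\<forall>i<n. C i \<subset> C (Suc i))}. enat n)"

definition unmixed_ideal :: "('r, 'm) ring_scheme \<Rightarrow> 'r set \<Rightarrow> bool" where
  "unmixed_ideal R I \<longleftrightarrow>
     (\<forall>P\<in>minimal_primes R I. \<forall>Q\<in>minimal_primes R I. prime_height R P = prime_height R Q)"


section \<open>Binomial edge ideals\<close>

text \<open>
  \<open>(('x \<Rightarrow>\<^sub>0 nat) \<Rightarrow>\<^sub>0 'k)\<close> is the type of polynomials over \<open>'k\<close> in the variables \<open>'x\<close>
  (finitely supported coefficient functions on exponent vectors). The polynomial ring on a
  set \<open>X\<close> of variables consists of those polynomials in which only variables of \<open>X\<close> occur.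
\<close>

definition mpoly_ring :: "'x set \<Rightarrow> (('x \<Rightarrow>\<^sub>0 nat) \<Rightarrow>\<^sub>0 'k::field) ring" where
  "mpoly_ring X =
     \<lparr>carrier = {p. \<forall>m\<in>Poly_Mapping.keys p. Poly_Mapping.keys m \<subseteq> X},
      monoid.mult = (*), one = 1, zero = 0, add = (+)\<rparr>"

lemma cring_mpoly_ring: "cring (mpoly_ring X :: (('x \<Rightarrow>\<^sub>0 nat) \<Rightarrow>\<^sub>0 'k::field) ring)"
proof (rule cringI)
  let ?R = "mpoly_ring X :: (('x \<Rightarrow>\<^sub>0 nat) \<Rightarrow>\<^sub>0 'k) ring"
  have add: "p + q \<in> carrier ?R" if "p \<in> carrier ?R" "q \<in> carrier ?R" for p q
    using that keys_add[of p q] by (auto simp: mpoly_ring_def)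
  have mult: "p * q \<in> carrier ?R" if "p \<in> carrier ?R" "q \<in> carrier ?R" for p q
  proof -
    have "Poly_Mapping.keys m \<subseteq> X" if m: "m \<in> Poly_Mapping.keys (p * q)" for m
    proof -
      obtain a b where "m = a + b" "a \<in> Poly_Mapping.keys p" "b \<in> Poly_Mapping.keys q"
        using m keys_mult[of p q] by blast
      then show ?thesis
        using \<open>p \<in> carrier ?R\<close> \<open>q \<in> carrier ?R\<close> keys_add[of a b]
        by (simp add: mpoly_ring_def) blast
    qed
    then show ?thesis by (auto simp: mpoly_ring_def)
  qed
  show "abelian_group ?R"
  proof (rule abelian_groupI)
    fix p q assume "p \<in> carrier ?R" "q \<in> carrier ?R"
    then show "p \<oplus>\<^bsub>?R\<^esub> q \<in> carrier ?R"
      using add[of p q] by (simp add: mpoly_ring_def)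
  next
    fix p assume "p \<in> carrier ?R"
    then show "\<exists>q\<in>carrier ?R. q \<oplus>\<^bsub>?R\<^esub> p = \<zero>\<^bsub>?R\<^esub>"
      by (intro bexI[of _ "- p"]) (simp_all add: mpoly_ring_def)
  qed (simp_all add: mpoly_ring_def add_ac)
  show "comm_monoid ?R"
  proof (rule comm_monoidI)
    fix p q assume "p \<in> carrier ?R" "q \<in> carrier ?R"
    then show "p \<otimes>\<^bsub>?R\<^esub> q \<in> carrier ?R"
      using mult[of p q] by (simp add: mpoly_ring_def)
  qed (simp_all add: mpoly_ring_def mult_ac)
qed (simp add: mpoly_ring_def distrib_right)

datatype 'a edge_var = VarX 'a | VarY 'a

definition pvar :: "'x \<Rightarrow> (('x \<Rightarrow>\<^sub>0 nat) \<Rightarrow>\<^sub>0 'k::field)" where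
  "pvar x = Poly_Mapping.single (Poly_Mapping.single x 1) 1"

definition edge_ring ::
  "'k::field itself \<Rightarrow> ('a, 'b) pre_digraph \<Rightarrow> (('a edge_var \<Rightarrow>\<^sub>0 nat) \<Rightarrow>\<^sub>0 'k) ring" where
  "edge_ring _ G = mpoly_ring (VarX ` verts G \<union> VarY ` verts G)"

text \<open>
  An edge contributes one generator for each of its two orientations; these differ only in
  sign.
\<close>

definition binomial_edge_ideal ::
  "'k::field itself \<Rightarrow> ('a, 'b) pre_digraph \<Rightarrow> (('a edge_var \<Rightarrow>\<^sub>0 nat) \<Rightarrow>\<^sub>0 'k) set" where
  "binomial_edge_ideal K G =
     Idl\<^bsub>edge_ring K G\<^esub>
       {pvar (VarX i) * pvar (VarY j) - pvar (VarX j) * pvar (VarY i) | i j. i \<rightarrow>\<^bsub>G\<^esub> j}"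

definition unmixed_graph :: "'k::field itself \<Rightarrow> ('a, 'b) pre_digraph \<Rightarrow> bool" where
  "unmixed_graph K G \<longleftrightarrow> unmixed_ideal (edge_ring K G) (binomial_edge_ideal K G)"

definition accessible_graph :: "'k::field itself \<Rightarrow> ('a, 'b) pre_digraph \<Rightarrow> bool" where
  "accessible_graph K G \<longleftrightarrow>
     unmixed_graph K G \<and>
     (\<forall>S. cut_set G S \<and> S \<noteq> {} \<longrightarrow> (\<exists>s\<in>S. cut_set G (S - {s})))"

end

theory Submission
  imports Defs
begin

text \<open>
  There are two halves, an algebraic one and a combinatorial one, which meet in the criterion
  that \<open>J\<^sub>G\<close> is unmixed iff \<open>c(S) = |S| + c(\<emptyset>)\<close> for every cut set \<open>S\<close>, where \<open>c(S)\<close> counts the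
  components of \<open>G - S\<close>.

  \<^bold>\<open>Algebra.\<close> For \<open>S \<subseteq> V(G)\<close> let \<open>P\<^sub>S\<close> be the kernel of the substitution that kills \<open>x\<^sub>i, y\<^sub>i\<close> for
  \<open>i \<in> S\<close> and sends \<open>y\<^sub>i\<close> to \<open>x\<^sub>i y\<^sub>r\<close> for \<open>i\<close> outside \<open>S\<close>, with \<open>r\<close> a representative of the component of
  \<open>i\<close> in \<open>G - S\<close>. A kernel of this kind is prime for free. It is generated by the killed variables
  and the \<open>2\<close>-minors within components (\<open>component_prime_subset\<close>), which
  identifies the minimal primes of \<open>J\<^sub>G\<close> with the \<open>P\<^sub>S\<close> for cut sets \<open>S\<close>. The height of \<open>P\<^sub>S\<close> is \<open>n + |S| - c(S)\<close>: specializing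
  one variable at a time gives a chain of primes of that length below \<open>P\<^sub>S\<close> and one of the
  complementary length above it, and a chain of primes in a polynomial ring in \<open>N\<close> variables has length
  at most \<open>N\<close> (\<open>prime_chain_length_le\<close>).

  \<^bold>\<open>Combinatorics.\<close> Let \<open>v\<close> be a cut vertex. If \<open>T\<close> is a cut set of \<open>G - v\<close> such that \<open>T \<union> {v}\<close> is a
  cut set of \<open>G\<close>, then \<open>c(T \<union> {v}) = |T| + 2\<close>, as wanted. So \<open>J\<close> of \<open>G - v\<close> can only fail to be
  unmixed when \<open>v\<close> is bad towards a component \<open>H\<close> of \<open>G - v\<close>: some cut set of \<open>H\<close> contains all
  neighbours of \<open>v\<close> in \<open>H\<close>. Suppose that every cut vertex is bad. Orienting
  each cut vertex towards a bad side and choosing a bad side \<open>H\<close> of smallest size yields a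
  region \<open>B\<close> of the graph all of whose cut vertices are bad towards \<open>B\<close>. By chordality \<open>B\<close> has a simplicial
  vertex \<open>z\<close> other than \<open>v\<close>, where \<open>v\<close> is the cut vertex to which \<open>H\<close> belongs. Some cut vertex \<open>w \<in> B\<close> is
  adjacent to \<open>z\<close>: either \<open>v\<close> itself, or the neighbours of \<open>z\<close> in \<open>B\<close> separate \<open>z\<close> from \<open>v\<close> and
  contain a nonempty cut set, which by accessibility contains a cut vertex. A cut set \<open>T\<close> witnessing that \<open>w\<close> is bad contains \<open>z\<close>, but all
  neighbours of \<open>z\<close> in \<open>B\<close> other than \<open>w\<close> are neighbours of \<open>w\<close> and so lie in \<open>T\<close>. Hence \<open>z\<close>
  separates two components outside \<open>B\<close>; so it is a cut vertex, and it remains separating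
  on its outer side after the removal of \<open>T\<close>. As \<open>z\<close> is also bad towards \<open>B\<close>, three cut sets
  arise whose component counts contradict each other
  (\<open>facing_bad_sides_contradiction\<close>).
\<close>

section \<open>Connectivity and cut sets\<close>

locale adjacency =
  fixes adj :: "'a \<Rightarrow> 'a \<Rightarrow> bool" (infix \<open>\<sim>\<close> 50)
  assumes adj_sym: "x \<sim> y \<Longrightarrow> y \<sim> x" and adj_irrefl: "\<not> x \<sim> x"
begin

definition conn :: "'a set \<Rightarrow> 'a rel" where
  "conn U = {(x, y). x \<in> U \<and> (x, y) \<in> {(a, b). a \<in> U \<and> b \<in> U \<and> a \<sim> b}\<^sup>*}"

definition component_count :: "'a set \<Rightarrow> nat" where
  "component_count U = card (U // conn U)"

definition separates :: "'a \<Rightarrow> 'a set \<Rightarrow> bool" where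
  "separates s U \<longleftrightarrow> (\<exists>i\<in>U. \<exists>j\<in>U. s \<sim> i \<and> s \<sim> j \<and> (i, j) \<notin> conn U)"

text \<open>
  The condition asks each \<open>s \<in> S\<close> to join two components of \<open>V - S\<close>, so it is vacuous for \<open>S = {}\<close>;
  by \<open>component_count_insert_less_iff\<close> below this is the usual notion of a cut set. The ambient set \<open>V\<close>
  is a parameter because cut sets of sides of a cut vertex occur as well.
\<close>
definition cutset :: "'a set \<Rightarrow> 'a set \<Rightarrow> bool" where
  "cutset V S \<longleftrightarrow> S \<subseteq> V \<and> (\<forall>s\<in>S. separates s (V - S))"

definition simplicial :: "'a set \<Rightarrow> 'a \<Rightarrow> bool" where
  "simplicial W z \<longleftrightarrow> z \<in> W \<and> (\<forall>x\<in>W. \<forall>y\<in>W. z \<sim> x \<longrightarrow> z \<sim> y \<longrightarrow> x \<noteq> y \<longrightarrow> x \<sim> y)"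

lemma conn_refl: "x \<in> U \<Longrightarrow> (x, x) \<in> conn U"
  by (simp add: conn_def)

lemma conn_in:
  assumes "(x, y) \<in> conn U" shows "x \<in> U" "y \<in> U"
proof -
  show "x \<in> U" using assms by (simp add: conn_def)
  have "(x, y) \<in> {(a, b). a \<in> U \<and> b \<in> U \<and> a \<sim> b}\<^sup>*" using assms by (simp add: conn_def)
  then show "y \<in> U" using \<open>x \<in> U\<close> by (induction rule: rtrancl_induct) auto
qed

lemma conn_step: "x \<in> U \<Longrightarrow> y \<in> U \<Longrightarrow> x \<sim> y \<Longrightarrow> (x, y) \<in> conn U"
  by (auto simp: conn_def)

lemma conn_trans: "(x, y) \<in> conn U \<Longrightarrow> (y, z) \<in> conn U \<Longrightarrow> (x, z) \<in> conn U"
  by (auto simp: conn_def intro: rtrancl_trans)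

lemma conn_induct [consumes 1, case_names base step]:
  assumes "(x, y) \<in> conn U" and "P x"
    and "\<And>y z. (x, y) \<in> conn U \<Longrightarrow> y \<in> U \<Longrightarrow> z \<in> U \<Longrightarrow> y \<sim> z \<Longrightarrow> P y \<Longrightarrow> P z"
  shows "P y"
proof -
  have x: "x \<in> U" and r: "(x, y) \<in> {(a, b). a \<in> U \<and> b \<in> U \<and> a \<sim> b}\<^sup>*"
    using assms(1) by (auto simp: conn_def)
  from r show ?thesis
  proof (induction rule: rtrancl_induct)
    case (step y z)
    then have "(x, y) \<in> conn U" using x by (simp add: conn_def)
    then show ?case using step assms(3) by blast
  qed (fact assms(2))
qed

lemma conn_sym: 
  assumes "(x, y) \<in> conn U" shows "(y, x) \<in> conn U"
  using assms
proof (induction rule: conn_induct)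
  case base then show ?case using assms conn_in conn_refl by blast
next
  case (step y z) then show ?case by (meson adj_sym conn_step conn_trans)
qed

lemma conn_mono: 
  assumes "U \<subseteq> W" "(x, y) \<in> conn U" shows "(x, y) \<in> conn W"
  using assms(2)
proof (induction rule: conn_induct)
  case base then show ?case using assms conn_in conn_refl by blast
next
  case (step y z) then show ?case using assms(1) by (meson conn_step conn_trans subsetD)
qed

text \<open>
  A walk that starts in a set which is closed under adjacency never leaves it, so it is also a walk
  in that set. This is how connectivity is localised to one side of a separation.
\<close>
lemma conn_closed:
  assumes "(x, y) \<in> conn U" "x \<in> A" and closed: "\<And>a b. a \<in> A \<Longrightarrow> a \<in> U \<Longrightarrow> b \<in> U \<Longrightarrow> a \<sim> b \<Longrightarrow> b \<in> A"
  shows "(x, y) \<in> conn (A \<inter> U)"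
  using assms(1)
proof (induction rule: conn_induct)
  case base
  have "x \<in> A \<inter> U" using assms(2) conn_in(1)[OF assms(1)] by simp
  then show ?case by (rule conn_refl)
next
  case (step y z)
  have y: "y \<in> A" using conn_in(2)[OF step.IH] by simp
  have "z \<in> A" using closed[OF y step.hyps(2,3,4)] .
  then have "(y, z) \<in> conn (A \<inter> U)" using y step.hyps by (intro conn_step) auto
  then show ?case using step.IH conn_trans by blast
qed

lemma conn_closed_in:
  assumes "(x, y) \<in> conn U" "x \<in> A" and "\<And>a b. a \<in> A \<Longrightarrow> a \<in> U \<Longrightarrow> b \<in> U \<Longrightarrow> a \<sim> b \<Longrightarrow> b \<in> A"
  shows "y \<in> A"
  using conn_in(2)[OF conn_closed[OF assms]] by simp

lemma equiv_conn: "equiv U (conn U)"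
proof (rule equivI)
  show "conn U \<subseteq> U \<times> U" by (auto dest: conn_in)
  show "refl_on U (conn U)" by (auto intro!: refl_onI conn_refl)
  show "sym (conn U)" by (auto intro!: symI conn_sym)
  show "trans (conn U)" by (auto intro!: transI intro: conn_trans)
qed

definition no_edges :: "'a set \<Rightarrow> 'a set \<Rightarrow> bool" where
  "no_edges A B \<longleftrightarrow> A \<inter> B = {} \<and> (\<forall>a\<in>A. \<forall>b\<in>B. \<not> a \<sim> b)"

lemma no_edges_sym: "no_edges A B \<Longrightarrow> no_edges B A"
  by (auto simp: no_edges_def dest: adj_sym)

lemma conn_Un_left:
  assumes "no_edges A B" "x \<in> A"
  shows "(x, y) \<in> conn (A \<union> B) \<longleftrightarrow> (x, y) \<in> conn A"
proof
  assume "(x, y) \<in> conn (A \<union> B)"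
  then have "(x, y) \<in> conn (A \<inter> (A \<union> B))"
    by (rule conn_closed) (use assms in \<open>auto simp: no_edges_def\<close>)
  then show "(x, y) \<in> conn A" by (simp add: Int_absorb2)
qed (auto intro: conn_mono)

text \<open>
  Connectivity in a union without edges between the parts is connectivity in the parts, so the
  quotients are just put side by side.
\<close>
lemma component_count_Un:
  assumes "finite A" "finite B" "no_edges A B"
  shows "component_count (A \<union> B) = component_count A + component_count B"
proof -
  have A: "conn (A \<union> B) `` {x} = conn A `` {x}" if "x \<in> A" for x
    using conn_Un_left[OF assms(3) that] by auto
  have B: "conn (A \<union> B) `` {x} = conn B `` {x}" if "x \<in> B" for x
    using conn_Un_left[OF no_edges_sym[OF assms(3)] that] by (auto simp: Un_commute)
  have "(A \<union> B) // conn (A \<union> B) = A // conn A \<union> B // conn B"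
    unfolding quotient_def using A B by auto
  moreover have "A // conn A \<inter> B // conn B = {}"
  proof (rule ccontr)
    assume "A // conn A \<inter> B // conn B \<noteq> {}"
    then obtain X where X: "X \<in> A // conn A" "X \<in> B // conn B" by auto
    then have "X \<subseteq> A" "X \<subseteq> B" "X \<noteq> {}"
      using equiv_conn in_quotient_imp_subset in_quotient_imp_non_empty by metis+
    then show False using assms(3) by (auto simp: no_edges_def)
  qed
  ultimately show ?thesis unfolding component_count_def
    using assms by (simp add: card_Un_disjoint finite_quotient equiv_type[OF equiv_conn])
qed

lemma component_count_connected:
  assumes "U \<noteq> {}" "\<And>x y. x \<in> U \<Longrightarrow> y \<in> U \<Longrightarrow> (x, y) \<in> conn U"
  shows "component_count U = 1"
proof -
  have "conn U `` {x} = U" if "x \<in> U" for x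
  proof (intro subset_antisym subsetI)
    show "y \<in> U" if "y \<in> conn U `` {x}" for y using that conn_in(2) by auto
    show "y \<in> conn U `` {x}" if "y \<in> U" for y using assms(2)[OF \<open>x \<in> U\<close> that] by simp
  qed
  then have "U // conn U = {U}" using assms(1) by (auto simp: quotient_def)
  then show ?thesis by (simp add: component_count_def)
qed

text \<open>
  A walk in \<open>insert s U\<close> that passes through \<open>s\<close> enters and leaves it by neighbours of \<open>s\<close>, and these all
  lie in one component of \<open>U\<close>.
\<close>
lemma conn_insert_nonseparating:
  assumes "\<not> separates s U" "x \<in> U" "y \<in> U" "(x, y) \<in> conn (insert s U)"
  shows "(x, y) \<in> conn U"
proof -
  have "(y \<in> U \<longrightarrow> (x, y) \<in> conn U) \<and> (y \<notin> U \<longrightarrow> (\<exists>i\<in>U. s \<sim> i \<and> (x, i) \<in> conn U))"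
    using assms(4)
  proof (induction rule: conn_induct)
    case base then show ?case using assms(2) conn_refl by simp
  next
    case (step y z)
    consider "y \<in> U" "z \<in> U" | "y \<in> U" "z \<notin> U" "z = s" | "y \<notin> U" "y = s" "z \<in> U"
      | "y = s" "z = s" using step.hyps by blast
    then show ?case
    proof cases
      case 1 then show ?thesis using step by (meson conn_step conn_trans)
    next
      case 2 then show ?thesis using step adj_sym by blast
    next
      case 3
      then obtain i where i: "i \<in> U" "s \<sim> i" "(x, i) \<in> conn U" using step.IH by blast
      have "s \<sim> z" using 3 step by simp
      then have "(i, z) \<in> conn U" using assms(1) i 3 unfolding separates_def by blast
      then show ?thesis using i 3 conn_trans by blast
    next
      case 4 then show ?thesis using step adj_irrefl by blast
    qed
  qed
  then show ?thesis using assms(3) by blast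
qed

text \<open>
  Adding \<open>s\<close> maps components of \<open>U\<close> to components of \<open>insert s U\<close>. The map is injective when \<open>s\<close>
  joins no two of them, and surjective but not injective when it does.
\<close>
lemma component_count_insert_less_iff:
  assumes "finite U" "s \<notin> U"
  shows "component_count (insert s U) < component_count U \<longleftrightarrow> separates s U"
proof -
  let ?f = "\<lambda>X. conn (insert s U) `` X"
  let ?Q = "U // conn U" and ?R = "insert s U // conn (insert s U)"
  have E: "equiv (insert s U) (conn (insert s U))" by (rule equiv_conn)
  have f: "?f (conn U `` {x}) = conn (insert s U) `` {x}" if "x \<in> U" for x
    using that conn_refl[of x U] by (auto intro: conn_trans conn_mono[of U "insert s U"])
  have fin: "finite ?Q" "finite ?R"
    using assms by (auto intro!: finite_quotient equiv_type[OF equiv_conn])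
  have img: "?f ` ?Q \<subseteq> ?R" using f by (auto simp: quotient_def)
  show ?thesis
  proof
    assume less: "component_count (insert s U) < component_count U"
    show "separates s U"
    proof (rule ccontr)
      assume n: "\<not> separates s U"
      have "inj_on ?f ?Q"
      proof (rule inj_onI)
        fix X Y assume X: "X \<in> ?Q" and Y: "Y \<in> ?Q" and eq: "?f X = ?f Y"
        obtain x y where x: "x \<in> U" "X = conn U `` {x}" and y: "y \<in> U" "Y = conn U `` {y}"
          using X Y by (auto simp: quotient_def)
        have "conn (insert s U) `` {x} = conn (insert s U) `` {y}" using eq x y f by simp
        then have "(x, y) \<in> conn (insert s U)"
          using x y eq_equiv_class_iff[OF E] by simp
        then have "(x, y) \<in> conn U" using conn_insert_nonseparating[OF n] x y by blast
        then show "X = Y" using x y eq_equiv_class_iff[OF equiv_conn[of U]] by simp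
      qed
      then have "card ?Q \<le> card ?R" using img fin card_inj_on_le by blast
      then show False using less by (simp add: component_count_def)
    qed
  next
    assume "separates s U"
    then obtain i j where ij: "i \<in> U" "j \<in> U" "s \<sim> i" "s \<sim> j" "(i, j) \<notin> conn U"
      unfolding separates_def by blast
    have si: "(s, i) \<in> conn (insert s U)" using ij by (intro conn_step) auto
    have "?R \<subseteq> ?f ` ?Q"
    proof
      fix X assume "X \<in> ?R"
      then obtain x where x: "x \<in> insert s U" "X = conn (insert s U) `` {x}"
        by (auto simp: quotient_def)
      have "\<exists>x'\<in>U. X = conn (insert s U) `` {x'}"
      proof (cases "x = s")
        case True
        then have "X = conn (insert s U) `` {i}" using x si equiv_class_eq[OF E] by simp
        then show ?thesis using ij by blast
      qed (use x in blast)
      then show "X \<in> ?f ` ?Q" using f by (auto simp: quotient_def)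
    qed
    then have R: "?R = ?f ` ?Q" using img by blast
    have "(i, j) \<in> conn (insert s U)"
      using ij by (meson adj_sym conn_step conn_trans insertI1 insertI2)
    then have "?f (conn U `` {i}) = ?f (conn U `` {j})"
      using f ij equiv_class_eq[OF E] by simp
    moreover have "conn U `` {i} \<noteq> conn U `` {j}"
      using ij eq_equiv_class_iff[OF equiv_conn[of U]] by simp
    moreover have "conn U `` {i} \<in> ?Q" "conn U `` {j} \<in> ?Q" using ij by (auto simp: quotient_def)
    ultimately have "\<not> inj_on ?f ?Q" unfolding inj_on_def by blast
    then have "card ?R < card ?Q" unfolding R using fin(1) card_image_le eq_card_imp_inj_on
      by (metis le_neq_implies_less)
    then show "component_count (insert s U) < component_count U" by (simp add: component_count_def)
  qed
qed

lemma separates_antimono: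
  assumes "separates s U" "W \<subseteq> U" "\<And>i. i \<in> U \<Longrightarrow> s \<sim> i \<Longrightarrow> i \<in> W"
  shows "separates s W"
  using assms conn_mono[of W U] unfolding separates_def by blast

lemma separates_Un:
  assumes "separates s A" "no_edges A B"
  shows "separates s (A \<union> B)"
  using assms conn_Un_left unfolding separates_def by blast

text \<open>
  If \<open>z\<close> is the only exit from \<open>B\<close>, then a walk from \<open>B\<close> to \<open>z\<close> reaches \<open>z\<close> for the first
  time before it can see anything outside \<open>insert z B\<close>.
\<close>
lemma conn_to_cut:
  assumes "(x, z) \<in> conn V" "x \<in> B" "z \<notin> B"
    and "\<And>a b. a \<in> B \<Longrightarrow> b \<in> V \<Longrightarrow> a \<sim> b \<Longrightarrow> b \<in> insert z B"
  shows "(x, z) \<in> conn (insert z B)"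
proof -
  have "y \<in> B \<and> (x, y) \<in> conn (insert z B) \<or> (x, z) \<in> conn (insert z B)" if "(x, y) \<in> conn V" for y
    using that
  proof (induction rule: conn_induct)
    case base
    have "(x, x) \<in> conn (insert z B)" using assms(2) by (intro conn_refl) simp
    then show ?case using assms(2) by simp
  next
    case (step y w)
    show ?case
    proof (cases "(x, z) \<in> conn (insert z B)")
      case False
      then have y: "y \<in> B" "(x, y) \<in> conn (insert z B)" using step.IH by auto
      then have w: "w \<in> insert z B" using assms(4) step by simp
      then have "(y, w) \<in> conn (insert z B)"
        using y step by (intro conn_step) auto
      then have "(x, w) \<in> conn (insert z B)"
        using y conn_trans by blast
      then show ?thesis using w by auto
    qed simp
  qed
  from this[OF assms(1)] show ?thesis using assms(3) by auto
qed

text \<open>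
  Take a smallest \<open>S \<subseteq> S0\<close> that still separates \<open>a\<close> from \<open>b\<close>. Putting back any \<open>s \<in> S\<close> connects
  them again, so \<open>s\<close> must have joined two components.
\<close>
lemma minimal_separator_cutset:
  assumes "finite S0" "S0 \<subseteq> V" "a \<in> V - S0" "b \<in> V - S0" "(a, b) \<notin> conn (V - S0)" "(a, b) \<in> conn V"
  shows "\<exists>S\<subseteq>S0. S \<noteq> {} \<and> cutset V S"
proof -
  let ?P = "\<lambda>S. S \<subseteq> S0 \<and> (a, b) \<notin> conn (V - S)"
  obtain S where S: "?P S" and min: "\<And>T. ?P T \<Longrightarrow> card S \<le> card T"
    using ex_has_least_nat[of ?P S0 card] assms by blast
  have "separates s (V - S)" if s: "s \<in> S" for s
  proof (rule ccontr)
    assume n: "\<not> separates s (V - S)"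
    have fS: "finite S" using S assms(1) finite_subset by blast
    have eq: "V - (S - {s}) = insert s (V - S)" using s S assms(2) by blast
    have "card (S - {s}) < card S" using fS s by (rule card_Diff1_less)
    then have "(a, b) \<in> conn (insert s (V - S))" using min[of "S - {s}"] S eq by force
    then have "(a, b) \<in> conn (V - S)"
      using conn_insert_nonseparating[OF n] assms S by blast
    then show False using S by blast
  qed
  moreover have "S \<noteq> {}" using S assms(6) by auto
  ultimately show ?thesis using S assms(2) unfolding cutset_def by blast
qed

end

section \<open>Simplicial vertices of chordal graphs\<close>

context adjacency begin

text \<open>
  The form in which chordality is used: two neighbours \<open>x, y\<close> of \<open>v\<close> are adjacent if
  they are linked through a connected set \<open>D\<close> that \<open>v\<close> does not see. Unlike the absence of long
  induced cycles, it speaks about connectivity and can be applied without producing a cycle.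
\<close>
definition chordal_on :: "'a set \<Rightarrow> bool" where
  "chordal_on V \<longleftrightarrow> (\<forall>v\<in>V. \<forall>x\<in>V. \<forall>y\<in>V. \<forall>D\<subseteq>V. \<forall>d e.
     v \<sim> x \<longrightarrow> v \<sim> y \<longrightarrow> x \<noteq> y \<longrightarrow> (\<forall>d\<in>D. d \<noteq> v \<and> \<not> v \<sim> d) \<longrightarrow>
     (d, e) \<in> conn D \<longrightarrow> x \<sim> d \<longrightarrow> y \<sim> e \<longrightarrow> x \<sim> y)"

lemma chordal_onD:
  assumes "chordal_on V" "v \<in> V" "x \<in> V" "y \<in> V" "D \<subseteq> V" "v \<sim> x" "v \<sim> y" "x \<noteq> y"
    "\<forall>d\<in>D. d \<noteq> v \<and> \<not> v \<sim> d" "(d, e) \<in> conn D" "x \<sim> d" "y \<sim> e"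
  shows "x \<sim> y"
  using assms(1)[unfolded chordal_on_def, rule_format, of v x y D d e] assms(2-) by simp

text \<open>
  Dirac's theorem, in the form that supports induction: a vertex \<open>v\<close> that is not adjacent to everything
  has a simplicial vertex away from it. A component \<open>D\<close> of the non-neighbours of \<open>v\<close> is attached
  to the rest only through the set \<open>N\<close> of neighbours of \<open>v\<close> that see \<open>D\<close>, and \<open>N\<close> is a clique by chordality. A
  simplicial vertex of the smaller graph \<open>D \<union> N\<close> that happens to lie in \<open>D\<close> is simplicial in the whole
  graph, since \<open>D \<union> N\<close> contains all its neighbours.
\<close>
lemma exists_simplicial_nonadjacent:
  assumes "chordal_on V" "finite V"
  shows "W \<subseteq> V \<Longrightarrow> v \<in> W \<Longrightarrow> u \<in> W \<Longrightarrow> u \<noteq> v \<Longrightarrow> \<not> v \<sim> u \<Longrightarrow>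
    \<exists>z. simplicial W z \<and> z \<noteq> v \<and> \<not> v \<sim> z"
proof (induction "card W" arbitrary: W v u rule: less_induct)
  case less
  have finW: "finite W" using less.prems assms(2) finite_subset by blast
  define W0 where "W0 = {x \<in> W. x \<noteq> v \<and> \<not> v \<sim> x}"
  define D where "D = conn W0 `` {u}"
  define N where "N = {x \<in> W. v \<sim> x \<and> (\<exists>d\<in>D. x \<sim> d)}"
  have uD: "u \<in> D" using less.prems by (auto simp: D_def W0_def intro: conn_refl)
  have DW0: "D \<subseteq> W0" using conn_in by (auto simp: D_def)
  have D_nbr: "x \<in> D \<union> N" if "d \<in> D" "x \<in> W" "d \<sim> x" for d x
  proof (cases "v \<sim> x")
    case True then show ?thesis using that adj_sym by (auto simp: N_def)
  next
    case False
    have "x \<noteq> v" using that DW0 adj_sym by (auto simp: W0_def)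
    then have "x \<in> W0" using False that by (simp add: W0_def)
    have "(u, d) \<in> conn W0" using that(1) by (simp add: D_def)
    moreover have "(d, x) \<in> conn W0"
      by (rule conn_step) (use \<open>x \<in> W0\<close> that DW0 in auto)
    ultimately have "(u, x) \<in> conn W0" by (rule conn_trans)
    then show ?thesis by (simp add: D_def)
  qed
  have connD: "(d, e) \<in> conn D" if "d \<in> D" "e \<in> D" for d e
  proof -
    have "(u, d) \<in> conn W0" "(u, e) \<in> conn W0" using that by (simp_all add: D_def)
    then have "(d, e) \<in> conn W0" by (rule conn_trans[OF conn_sym])
    then have "(d, e) \<in> conn (D \<inter> W0)"
    proof (rule conn_closed)
      fix a b assume ab: "a \<in> D" "a \<in> W0" "b \<in> W0" "a \<sim> b"
      then have "(u, a) \<in> conn W0" by (simp add: D_def)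
      then have "(u, b) \<in> conn W0" using conn_step[OF ab(2-4)] by (rule conn_trans)
      then show "b \<in> D" by (simp add: D_def)
    qed (fact that(1))
    then show ?thesis using DW0 by (simp add: Int_absorb2)
  qed
  have Nclique: "x \<sim> y" if xy: "x \<in> N" "y \<in> N" "x \<noteq> y" for x y
  proof -
    obtain d e where de: "d \<in> D" "e \<in> D" "x \<sim> d" "y \<sim> e" using xy unfolding N_def by blast
    have "v \<in> V" "x \<in> V" "y \<in> V" "D \<subseteq> V" "v \<sim> x" "v \<sim> y" "\<forall>d\<in>D. d \<noteq> v \<and> \<not> v \<sim> d"
      using that less.prems DW0 unfolding N_def W0_def by blast+
    then show ?thesis
      using chordal_onD[OF assms(1) _ _ _ _ _ _ that(3) _ connD[OF de(1,2)] de(3,4)] by simp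
  qed
  define W' where "W' = D \<union> N"
  have W'W: "W' \<subseteq> W" using DW0 by (auto simp: W'_def W0_def N_def)
  have "v \<notin> W'" using DW0 adj_irrefl by (auto simp: W'_def W0_def N_def)
  then have card: "card W' < card W" using W'W less.prems(2) finW by (metis psubsetI psubset_card_mono)
  have W'V: "W' \<subseteq> V" using W'W less.prems by blast
  have *: "\<exists>z. simplicial W z \<and> z \<noteq> v \<and> \<not> v \<sim> z" if z: "simplicial W' z" "z \<in> D" for z
  proof -
    have "simplicial W z" unfolding simplicial_def
    proof (intro conjI ballI impI)
      show "z \<in> W" using z W'W by (auto simp: simplicial_def)
      fix x y assume "x \<in> W" "y \<in> W" "z \<sim> x" "z \<sim> y" "x \<noteq> y"
      then show "x \<sim> y" using z D_nbr[OF z(2)] unfolding simplicial_def W'_def by blast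
    qed
    then show ?thesis using z DW0 by (auto simp: W0_def)
  qed
  \<comment> \<open>To force the simplicial vertex of \<open>D \<union> N\<close> into \<open>D\<close>, apply induction away from some \<open>x \<in> N\<close> if there is one
    with a non-neighbour, since the rest of the clique \<open>N\<close> is adjacent to \<open>x\<close>. Otherwise all of \<open>N\<close> is
    universal in \<open>D \<union> N\<close>, so induction away from some \<open>x \<in> D\<close> avoids it; and if \<open>D \<union> N\<close> is a
    clique, any vertex of \<open>D\<close> will do.\<close>
  consider (a) x y where "x \<in> N" "y \<in> W'" "y \<noteq> x" "\<not> x \<sim> y"
    | (b) x y where "\<forall>x\<in>N. \<forall>y\<in>W'. y \<noteq> x \<longrightarrow> x \<sim> y" "x \<in> D" "y \<in> W'" "y \<noteq> x" "\<not> x \<sim> y"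
    | (c) "\<forall>x\<in>W'. \<forall>y\<in>W'. y \<noteq> x \<longrightarrow> x \<sim> y"
    unfolding W'_def by blast
  then show ?case
  proof cases
    case a
    then obtain z where z: "simplicial W' z" "z \<noteq> x" "\<not> x \<sim> z"
      using less.hyps[OF card W'V, of x y] W'_def by blast
    then have "z \<in> D" using Nclique a by (auto simp: simplicial_def W'_def)
    then show ?thesis using * z by blast
  next
    case b
    then obtain z where z: "simplicial W' z" "z \<noteq> x" "\<not> x \<sim> z"
      using less.hyps[OF card W'V, of x y] W'_def by blast
    have "z \<notin> N"
    proof
      assume "z \<in> N"
      then have "z \<sim> x" using b(1,2) z(2) by (auto simp: W'_def)
      then show False using z(3) adj_sym by simp
    qed
    then have "z \<in> D" using z(1) by (simp add: simplicial_def W'_def)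
    then show ?thesis using * z by blast
  next
    case c
    have "u \<in> W'" using uD by (simp add: W'_def)
    then have "simplicial W' u" using c by (simp add: simplicial_def)
    then show ?thesis using * uD by simp
  qed
qed

text \<open>
  If \<open>v\<close> is adjacent to everything else, vertices that are simplicial after deleting \<open>v\<close> remain so.
\<close>
lemma exists_simplicial_other:
  assumes "chordal_on V" "finite V" "W \<subseteq> V" "v \<in> W" "W \<noteq> {v}"
  shows "\<exists>z. simplicial W z \<and> z \<noteq> v"
proof (cases "\<exists>u\<in>W. u \<noteq> v \<and> \<not> v \<sim> u")
  case True
  then show ?thesis using exists_simplicial_nonadjacent[OF assms(1-4)] by blast
next
  case universal: False
  have lift: "simplicial W z" if z: "simplicial (W - {v}) z" for z
    unfolding simplicial_def
  proof (intro conjI ballI impI)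
    show "z \<in> W" using z by (simp add: simplicial_def)
    fix x y assume xy: "x \<in> W" "y \<in> W" "z \<sim> x" "z \<sim> y" "x \<noteq> y"
    consider "x = v" | "y = v" | "x \<noteq> v" "y \<noteq> v" by blast
    then show "x \<sim> y"
    proof cases
      case 1
      then have "v \<sim> y" using universal xy by auto
      then show ?thesis using 1 by simp
    next
      case 2
      then have "v \<sim> x" using universal xy by auto
      then show ?thesis using 2 adj_sym by simp
    next
      case 3 then show ?thesis using z xy by (simp add: simplicial_def)
    qed
  qed
  show ?thesis
  proof (cases "\<exists>x\<in>W-{v}. \<exists>y\<in>W-{v}. y \<noteq> x \<and> \<not> x \<sim> y")
    case True
    then obtain x y where "x \<in> W - {v}" "y \<in> W - {v}" "y \<noteq> x" "\<not> x \<sim> y" by blast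
    then obtain z where "simplicial (W - {v}) z"
      using exists_simplicial_nonadjacent[OF assms(1,2), of "W - {v}" x y] assms(3) by auto
    moreover from this have "z \<noteq> v" by (simp add: simplicial_def)
    ultimately show ?thesis using lift by blast
  next
    case False
    obtain z where "z \<in> W - {v}" using assms(4,5) by blast
    then have "simplicial (W - {v}) z" using False unfolding simplicial_def by metis
    then show ?thesis using lift \<open>z \<in> W - {v}\<close> by blast
  qed
qed

text \<open>
  The obstruction to unmixedness after deleting a cut vertex \<open>v\<close>: a cut set of the side \<open>H\<close> that swallows all
  neighbours of \<open>v\<close> in \<open>H\<close>. Such a set stays a cut set of \<open>V - {v}\<close>; but once it is removed, \<open>v\<close> no
  longer touches \<open>H\<close>, so adding \<open>v\<close> to it need not give a cut set of \<open>V\<close>.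
\<close>
definition bad_side :: "'a set \<Rightarrow> 'a \<Rightarrow> 'a set \<Rightarrow> bool" where
  "bad_side V v H \<longleftrightarrow> H \<in> (V - {v}) // conn (V - {v}) \<and>
     (\<exists>S. cutset H S \<and> (\<forall>x\<in>H. v \<sim> x \<longrightarrow> x \<in> S))"

lemma component_props:
  assumes "H \<in> U // conn U"
  shows "H \<subseteq> U" "H \<noteq> {}" "\<And>x y. x \<in> H \<Longrightarrow> y \<in> H \<Longrightarrow> (x, y) \<in> conn H"
    "\<And>x y. x \<in> H \<Longrightarrow> y \<in> U \<Longrightarrow> x \<sim> y \<Longrightarrow> y \<in> H" "no_edges H (U - H)" "\<And>x. x \<in> H \<Longrightarrow> H = conn U `` {x}"
proof -
  show 1: "H \<subseteq> U" "H \<noteq> {}"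
    using assms equiv_conn in_quotient_imp_subset in_quotient_imp_non_empty by metis+
  show 2: "y \<in> H" if "x \<in> H" "y \<in> U" "x \<sim> y" for x y
    using in_quotient_imp_closed[OF equiv_conn assms that(1)] conn_step that 1 by blast
  show "(x, y) \<in> conn H" if "x \<in> H" "y \<in> H" for x y
  proof -
    have "(x, y) \<in> conn U" using that assms equiv_conn quotient_eq_iff by metis
    then have "(x, y) \<in> conn (H \<inter> U)" using that 2 by (intro conn_closed) auto
    then show ?thesis using 1 by (simp add: Int_absorb2)
  qed
  show "no_edges H (U - H)" using 2 unfolding no_edges_def by blast
  show "H = conn U `` {x}" if "x \<in> H" for x
    using assms equiv_conn that by (metis Image_singleton_iff equiv_class_eq_iff quotientE)
qed

text \<open>
  Without bad sides, \<open>v\<close> keeps a neighbour outside \<open>S\<close> in each of two components of \<open>V - {v}\<close>. Hence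
  \<open>insert v S\<close> is a cut set of \<open>V\<close>, with one element more than \<open>S\<close>.
\<close>
lemma no_bad_side_cut_vertex:
  assumes "finite V" and tight: "\<And>S. cutset V S \<Longrightarrow> component_count (V - S) = card S + 1"
    and v: "v \<in> V" "cutset V {v}" and good: "\<And>H. \<not> bad_side V v H"
    and S: "cutset (V - {v}) S"
  shows "component_count (V - {v} - S) = card S + 2"
proof -
  have eq: "V - insert v S = V - {v} - S" by blast
  obtain i j where ij: "i \<in> V - {v}" "j \<in> V - {v}" "v \<sim> i" "v \<sim> j" "(i, j) \<notin> conn (V - {v})"
    using v by (auto simp: cutset_def separates_def)
  have nbr: "\<exists>x\<in>H - S. v \<sim> x" if H: "H \<in> (V - {v}) // conn (V - {v})" for H
  proof (rule ccontr)
    assume n: "\<not> (\<exists>x\<in>H - S. v \<sim> x)"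
    note P = component_props[OF H]
    have "cutset H (H \<inter> S)" unfolding cutset_def
    proof (intro conjI ballI)
      fix s assume s: "s \<in> H \<inter> S"
      then have "separates s (V - {v} - S)" using S by (auto simp: cutset_def)
      then show "separates s (H - H \<inter> S)"
        by (rule separates_antimono) (use P s in auto)
    qed auto
    then have "bad_side V v H" unfolding bad_side_def using H n by blast
    then show False using good by blast
  qed
  define H1 where "H1 = conn (V - {v}) `` {i}"
  define H2 where "H2 = conn (V - {v}) `` {j}"
  have H1: "H1 \<in> (V - {v}) // conn (V - {v})" and H2: "H2 \<in> (V - {v}) // conn (V - {v})"
    using ij by (auto simp: H1_def H2_def intro: quotientI)
  obtain x y where xy: "x \<in> H1 - S" "v \<sim> x" "y \<in> H2 - S" "v \<sim> y" using nbr H1 H2 by meson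
  have "(x, y) \<notin> conn (V - {v} - S)"
  proof
    assume "(x, y) \<in> conn (V - {v} - S)"
    then have "(x, y) \<in> conn (V - {v})" using conn_mono[of "V - {v} - S" "V - {v}"] by blast
    then have "(i, j) \<in> conn (V - {v})" using xy conn_sym conn_trans unfolding H1_def H2_def by blast
    then show False using ij by blast
  qed
  moreover have "x \<in> V - {v} - S" "y \<in> V - {v} - S"
    using xy component_props(1)[OF H1] component_props(1)[OF H2] by blast+
  ultimately have "separates v (V - {v} - S)" using xy unfolding separates_def by blast
  then have "cutset V (insert v S)" using S v unfolding cutset_def eq by blast
  moreover have "v \<notin> S" "finite S" using S assms(1) by (auto simp: cutset_def intro: finite_subset)
  ultimately show ?thesis using tight[of "insert v S"] eq by simp
qed

text \<open>
  Accessibility removes elements one at a time, and the last nonempty set met on the way is a singleton.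
\<close>
lemma accessible_contains_cut_vertex:
  assumes "finite S" "\<And>S. cutset V S \<Longrightarrow> S \<noteq> {} \<Longrightarrow> \<exists>s\<in>S. cutset V (S - {s})"
    "cutset V S" "S \<noteq> {}"
  shows "\<exists>w\<in>S. cutset V {w}"
  using assms(1,3,4)
proof (induction "card S" arbitrary: S rule: less_induct)
  case less
  obtain s where s: "s \<in> S" "cutset V (S - {s})" using assms(2) less.prems by blast
  show ?case
  proof (cases "S - {s} = {}")
    case True
    then have "S = {s}" using s by blast
    then show ?thesis using less.prems by blast
  next
    case False
    then show ?thesis using less.hyps[of "S - {s}"] less.prems s
      by (metis DiffD1 card_Diff1_less finite_Diff)
  qed
qed

end

context adjacency begin

text \<open>
  Among the walks from \<open>x\<close> to \<open>y\<close> with interior in \<open>D\<close>, a shortest one is an induced path. Closing it up with \<open>v\<close>, which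
  is adjacent to its two ends only, gives an induced cycle. Its length is at least four unless \<open>x \<sim> y\<close>.
\<close>
lemma chordal_onI:
  assumes no_cycle: "\<And>vs. 4 \<le> length vs \<Longrightarrow> distinct vs \<Longrightarrow> set vs \<subseteq> V \<Longrightarrow>
      (\<And>i j. i < length vs \<Longrightarrow> j < length vs \<Longrightarrow>
        vs ! i \<sim> vs ! j \<longleftrightarrow> j = Suc i mod length vs \<or> i = Suc j mod length vs) \<Longrightarrow> False"
  shows "chordal_on V"
  unfolding chordal_on_def
proof (intro ballI allI impI, rule ccontr)
  fix v x y D d e
  assume V: "v \<in> V" "x \<in> V" "y \<in> V" "D \<subseteq> V" and vx: "v \<sim> x" and vy: "v \<sim> y" and xy: "x \<noteq> y"
    and D: "\<forall>d\<in>D. d \<noteq> v \<and> \<not> v \<sim> d" and de: "(d, e) \<in> conn D" "x \<sim> d" "y \<sim> e" and nadj: "\<not> x \<sim> y"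
  define path where "path z n f \<longleftrightarrow> n \<ge> (1::nat) \<and> f 0 = x \<and> f n = z \<and> (\<forall>i. 0 < i \<and> i < n \<longrightarrow> f i \<in> D)
    \<and> (\<forall>i<n. f i \<sim> f (Suc i))" for z n and f :: "nat \<Rightarrow> 'a"
  have extend: "path z' (Suc n) (f(Suc n := z'))" if "path z n f" "z \<in> D" "z \<sim> z'" for z z' n f
    using that unfolding path_def by (auto simp: less_Suc_eq)
  have "\<exists>n f. path e n f" using de(1)
  proof (induction rule: conn_induct)
    case base
    have "path d 1 (\<lambda>i. if i = 0 then x else d)" using de(2) by (simp add: path_def)
    then show ?case by blast
  next
    case (step z z')
    then show ?case using extend by meson
  qed
  then obtain n0 f0 where "path e n0 f0" by blast
  then have "path y (Suc n0) (f0(Suc n0 := y))"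
    using extend conn_in(2)[OF de(1)] adj_sym[OF de(3)] by simp
  then have ex: "\<exists>n. \<exists>f. path y n f" by blast
  define n where "n = (LEAST n. \<exists>f. path y n f)"
  obtain f where f: "path y n f" using LeastI_ex[OF ex] unfolding n_def by blast
  have least: "n \<le> m" if "path y m g" for m g unfolding n_def by (rule Least_le) (use that in blast)
  have f0: "f 0 = x" "f n = y" "n \<ge> 1" and fD: "\<And>i. 0 < i \<Longrightarrow> i < n \<Longrightarrow> f i \<in> D"
    and fs: "\<And>i. i < n \<Longrightarrow> f i \<sim> f (Suc i)" using f by (auto simp: path_def)
  have "n \<noteq> 1" using fs[of 0] f0 nadj by auto
  then have n2: "n \<ge> 2" using f0(3) by simp
  have chordless: "j = Suc i" if ij: "i < j" "j \<le> n" "f i \<sim> f j" for i j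
  proof (rule ccontr)
    assume "j \<noteq> Suc i"
    then have j: "Suc i < j" using ij by simp
    define l where "l = j - Suc i"
    have l: "l > 0" "Suc i + l = j" using j by (auto simp: l_def)
    \<comment> \<open>A chord from \<open>i\<close> to \<open>j\<close> cuts out the \<open>l\<close> vertices in between.\<close>
    define g where "g k = (if k \<le> i then f k else f (k + l))" for k
    have "path y (n - l) g" unfolding path_def
    proof (intro conjI allI impI)
      show "1 \<le> n - l" using ij l by simp
      show "g 0 = x" using f0 by (simp add: g_def)
      show "g (n - l) = y" using ij l f0 by (auto simp: g_def)
      show "g k \<in> D" if "0 < k \<and> k < n - l" for k using that ij l fD[of k] fD[of "k + l"] by (auto simp: g_def)
      show "g k \<sim> g (Suc k)" if "k < n - l" for k
      proof (cases "k = i")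
        case True then show ?thesis using ij(3) l by (simp add: g_def)
      next
        case False then show ?thesis using that ij l fs[of k] fs[of "k + l"] by (auto simp: g_def)
      qed
    qed
    then have "n \<le> n - l" by (rule least)
    then show False using l ij by simp
  qed
  have inj: "i = j" if "i \<le> n" "j \<le> n" "f i = f j" for i j
  proof -
    have "False" if ij: "i < j" "j \<le> n" "f i = f j" for i j
    proof (cases "j < n")
      case True
      then have "f i \<sim> f (Suc j)" using fs[of j] ij by simp
      then have "Suc j = Suc i" using chordless[of i "Suc j"] True ij by simp
      then show False using ij by simp
    next
      case False
      then have j: "j = n" using ij by simp
      show False
      proof (cases "i = 0")
        case True then show ?thesis using ij j f0 xy by simp
      next
        case False
        then have "f (i - 1) \<sim> f n" using fs[of "i - 1"] ij j by simp
        moreover have "i - 1 < n" using ij j by linarith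
        ultimately have "n = Suc (i - 1)" using chordless[of "i - 1" n] by simp
        then show ?thesis using ij j False by simp
      qed
    qed
    then show ?thesis using that by (metis linorder_neqE_nat)
  qed
  have vf: "v \<noteq> f i" if "i \<le> n" for i
    using that D fD[of i] f0 vx vy adj_irrefl by (cases "i = 0 \<or> i = n") auto
  have vadj: "v \<sim> f i \<longleftrightarrow> i = 0 \<or> i = n" if "i \<le> n" for i
    using that D fD[of i] f0 vx vy by (cases "i = 0 \<or> i = n") auto
  have fadj: "f i \<sim> f j \<longleftrightarrow> j = Suc i \<or> i = Suc j" if "i \<le> n" "j \<le> n" for i j
  proof
    assume a: "f i \<sim> f j"
    then have "i \<noteq> j" using adj_irrefl by auto
    then consider "i < j" | "j < i" by linarith
    then show "j = Suc i \<or> i = Suc j"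
      using chordless[of i j] chordless[of j i] a adj_sym[OF a] that by cases auto
  next
    assume "j = Suc i \<or> i = Suc j"
    then show "f i \<sim> f j" using fs[of i] fs[of j] that adj_sym by auto
  qed
  define vs where "vs = v # map f [0..<Suc n]"
  have len: "length vs = n + 2" by (simp add: vs_def)
  have nth: "vs ! 0 = v" "\<And>i. i \<le> n \<Longrightarrow> vs ! Suc i = f i" by (simp_all add: vs_def nth_Cons' del: upt_Suc)
  show False
  proof (rule no_cycle[of vs])
    show "4 \<le> length vs" using len n2 by simp
    have "inj_on f {0..<Suc n}" using inj by (auto simp: inj_on_def)
    moreover have "v \<notin> f ` {0..<Suc n}"
    proof
      assume "v \<in> f ` {0..<Suc n}"
      then obtain i where "i \<in> {0..<Suc n}" "v = f i" by blast
      then show False using vf[of i] by simp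
    qed
    ultimately show "distinct vs" by (simp add: vs_def distinct_map del: upt_Suc)
    show "set vs \<subseteq> V"
    proof
      fix u assume "u \<in> set vs"
      then consider "u = v" | i where "i \<le> n" "u = f i" by (auto simp: vs_def less_Suc_eq_le simp del: upt_Suc)
      then show "u \<in> V"
      proof cases
        case 2
        then show ?thesis using fD[of i] f0 V by (cases "i = 0 \<or> i = n") auto
      qed (use V in simp)
    qed
    fix a b assume ab: "a < length vs" "b < length vs"
    have m: "Suc (Suc i) mod (n + 2) = (if i < n then Suc (Suc i) else 0)" if "i \<le> n" for i
      using that by auto
    have m0: "Suc 0 mod (n + 2) = Suc 0" by simp
    show "vs ! a \<sim> vs ! b \<longleftrightarrow> b = Suc a mod length vs \<or> a = Suc b mod length vs"
    proof (cases a)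
      case 0
      show ?thesis
      proof (cases b)
        case 0 then show ?thesis using \<open>a = 0\<close> nth adj_irrefl by (simp add: len)
      next
        case (Suc j)
        then have "j \<le> n" using ab len by simp
        then show ?thesis unfolding len \<open>a = 0\<close> Suc m[OF \<open>j \<le> n\<close>] m0 nth(1) nth(2)[OF \<open>j \<le> n\<close>] vadj[OF \<open>j \<le> n\<close>] by auto
      qed
    next
      case (Suc i)
      then have i: "i \<le> n" using ab len by simp
      show ?thesis
      proof (cases b)
        case 0
        have "f i \<sim> v \<longleftrightarrow> v \<sim> f i" using adj_sym by blast
        then show ?thesis unfolding len Suc 0 m[OF i] m0 nth(1) nth(2)[OF i] using vadj[OF i] i by auto
      next
        case (Suc j)
        then have j: "j \<le> n" using ab len by simp
        show ?thesis unfolding len \<open>a = Suc i\<close> Suc m[OF i] m[OF j] nth(2)[OF i] nth(2)[OF j] fadj[OF i j]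
          using i j by auto
      qed
    qed
  qed
qed

end

section \<open>A cut vertex without bad sides\<close>

context adjacency begin

text \<open>
  Let \<open>A\<close> be a bad side of \<open>z\<close>, witnessed by \<open>S\<close>, and let \<open>B\<close> be the rest of \<open>V - {z}\<close>. If \<open>z\<close> still
  separates \<open>B\<close> after the removal of some \<open>P \<subseteq> B\<close>, then \<open>S\<close>, \<open>insert z P\<close> and their union are all cut sets of
  \<open>V\<close>. The first two determine the component counts \<open>|S|\<close> of \<open>A - S\<close> and \<open>|P| + 1\<close> of \<open>B - P\<close>; their
  sum is one less than what the union requires.
\<close>
lemma facing_bad_sides_contradiction:
  assumes "finite V" and connV: "\<And>x y. x \<in> V \<Longrightarrow> y \<in> V \<Longrightarrow> (x, y) \<in> conn V"
    and tight: "\<And>S. cutset V S \<Longrightarrow> component_count (V - S) = card S + 1"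
    and z: "z \<in> V"
    and bad: "bad_side V z A"
    and B: "B = V - {z} - A" and P: "P \<subseteq> B" 
    and sepP: "\<And>p. p \<in> insert z P \<Longrightarrow> separates p (B - P)"
  shows False
proof -
  obtain S where A: "A \<in> (V - {z}) // conn (V - {z})" and S: "cutset A S"
    and nbr: "\<And>x. x \<in> A \<Longrightarrow> z \<sim> x \<Longrightarrow> x \<in> S"
    using bad unfolding bad_side_def by blast
  note PA = component_props[OF A]
  have SA: "S \<subseteq> A" using S by (simp add: cutset_def)
  have AB: "no_edges A B" using PA(5) unfolding B .
  have zAB: "z \<notin> A" "z \<notin> B" using PA(1) B by auto
  have fin: "finite A" "finite B" "finite S" "finite P"
    using assms(1) PA(1) SA P B by (auto intro: finite_subset)
  have sepS: "separates s (A - S)" if "s \<in> S" for s using S that by (auto simp: cutset_def)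
  have V: "V = insert z (A \<union> B)" using z PA(1) B by auto
  have disj: "A \<inter> B = {}" using AB by (simp add: no_edges_def)

  have n1: "no_edges (A - S) (B - P)" using AB unfolding no_edges_def by blast
  have n2: "no_edges (A - S) (insert z B)"
    unfolding no_edges_def
  proof (intro conjI ballI)
    show "(A - S) \<inter> insert z B = {}" using disj zAB by blast
    fix a b assume ab: "a \<in> A - S" "b \<in> insert z B"
    show "\<not> a \<sim> b"
    proof (cases "b = z")
      case True
      show ?thesis
      proof
        assume "a \<sim> b"
        then have "z \<sim> a" using True adj_sym by simp
        then show False using nbr ab by blast
      qed
    next
      case False then show ?thesis using AB ab by (simp add: no_edges_def)
    qed
  qed
  have n3: "no_edges A (B - P)" using AB unfolding no_edges_def by blast

  have e1: "V - (insert z (S \<union> P)) = (A - S) \<union> (B - P)"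
    using V SA P disj zAB by blast
  have e2: "V - S = (A - S) \<union> insert z B" using V SA disj zAB by blast
  have e3: "V - insert z P = A \<union> (B - P)" using V P disj zAB by blast

  have "cutset V (insert z (S \<union> P))" unfolding cutset_def e1
  proof (intro conjI ballI)
    show "insert z (S \<union> P) \<subseteq> V" using V SA P by blast
    fix s assume "s \<in> insert z (S \<union> P)"
    then consider "s \<in> S" | "s \<in> insert z P" by blast
    then show "separates s ((A - S) \<union> (B - P))"
    proof cases
      case 1 then show ?thesis using separates_Un[OF sepS n1] by simp
    next
      case 2 
      then show ?thesis using separates_Un[OF sepP no_edges_sym[OF n1]] by (simp add: Un_commute)
    qed
  qed
  then have t1: "component_count (A - S) + component_count (B - P) = card (insert z (S \<union> P)) + 1"
    using tight[of "insert z (S \<union> P)"] e1 component_count_Un[OF _ _ n1] fin by simp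
  have "cutset V S" unfolding cutset_def e2
    using separates_Un[OF sepS n2] SA V by blast
  then have t2: "component_count (A - S) + component_count (insert z B) = card S + 1"
    using tight[of S] e2 component_count_Un[OF _ _ n2] fin by simp
  have "cutset V (insert z P)" unfolding cutset_def e3
  proof (intro conjI ballI)
    show "insert z P \<subseteq> V" using V P by blast
    fix s assume "s \<in> insert z P"
    then show "separates s (A \<union> (B - P))"
      using separates_Un[OF sepP no_edges_sym[OF n3]] by (simp add: Un_commute)
  qed
  then have t3: "component_count A + component_count (B - P) = card (insert z P) + 1"
    using tight[of "insert z P"] e3 component_count_Un[OF _ _ n3] fin by simp
  have "component_count A = 1" using PA(2,3) by (rule component_count_connected)
  have toz: "(x, z) \<in> conn (insert z B)" if "x \<in> insert z B" for x
  proof (cases "x = z")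
    case True then show ?thesis by (simp add: conn_refl)
  next
    case False
    have "(x, z) \<in> conn V" using that V z by (intro connV) auto
    moreover have "b \<in> insert z B" if "a \<in> B" "b \<in> V" "a \<sim> b" for a b
    proof -
      have "\<not> b \<sim> a" if "b \<in> A" using that AB \<open>a \<in> B\<close> by (simp add: no_edges_def)
      then show ?thesis using that(2,3) V adj_sym by blast
    qed
    moreover have "x \<in> B" using that False by simp
    ultimately show ?thesis using conn_to_cut zAB(2) by simp
  qed
  have "component_count (insert z B) = 1"
  proof (rule component_count_connected)
    fix x y assume "x \<in> insert z B" "y \<in> insert z B"
    then show "(x, y) \<in> conn (insert z B)" using toz conn_trans[OF _ conn_sym] by blast
  qed simp
  moreover have "card (insert z (S \<union> P)) = card S + card P + 1"
  proof -
    have "z \<notin> S \<union> P" "S \<inter> P = {}" using SA P zAB disj by blast+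
    then show ?thesis using fin by (simp add: card_Un_disjoint)
  qed
  moreover have "card (insert z P) = card P + 1"
  proof -
    have "z \<notin> P" using P zAB by blast
    then show ?thesis using fin by simp
  qed
  ultimately show False using t1 t2 t3 \<open>component_count A = 1\<close> by simp
qed

text \<open>
  The sides \<open>A u\<close> of the cut vertices \<open>u\<close> near a smallest bad side \<open>H\<close> of \<open>v\<close> all face each other: each of
  them is bad, and their common part \<open>B\<close> can only be left through a cut vertex \<open>u\<close>, to the side opposite to \<open>A u\<close>. A
  simplicial vertex \<open>z\<close> of \<open>B\<close> together with a cut vertex \<open>w\<close> adjacent to it then leads to the
  situation of \<open>facing_bad_sides_contradiction\<close>.
\<close>
theorem chordal_accessible_has_good_cut_vertex:
  assumes fin: "finite V" and connV: "\<And>x y. x \<in> V \<Longrightarrow> y \<in> V \<Longrightarrow> (x, y) \<in> conn V"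
    and nonadj: "a \<in> V" "b \<in> V" "a \<noteq> b" "\<not> a \<sim> b"
    and chordal: "chordal_on V"
    and tight: "\<And>S. cutset V S \<Longrightarrow> component_count (V - S) = card S + 1"
    and acc: "\<And>S. cutset V S \<Longrightarrow> S \<noteq> {} \<Longrightarrow> \<exists>s\<in>S. cutset V (S - {s})"
  shows "\<exists>v\<in>V. cutset V {v} \<and> (\<forall>H. \<not> bad_side V v H)"
proof (rule ccontr)
  assume "\<not> ?thesis"
  then have allbad: "\<exists>H. bad_side V v H" if "v \<in> V" "cutset V {v}" for v using that by blast
  have cut_in: "\<exists>w\<in>S0. cutset V {w}" 
    if S0: "S0 \<subseteq> V" "x \<in> V - S0" "y \<in> V - S0" "(x, y) \<notin> conn (V - S0)" for S0 x y
  proof -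
    have "finite S0" using S0(1) fin finite_subset by blast
    moreover have "(x, y) \<in> conn V" using S0 by (intro connV) auto
    ultimately obtain S where "S \<subseteq> S0" "S \<noteq> {}" "cutset V S"
      using minimal_separator_cutset[OF _ S0] by blast
    moreover from this have "finite S" using \<open>finite S0\<close> finite_subset by blast
    then have "\<exists>w\<in>S. cutset V {w}"
      using accessible_contains_cut_vertex[of S, OF _ acc] \<open>S \<noteq> {}\<close> \<open>cutset V S\<close> by simp
    ultimately show ?thesis by blast
  qed
  have "\<exists>w\<in>V - {a, b}. cutset V {w}"
  proof (rule cut_in)
    show "(a, b) \<notin> conn (V - (V - {a, b}))"
    proof
      have e: "V - (V - {a, b}) = {a, b}" using nonadj by blast
      assume "(a, b) \<in> conn (V - (V - {a, b}))"
      then have "b \<in> {a}" unfolding e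
        by (rule conn_closed_in) (use nonadj adj_irrefl in auto)
      then show False using nonadj by simp
    qed
  qed (use nonadj in auto)
  then obtain v0 H0 where "v0 \<in> V" "cutset V {v0}" "bad_side V v0 H0" using allbad by blast
  then obtain v H where v: "v \<in> V" "cutset V {v}" and badH: "bad_side V v H" and
    minH: "\<And>v' H'. v' \<in> V \<Longrightarrow> cutset V {v'} \<Longrightarrow> bad_side V v' H' \<Longrightarrow> card H \<le> card H'"
    using ex_has_least_nat[of "\<lambda>(v, H). v \<in> V \<and> cutset V {v} \<and> bad_side V v H" "(v0, H0)" "\<lambda>(v, H). card H"]
    by auto
  have compH: "H \<in> (V - {v}) // conn (V - {v})" using badH by (simp add: bad_side_def)
  note PH = component_props[OF compH]
  have finH: "finite H" using PH(1) fin finite_subset by blast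
  define M where "M = insert v H"
  have MV: "M \<subseteq> V" using PH(1) v by (auto simp: M_def)
  \<comment> \<open>\<open>A u\<close> is the side of \<open>u\<close> that faces \<open>v\<close>; for \<open>u = v\<close> it is \<open>H\<close>.\<close>
  define A where "A u = (if u = v then H else conn (V - {u}) `` {v})" for u
  define C where "C = {u \<in> M. cutset V {u}}"
  have vC: "v \<in> C" using v by (simp add: C_def M_def)
  have CV: "C \<subseteq> V" using MV by (auto simp: C_def)
  have compA: "A u \<in> (V - {u}) // conn (V - {u})" if "u \<in> C" for u
  proof (cases "u = v")
    case True then show ?thesis using compH by (simp add: A_def)
  next
    case False then show ?thesis using v by (auto simp: A_def intro: quotientI)
  qed
  have uA: "u \<notin> A u" if "u \<in> C" for u using component_props(1)[OF compA[OF that]] by blast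
  have vA: "v \<in> A u" if "u \<in> C" "u \<noteq> v" for u
    using that v by (auto simp: A_def intro: conn_refl)
  \<comment> \<open>A bad side of \<open>u\<close> other than \<open>A u\<close> would avoid \<open>v\<close> and therefore lie strictly inside \<open>H\<close>,
    against the minimal choice of \<open>H\<close>.\<close>
  have badA: "bad_side V u (A u)" if u: "u \<in> C" for u
  proof (cases "u = v")
    case True then show ?thesis using badH by (simp add: A_def)
  next
    case False
    have uH: "u \<in> H" using u False by (simp add: C_def M_def)
    have uV: "u \<in> V" "cutset V {u}" using u CV by (auto simp: C_def)
    then obtain K where K: "bad_side V u K" using allbad by blast
    then have compK: "K \<in> (V - {u}) // conn (V - {u})" by (simp add: bad_side_def)
    note PK = component_props[OF compK]
    show ?thesis
    proof (cases "v \<in> K")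
      case True
      then show ?thesis using PK(6)[of v] K False by (simp add: A_def)
    next
      case vK: False
      have "K \<subseteq> H - {u}"
      proof
        fix x assume x: "x \<in> K"
        have "(x, u) \<in> conn (insert u K)"
        proof (rule conn_to_cut)
          show "(x, u) \<in> conn V" using x PK(1) uV by (intro connV) auto
          show "u \<notin> K" using PK(1) by blast
          show "b \<in> insert u K" if "a \<in> K" "b \<in> V" "a \<sim> b" for a b
            using PK(4)[OF that(1) _ that(3)] that(2) by blast
        qed (fact x)
        moreover have "insert u K \<subseteq> V - {v}" using PK(1) vK uV False by blast
        ultimately have "(x, u) \<in> conn (V - {v})" using conn_mono by blast
        then have "(u, x) \<in> conn (V - {v})" by (rule conn_sym)
        then have "x \<in> H" using PH(6)[OF uH] by blast
        moreover have "x \<noteq> u" using x PK(1) by blast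
        ultimately show "x \<in> H - {u}" by simp
      qed
      then have "K \<subset> H" using uH by blast
      then have "card K < card H" using finH by (rule psubset_card_mono[rotated])
      then show ?thesis using minH[OF uV K] by simp
    qed
  qed
  define B where "B = {x \<in> M. \<forall>u\<in>C. x \<in> A u \<or> x = u}"
  have BV: "B \<subseteq> V" using MV by (auto simp: B_def)
  have vB: "v \<in> B" using vA by (auto simp: B_def M_def)
  \<comment> \<open>If \<open>y\<close> is outside \<open>B\<close>, it is on the far side of some cut vertex \<open>u\<close>, and \<open>u\<close> is the only vertex outside
    that side with edges into it.\<close>
  have leave: "x \<in> C \<and> y \<notin> A x" if "x \<in> B" "y \<in> V" "y \<notin> B" "x \<sim> y" for x y
  proof -
    have "\<exists>u\<in>C. y \<notin> A u \<and> y \<noteq> u"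
    proof (cases "y \<in> M")
      case True then show ?thesis using that(3) by (auto simp: B_def)
    next
      case False then show ?thesis using vC by (auto simp: A_def M_def)
    qed
    then obtain u where u: "u \<in> C" "y \<notin> A u" "y \<noteq> u" by blast
    have "x \<notin> A u" using component_props(4)[OF compA[OF u(1)], of x y] that u by blast
    then have "x = u" using that(1) u(1) by (auto simp: B_def)
    then show ?thesis using u by simp
  qed
  have "B \<noteq> {v}"
  proof
    assume Bv: "B = {v}"
    obtain h where h: "h \<in> H" using PH(2) by blast
    have "(h, v) \<in> conn V" using h PH(1) v by (intro connV) auto
    then have "v \<in> H"
    proof (rule conn_closed_in)
      show "h \<in> H" by fact
      fix p q assume pq: "p \<in> H" "p \<in> V" "q \<in> V" "p \<sim> q"
      show "q \<in> H"
      proof (cases "q = v")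
        case True
        have "v \<in> C \<and> p \<notin> A v"
        proof (rule leave[OF vB])
          show "p \<in> V" by fact
          show "p \<notin> B" using pq(1) Bv PH(1) by blast
          show "v \<sim> p" using pq True adj_sym by simp
        qed
        then show ?thesis using pq(1) by (simp add: A_def)
      next
        case False then show ?thesis using PH(4)[OF pq(1)] pq by blast
      qed
    qed
    then show False using PH(1) by blast
  qed
  then obtain z where z: "simplicial B z" "z \<noteq> v"
    using exists_simplicial_other[OF chordal fin BV vB] by blast
  have zB: "z \<in> B" using z(1) by (simp add: simplicial_def)
  have zV: "z \<in> V" using zB BV by blast
  have "\<exists>w\<in>B. w \<sim> z \<and> cutset V {w}"
  proof (cases "v \<sim> z")
    case True then show ?thesis using vB v by blast
  next
    case False
    \<comment> \<open>The neighbours of \<open>z\<close> in \<open>B\<close> separate \<open>z\<close> from \<open>v\<close>: without them, one can only go from \<open>z\<close> to its far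
      side, and \<open>Z\<close> is closed under adjacency.\<close>
    define S0 where "S0 = {x \<in> B. x \<sim> z}"
    define Z where "Z = insert z (if z \<in> C then V - {z} - A z else {})"
    have "\<exists>w\<in>S0. cutset V {w}"
    proof (rule cut_in)
      show "S0 \<subseteq> V" using BV by (auto simp: S0_def)
      show "z \<in> V - S0" using zV adj_irrefl by (auto simp: S0_def)
      show "v \<in> V - S0" using v False by (simp add: S0_def)
      show "(z, v) \<notin> conn (V - S0)"
      proof
        assume "(z, v) \<in> conn (V - S0)"
        then have "v \<in> Z"
        proof (rule conn_closed_in)
          show "z \<in> Z" by (simp add: Z_def)
          fix p q assume pq: "p \<in> Z" "p \<in> V - S0" "q \<in> V - S0" "p \<sim> q"
          show "q \<in> Z"
          proof (cases "p = z")
            case True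
            have "q \<notin> B" using pq True adj_sym by (auto simp: S0_def)
            then have "z \<in> C \<and> q \<notin> A z" using leave[OF zB, of q] pq True by simp
            then show ?thesis using pq(3) by (simp add: Z_def)
          next
            case False
            then have zC: "z \<in> C" and p: "p \<in> V - {z} - A z" using pq(1) by (auto simp: Z_def split: if_splits)
            have "q \<in> V - {z} - A z \<or> q = z"
              using component_props(4)[OF compA[OF zC], of q p] p pq adj_sym by blast
            then show ?thesis using zC by (auto simp: Z_def)
          qed
        qed
        then show False using vA[of z] z(2) by (auto simp: Z_def split: if_splits)
      qed
    qed
    then show ?thesis by (auto simp: S0_def)
  qed
  then obtain w where w: "w \<in> B" "w \<sim> z" "cutset V {w}" by blast
  have wC: "w \<in> C" using w by (simp add: B_def C_def)
  have wz: "w \<noteq> z" using w(2) adj_irrefl by blast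
  note PAw = component_props[OF compA[OF wC]]
  obtain T where T: "cutset (A w) T" and nbrT: "\<And>x. x \<in> A w \<Longrightarrow> w \<sim> x \<Longrightarrow> x \<in> T"
    using badA[OF wC] unfolding bad_side_def by blast
  have zA: "z \<in> A w" using zB wC wz by (auto simp: B_def)
  then have zT: "z \<in> T" using nbrT w(2) by simp
  \<comment> \<open>\<open>T\<close> contains all neighbours of \<open>w\<close> on its side, and those of \<open>z\<close> in \<open>B\<close> are among them because \<open>z\<close> is simplicial.
    So only edges that leave \<open>B\<close> can make \<open>z\<close> separating.\<close>
  have outside: "x \<notin> B" if x: "x \<in> A w - T" "z \<sim> x" for x
  proof
    assume "x \<in> B"
    moreover have "x \<noteq> w" using x uA[OF wC] by blast
    ultimately have "w \<sim> x" using z(1) w adj_sym[OF w(2)] x(2) unfolding simplicial_def by blast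
    then show False using nbrT x by blast
  qed
  have AwV: "A w \<subseteq> V" using PAw(1) by blast
  have sepT: "separates s (A w - T)" if "s \<in> T" for s using T that by (simp add: cutset_def)
  obtain i where i: "i \<in> A w - T" "z \<sim> i" using sepT[OF zT] by (auto simp: separates_def)
  have zC: "z \<in> C" using leave[OF zB _ outside[OF i] i(2)] i AwV by blast
  note PAz = component_props[OF compA[OF zC]]
  define D where "D = V - {z} - A z"
  have D_nbr: "q \<in> insert z D" if "p \<in> D" "q \<in> V" "p \<sim> q" for p q
  proof -
    have "q \<notin> A z"
    proof
      assume "q \<in> A z"
      then have "p \<in> A z" using PAz(4)[of q p] that adj_sym by (auto simp: D_def)
      then show False using that(1) by (simp add: D_def)
    qed
    then show ?thesis using that(2) by (simp add: D_def)
  qed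
  have wAz: "w \<in> A z" using w(1) zC wz by (auto simp: B_def)
  have DAw: "D \<subseteq> A w"
  proof
    fix x assume x: "x \<in> D"
    have "(x, z) \<in> conn (insert z D)"
    proof (rule conn_to_cut)
      show "(x, z) \<in> conn V" using x zV by (intro connV) (auto simp: D_def)
      show "z \<notin> D" by (simp add: D_def)
    qed (use x D_nbr in auto)
    moreover have "insert z D \<subseteq> V - {w}" using wAz wz zV by (auto simp: D_def)
    ultimately have "(x, z) \<in> conn (V - {w})" using conn_mono by blast
    then have "(z, x) \<in> conn (V - {w})" by (rule conn_sym)
    then show "x \<in> A w" using PAw(6)[OF zA] by blast
  qed
  have "separates p (D - T \<inter> D)" if p: "p \<in> insert z (T \<inter> D)" for p
  proof (rule separates_antimono)
    show "separates p (A w - T)" using p zT sepT by blast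
    show "D - T \<inter> D \<subseteq> A w - T" using DAw by blast
    fix i assume i: "i \<in> A w - T" "p \<sim> i"
    have "i \<in> D"
    proof (cases "p = z")
      case True
      have "i \<noteq> z" using i zT by blast
      moreover have "z \<in> C \<and> i \<notin> A z"
        by (rule leave[OF zB _ outside]) (use i True AwV in auto)
      ultimately show ?thesis using i AwV by (auto simp: D_def)
    next
      case False
      then have "i \<in> insert z D" using D_nbr[of p i] p i AwV by blast
      then show ?thesis using i zT by blast
    qed
    then show "i \<in> D - T \<inter> D" using i by blast
  qed
  then show False
    by (intro facing_bad_sides_contradiction[OF fin connV tight zV badA[OF zC] D_def, of "T \<inter> D"]) auto
qed

end

section \<open>Substitution homomorphisms of polynomial rings\<close>

abbreviation lookup :: "('x \<Rightarrow>\<^sub>0 'c::zero) \<Rightarrow> 'x \<Rightarrow> 'c" where "lookup \<equiv> poly_mapping.lookup"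

lemma sum_single_keys: "(\<Sum>m\<in>Poly_Mapping.keys p. Poly_Mapping.single m (lookup p m)) = p"
proof (rule poly_mapping_eqI)
  fix k
  have "lookup (\<Sum>m\<in>Poly_Mapping.keys p. Poly_Mapping.single m (lookup p m)) k =
    (\<Sum>m\<in>Poly_Mapping.keys p. if m = k then lookup p m else 0)"
    by (simp add: lookup_sum lookup_single when_def)
  also have "\<dots> = lookup p k" by (simp add: in_keys_iff)
  finally show "lookup (\<Sum>m\<in>Poly_Mapping.keys p. Poly_Mapping.single m (lookup p m)) k = lookup p k" .
qed

definition msubst :: "('x \<Rightarrow> (('y \<Rightarrow>\<^sub>0 nat) \<Rightarrow>\<^sub>0 'k::field)) \<Rightarrow> ('x \<Rightarrow>\<^sub>0 nat) \<Rightarrow> (('y \<Rightarrow>\<^sub>0 nat) \<Rightarrow>\<^sub>0 'k)" where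
  "msubst \<sigma> m = (\<Prod>x\<in>Poly_Mapping.keys m. \<sigma> x ^ lookup m x)"

text \<open>
  The homomorphism of \<open>'k\<close>-algebras that sends each variable \<open>x\<close> to the polynomial \<open>\<sigma> x\<close>.
\<close>
definition psubst :: "('x \<Rightarrow> (('y \<Rightarrow>\<^sub>0 nat) \<Rightarrow>\<^sub>0 'k::field)) \<Rightarrow> (('x \<Rightarrow>\<^sub>0 nat) \<Rightarrow>\<^sub>0 'k) \<Rightarrow> (('y \<Rightarrow>\<^sub>0 nat) \<Rightarrow>\<^sub>0 'k)" where
  "psubst \<sigma> p = (\<Sum>m\<in>Poly_Mapping.keys p. Poly_Mapping.single 0 (lookup p m) * msubst \<sigma> m)"

lemma msubst_superset:
  "finite A \<Longrightarrow> Poly_Mapping.keys m \<subseteq> A \<Longrightarrow> msubst \<sigma> m = (\<Prod>x\<in>A. \<sigma> x ^ lookup m x)"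
  unfolding msubst_def by (rule prod.mono_neutral_left) (auto simp: in_keys_iff)

lemma keys_add_nat: "Poly_Mapping.keys ((m :: 'x \<Rightarrow>\<^sub>0 nat) + n) = Poly_Mapping.keys m \<union> Poly_Mapping.keys n"
  by (auto simp: in_keys_iff lookup_add)

lemma msubst_zero [simp]: "msubst \<sigma> 0 = 1"
  by (simp add: msubst_def)

lemma msubst_single [simp]: "msubst \<sigma> (Poly_Mapping.single x k) = \<sigma> x ^ k"
  by (cases "k = 0") (simp_all add: msubst_def)

lemma msubst_add: "msubst \<sigma> (m + n) = msubst \<sigma> m * msubst \<sigma> n"
proof -
  let ?A = "Poly_Mapping.keys m \<union> Poly_Mapping.keys n"
  have "msubst \<sigma> (m + n) = (\<Prod>x\<in>?A. \<sigma> x ^ lookup m x * \<sigma> x ^ lookup n x)"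
    by (subst msubst_superset[of ?A]) (auto simp: keys_add_nat lookup_add power_add)
  then show ?thesis
    using msubst_superset[of ?A m \<sigma>] msubst_superset[of ?A n \<sigma>] by (simp add: prod.distrib)
qed

lemma psubst_superset:
  "finite A \<Longrightarrow> Poly_Mapping.keys p \<subseteq> A \<Longrightarrow>
    psubst \<sigma> p = (\<Sum>m\<in>A. Poly_Mapping.single 0 (lookup p m) * msubst \<sigma> m)"
  unfolding psubst_def by (rule sum.mono_neutral_left) (auto simp: in_keys_iff)

lemma psubst_zero [simp]: "psubst \<sigma> 0 = 0"
  by (simp add: psubst_def)

lemma psubst_add: "psubst \<sigma> (p + q) = psubst \<sigma> p + psubst \<sigma> q"
proof -
  let ?A = "Poly_Mapping.keys p \<union> Poly_Mapping.keys q"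
  have "psubst \<sigma> (p + q) = (\<Sum>m\<in>?A. Poly_Mapping.single 0 (lookup p m) * msubst \<sigma> m
      + Poly_Mapping.single 0 (lookup q m) * msubst \<sigma> m)"
    using keys_add[of p q]
    by (subst psubst_superset[of ?A]) (auto simp: lookup_add single_add distrib_right)
  then show ?thesis
    using psubst_superset[of ?A p \<sigma>] psubst_superset[of ?A q \<sigma>] by (simp add: sum.distrib)
qed

lemma psubst_sum: "psubst \<sigma> (\<Sum>i\<in>I. f i) = (\<Sum>i\<in>I. psubst \<sigma> (f i))"
  by (induction I rule: infinite_finite_induct) (simp_all add: psubst_add)

lemma psubst_single: "psubst \<sigma> (Poly_Mapping.single m c) = Poly_Mapping.single 0 c * msubst \<sigma> m"
  by (cases "c = 0") (simp_all add: psubst_def)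

lemma psubst_one [simp]: "psubst \<sigma> 1 = 1"
  using psubst_single[of \<sigma> 0 1] by simp

lemma psubst_const [simp]: "psubst \<sigma> (Poly_Mapping.single 0 c) = Poly_Mapping.single 0 c"
  by (simp add: psubst_single)

lemma psubst_pvar [simp]: "psubst \<sigma> (pvar x) = \<sigma> x"
  unfolding pvar_def by (simp add: psubst_single)

lemma single_zero_mult: "Poly_Mapping.single (0 :: 'm::monoid_add) (a * b :: 'c::semiring_0) = Poly_Mapping.single 0 a * Poly_Mapping.single 0 b"
  by (simp add: mult_single)

lemma psubst_mult: "psubst \<sigma> (p * q) = psubst \<sigma> p * psubst \<sigma> q"
proof -
  let ?s = "\<lambda>p m. Poly_Mapping.single m (lookup p m)"
  have "psubst \<sigma> (p * q) = psubst \<sigma> ((\<Sum>m\<in>Poly_Mapping.keys p. ?s p m) * (\<Sum>n\<in>Poly_Mapping.keys q. ?s q n))"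
    by (simp only: sum_single_keys)
  also have "\<dots> = (\<Sum>m\<in>Poly_Mapping.keys p. \<Sum>n\<in>Poly_Mapping.keys q. psubst \<sigma> (?s p m * ?s q n))"
    by (simp add: sum_product psubst_sum)
  also have "\<dots> = (\<Sum>m\<in>Poly_Mapping.keys p. \<Sum>n\<in>Poly_Mapping.keys q.
      (Poly_Mapping.single 0 (lookup p m) * msubst \<sigma> m) * (Poly_Mapping.single 0 (lookup q n) * msubst \<sigma> n))"
  proof (intro sum.cong refl)
    fix m n
    have "psubst \<sigma> (?s p m * ?s q n) = Poly_Mapping.single 0 (lookup p m * lookup q n) * (msubst \<sigma> m * msubst \<sigma> n)"
      by (simp add: mult_single psubst_single msubst_add)
    then show "psubst \<sigma> (?s p m * ?s q n) = 
      (Poly_Mapping.single 0 (lookup p m) * msubst \<sigma> m) * (Poly_Mapping.single 0 (lookup q n) * msubst \<sigma> n)"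
      by (simp only: single_zero_mult mult_ac)
  qed
  also have "\<dots> = psubst \<sigma> p * psubst \<sigma> q" by (simp add: psubst_def sum_product)
  finally show ?thesis .
qed

lemma psubst_uminus: "psubst \<sigma> (- p) = - psubst \<sigma> p"
proof -
  have "psubst \<sigma> (- p) + psubst \<sigma> p = psubst \<sigma> (- p + p)" by (simp only: psubst_add)
  then show ?thesis by (simp add: eq_neg_iff_add_eq_0)
qed

lemma psubst_diff: "psubst \<sigma> (p - q) = psubst \<sigma> p - psubst \<sigma> q"
  using psubst_add[of \<sigma> p "- q"] by (simp add: psubst_uminus)

lemma psubst_power: "psubst \<sigma> (p ^ k) = psubst \<sigma> p ^ k"
  by (induction k) (simp_all add: psubst_mult)

lemma psubst_prod: "psubst \<sigma> (\<Prod>i\<in>I. f i) = (\<Prod>i\<in>I. psubst \<sigma> (f i))"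
  by (induction I rule: infinite_finite_induct) (simp_all add: psubst_mult)

lemma psubst_msubst: "psubst \<chi> (msubst \<sigma> m) = msubst (\<lambda>x. psubst \<chi> (\<sigma> x)) m"
  by (simp add: msubst_def psubst_prod psubst_power)

lemma psubst_psubst: "psubst \<chi> (psubst \<sigma> p) = psubst (\<lambda>x. psubst \<chi> (\<sigma> x)) p"
proof -
  have "psubst \<chi> (psubst \<sigma> p) =
    (\<Sum>m\<in>Poly_Mapping.keys p. Poly_Mapping.single 0 (lookup p m) * psubst \<chi> (msubst \<sigma> m))"
    unfolding psubst_def[of \<sigma> p] by (simp add: psubst_sum psubst_mult)
  then show ?thesis unfolding psubst_msubst psubst_def[of "\<lambda>x. psubst \<chi> (\<sigma> x)"] .
qed

lemma psubst_cong:
  assumes "\<And>m x. m \<in> Poly_Mapping.keys p \<Longrightarrow> x \<in> Poly_Mapping.keys m \<Longrightarrow> \<sigma> x = \<tau> x"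
  shows "psubst \<sigma> p = psubst \<tau> p"
  unfolding psubst_def msubst_def using assms by (intro sum.cong prod.cong arg_cong2[where f="(*)"] refl) auto

lemma pvar_power: "(pvar x :: ('x \<Rightarrow>\<^sub>0 nat) \<Rightarrow>\<^sub>0 'k::field) ^ k = Poly_Mapping.single (Poly_Mapping.single x k) 1"
  by (induction k) (simp_all add: pvar_def mult_single single_add[symmetric])

lemma prod_single_one: "(\<Prod>i\<in>I. Poly_Mapping.single (f i :: 'x \<Rightarrow>\<^sub>0 nat) (1 :: 'k::field)) = Poly_Mapping.single (\<Sum>i\<in>I. f i) 1"
  by (induction I rule: infinite_finite_induct) (simp_all add: mult_single)

lemma msubst_pvar: "msubst pvar m = Poly_Mapping.single m 1"
  by (simp add: msubst_def pvar_power prod_single_one sum_single_keys)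

lemma psubst_pvar_id: "psubst pvar p = p"
proof -
  have "psubst pvar p = (\<Sum>m\<in>Poly_Mapping.keys p. Poly_Mapping.single m (lookup p m))"
    by (simp add: psubst_def msubst_pvar mult_single)
  then show ?thesis by (simp add: sum_single_keys)
qed

text \<open>
  Leading monomials show this when the variables are linearly ordered, which is not assumed of \<open>'x\<close>. Two polynomials involve finitely many variables only, so renaming these to
  natural numbers, which can be undone, reduces to the ordered case.
\<close>
lemma mpoly_no_zero_divisors:
  fixes p q :: "('x \<Rightarrow>\<^sub>0 nat) \<Rightarrow>\<^sub>0 'k::field"
  assumes "p * q = 0" shows "p = 0 \<or> q = 0"
proof -
  define X where "X = (\<Union>m\<in>Poly_Mapping.keys p \<union> Poly_Mapping.keys q. Poly_Mapping.keys m)"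
  have "finite X" by (simp add: X_def)
  then obtain f :: "'x \<Rightarrow> nat" where f: "inj_on f X" using finite_imp_inj_to_nat_seg by metis
  define \<rho> :: "'x \<Rightarrow> (nat \<Rightarrow>\<^sub>0 nat) \<Rightarrow>\<^sub>0 'k" where "\<rho> = (\<lambda>x. pvar (f x))"
  have inv: "psubst (\<lambda>i. pvar (inv_into X f i)) (psubst \<rho> r) = r" if "r = p \<or> r = q" for r
  proof -
    have "psubst (\<lambda>i. pvar (inv_into X f i)) (psubst \<rho> r) = psubst pvar r"
      unfolding psubst_psubst
    proof (rule psubst_cong)
      fix m x assume "m \<in> Poly_Mapping.keys r" "x \<in> Poly_Mapping.keys m"
      then have "x \<in> X" using that by (auto simp: X_def)
      then show "psubst (\<lambda>i. pvar (inv_into X f i)) (\<rho> x) = pvar x"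
        using f by (simp add: \<rho>_def inv_into_f_f)
    qed
    then show ?thesis by (simp add: psubst_pvar_id)
  qed
  have "psubst \<rho> p * psubst \<rho> q = 0" using assms psubst_mult[of \<rho> p q] by simp
  then have "psubst \<rho> p = 0 \<or> psubst \<rho> q = 0" by simp
  then show ?thesis using inv psubst_zero by metis
qed

lemma mpoly_mult_eq_0_iff: 
  fixes p q :: "('x \<Rightarrow>\<^sub>0 nat) \<Rightarrow>\<^sub>0 'k::field"
  shows "p * q = 0 \<longleftrightarrow> p = 0 \<or> q = 0"
  using mpoly_no_zero_divisors by auto

lemma mpoly_mult_left_cancel:
  fixes p q r :: "('x \<Rightarrow>\<^sub>0 nat) \<Rightarrow>\<^sub>0 'k::field"
  assumes "p * q = p * r" "p \<noteq> 0" shows "q = r"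
proof -
  have "p * (q - r) = 0" using assms(1) by (simp add: right_diff_distrib)
  then show ?thesis using assms(2) mpoly_no_zero_divisors by fastforce
qed

lemma mpoly_prod_eq_0:
  fixes f :: "'i \<Rightarrow> ('x \<Rightarrow>\<^sub>0 nat) \<Rightarrow>\<^sub>0 'k::field"
  shows "finite I \<Longrightarrow> (\<Prod>i\<in>I. f i) = 0 \<longleftrightarrow> (\<exists>i\<in>I. f i = 0)"
  by (induction I rule: finite_induct) (auto simp: mpoly_mult_eq_0_iff)

lemma mpoly_power_eq_0:
  fixes p :: "('x \<Rightarrow>\<^sub>0 nat) \<Rightarrow>\<^sub>0 'k::field"
  shows "p ^ k = 0 \<longleftrightarrow> p = 0 \<and> k > 0"
  by (induction k) (auto simp: mpoly_mult_eq_0_iff)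

lemma msubst_eq_0:
  fixes \<sigma> :: "'x \<Rightarrow> (('y \<Rightarrow>\<^sub>0 nat) \<Rightarrow>\<^sub>0 'k::field)"
  shows "msubst \<sigma> m = 0 \<longleftrightarrow> (\<exists>x\<in>Poly_Mapping.keys m. \<sigma> x = 0)"
  unfolding msubst_def by (auto simp: mpoly_prod_eq_0 mpoly_power_eq_0 in_keys_iff)

lemma pvar_neq_0 [simp]: "pvar x \<noteq> 0"
  unfolding pvar_def by (metis lookup_single_eq lookup_zero zero_neq_one)

section \<open>Ideals of polynomial rings and kernels of substitutions\<close>

lemma mpoly_ring_simps [simp]:
  "x \<otimes>\<^bsub>mpoly_ring X\<^esub> y = x * y" "x \<oplus>\<^bsub>mpoly_ring X\<^esub> y = x + y"
  "\<one>\<^bsub>mpoly_ring X\<^esub> = 1" "\<zero>\<^bsub>mpoly_ring X\<^esub> = 0"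
  by (simp_all add: mpoly_ring_def)

lemma mpoly_carrier_iff:
  "p \<in> carrier (mpoly_ring X) \<longleftrightarrow> (\<forall>m\<in>Poly_Mapping.keys p. Poly_Mapping.keys m \<subseteq> X)"
  by (simp add: mpoly_ring_def)

lemma carrier_add: "p \<in> carrier (mpoly_ring X) \<Longrightarrow> q \<in> carrier (mpoly_ring X) \<Longrightarrow> p + q \<in> carrier (mpoly_ring X)"
  using cring.cring_simprules(1)[OF cring_mpoly_ring] by fastforce

lemma carrier_mult: "p \<in> carrier (mpoly_ring X) \<Longrightarrow> q \<in> carrier (mpoly_ring X) \<Longrightarrow> p * q \<in> carrier (mpoly_ring X)"
  using cring.cring_simprules(5)[OF cring_mpoly_ring] by fastforce

lemma carrier_uminus: "p \<in> carrier (mpoly_ring X) \<Longrightarrow> - p \<in> carrier (mpoly_ring X)"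
  by (simp add: mpoly_carrier_iff)

lemma carrier_diff: "p \<in> carrier (mpoly_ring X) \<Longrightarrow> q \<in> carrier (mpoly_ring X) \<Longrightarrow> p - q \<in> carrier (mpoly_ring X)"
  using carrier_add[OF _ carrier_uminus] by fastforce

lemma carrier_zero: "0 \<in> carrier (mpoly_ring X)"
  by (simp add: mpoly_carrier_iff)

lemma carrier_one: "1 \<in> carrier (mpoly_ring X)"
  by (simp add: mpoly_carrier_iff)

lemma carrier_pvar: "x \<in> X \<Longrightarrow> pvar x \<in> carrier (mpoly_ring X)"
  by (simp add: mpoly_carrier_iff pvar_def)

lemma carrier_single: "Poly_Mapping.keys m \<subseteq> X \<Longrightarrow> Poly_Mapping.single m c \<in> carrier (mpoly_ring X)"
  by (auto simp: mpoly_carrier_iff)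

lemma carrier_power: "p \<in> carrier (mpoly_ring X) \<Longrightarrow> p ^ k \<in> carrier (mpoly_ring X)"
  by (induction k) (simp_all add: carrier_one carrier_mult)

lemma carrier_sum: "(\<And>i. i \<in> I \<Longrightarrow> f i \<in> carrier (mpoly_ring X)) \<Longrightarrow> (\<Sum>i\<in>I. f i) \<in> carrier (mpoly_ring X)"
  by (induction I rule: infinite_finite_induct) (simp_all add: carrier_zero carrier_add)

lemma ideal_mpoly:
  assumes "ideal Q (mpoly_ring X)"
  shows "Q \<subseteq> carrier (mpoly_ring X)" "0 \<in> Q" "\<And>p q. p \<in> Q \<Longrightarrow> q \<in> Q \<Longrightarrow> p + q \<in> Q"
    "\<And>p q. p \<in> Q \<Longrightarrow> q \<in> carrier (mpoly_ring X) \<Longrightarrow> q * p \<in> Q"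
    "\<And>p. p \<in> Q \<Longrightarrow> - p \<in> Q" "\<And>p q. p \<in> Q \<Longrightarrow> q \<in> Q \<Longrightarrow> p - q \<in> Q"
proof -
  interpret ideal Q "mpoly_ring X" by fact
  show 1: "Q \<subseteq> carrier (mpoly_ring X)" by (rule a_subset)
  show "0 \<in> Q" using additive_subgroup.zero_closed[OF additive_subgroup_axioms] by simp
  show 2: "\<And>p q. p \<in> Q \<Longrightarrow> q \<in> Q \<Longrightarrow> p + q \<in> Q" using additive_subgroup.a_closed[OF additive_subgroup_axioms] by simp
  show 3: "\<And>p q. p \<in> Q \<Longrightarrow> q \<in> carrier (mpoly_ring X) \<Longrightarrow> q * p \<in> Q" using I_l_closed by simp
  show 4: "- p \<in> Q" if "p \<in> Q" for p
    using 3[OF that carrier_uminus[OF carrier_one]] by simp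
  show "\<And>p q. p \<in> Q \<Longrightarrow> q \<in> Q \<Longrightarrow> p - q \<in> Q" using 2 4 by (metis add_uminus_conv_diff)
qed

lemma primeideal_mpoly:
  assumes "primeideal Q (mpoly_ring X)"
  shows "ideal Q (mpoly_ring X)" "1 \<notin> Q"
    "\<And>p q. p \<in> carrier (mpoly_ring X) \<Longrightarrow> q \<in> carrier (mpoly_ring X) \<Longrightarrow> p * q \<in> Q \<Longrightarrow> p \<in> Q \<or> q \<in> Q"
proof -
  interpret primeideal Q "mpoly_ring X" by fact
  show "ideal Q (mpoly_ring X)" by (rule is_ideal)
  show "1 \<notin> Q" using I_notcarr one_imp_carrier by auto
  show "\<And>p q. p \<in> carrier (mpoly_ring X) \<Longrightarrow> q \<in> carrier (mpoly_ring X) \<Longrightarrow> p * q \<in> Q \<Longrightarrow> p \<in> Q \<or> q \<in> Q"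
    using I_prime by simp
qed

text \<open>
  All prime ideals that are constructed explicitly arise in this way. Primality is automatic because the
  target is a domain, and inclusions follow from factoring one substitution through another.
\<close>
definition psubst_ker :: "'x set \<Rightarrow> ('x \<Rightarrow> (('y \<Rightarrow>\<^sub>0 nat) \<Rightarrow>\<^sub>0 'k::field)) \<Rightarrow> (('x \<Rightarrow>\<^sub>0 nat) \<Rightarrow>\<^sub>0 'k) set" where
  "psubst_ker X \<sigma> = {p \<in> carrier (mpoly_ring X). psubst \<sigma> p = 0}"

lemma primeideal_psubst_ker: 
  fixes \<sigma> :: "'x \<Rightarrow> (('y \<Rightarrow>\<^sub>0 nat) \<Rightarrow>\<^sub>0 'k::field)"
  shows "primeideal (psubst_ker X \<sigma>) (mpoly_ring X)"
proof (rule primeidealI2)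
  let ?R = "mpoly_ring X :: (('x \<Rightarrow>\<^sub>0 nat) \<Rightarrow>\<^sub>0 'k) ring"
  interpret R: cring ?R by (rule cring_mpoly_ring)
  have minus: "\<ominus>\<^bsub>?R\<^esub> p = - p" if "p \<in> carrier ?R" for p
    using that carrier_uminus[OF that] by (intro R.minus_equality) auto
  show "additive_subgroup (psubst_ker X \<sigma>) ?R"
    by (intro additive_subgroup.intro R.add.subgroupI)
      (auto simp: psubst_ker_def carrier_add carrier_zero carrier_uminus psubst_add psubst_uminus minus
        simp flip: a_inv_def intro!: exI[of _ 0])
  show "cring ?R" by (rule cring_mpoly_ring)
  have "1 \<in> carrier ?R" "1 \<notin> psubst_ker X \<sigma>" by (simp_all add: carrier_one psubst_ker_def)
  then show "carrier ?R \<noteq> psubst_ker X \<sigma>" by blast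
qed (auto simp: psubst_ker_def carrier_mult psubst_mult mpoly_mult_eq_0_iff)

lemma psubst_ker_subset:
  assumes "\<And>x. x \<in> X \<Longrightarrow> \<tau> x = psubst \<chi> (\<sigma> x)"
  shows "psubst_ker X \<sigma> \<subseteq> psubst_ker X \<tau>"
proof
  fix p assume p: "p \<in> psubst_ker X \<sigma>"
  have "psubst \<tau> p = psubst \<chi> (psubst \<sigma> p)"
    unfolding psubst_psubst by (rule psubst_cong) (use p assms in \<open>auto simp: psubst_ker_def mpoly_carrier_iff\<close>)
  then show "p \<in> psubst_ker X \<tau>" using p by (simp add: psubst_ker_def)
qed

section \<open>Chains of primes in polynomial rings\<close>

definition prime_chain :: "'x set \<Rightarrow> (nat \<Rightarrow> (('x \<Rightarrow>\<^sub>0 nat) \<Rightarrow>\<^sub>0 'k::field) set) \<Rightarrow> nat \<Rightarrow> bool" where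
  "prime_chain X C n \<longleftrightarrow> (\<forall>i\<le>n. primeideal (C i) (mpoly_ring X)) \<and> (\<forall>i<n. C i \<subset> C (Suc i))"

text \<open>
  Modulo \<open>Q\<close> the sum reduces to \<open>g 0\<close>, which is therefore in \<open>Q\<close> and vanishes; then \<open>f\<close> can be cancelled modulo \<open>P\<close> and
  the argument repeats with the remaining coefficients.
\<close>
lemma coefficients_in_larger_prime:
  fixes f :: "('x \<Rightarrow>\<^sub>0 nat) \<Rightarrow>\<^sub>0 'k::field"
  assumes P: "primeideal P (mpoly_ring X)" and Q: "primeideal Q (mpoly_ring X)" "P \<subseteq> Q" "f \<in> Q" "f \<notin> P"
  shows "(\<Sum>j<k. f ^ j * g j) \<in> P \<Longrightarrow> (\<And>j. j < k \<Longrightarrow> g j \<in> carrier (mpoly_ring X)) \<Longrightarrow>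
    (\<And>j. j < k \<Longrightarrow> g j \<in> Q \<Longrightarrow> g j = 0) \<Longrightarrow> j < k \<Longrightarrow> g j \<in> Q"
proof (induction k arbitrary: g j)
  case (Suc k)
  note iP = ideal_mpoly[OF primeideal_mpoly(1)[OF P]]
  note iQ = ideal_mpoly[OF primeideal_mpoly(1)[OF Q(1)]]
  have fc: "f \<in> carrier (mpoly_ring X)" using Q(3) iQ(1) by blast
  let ?r = "\<Sum>j<k. f ^ j * g (Suc j)"
  have rc: "?r \<in> carrier (mpoly_ring X)"
    using Suc.prems(2) by (intro carrier_sum carrier_mult carrier_power fc) auto
  have split: "(\<Sum>j<Suc k. f ^ j * g j) = g 0 + ?r * f"
    unfolding sum.lessThan_Suc_shift by (simp add: sum_distrib_left mult_ac)
  have rf: "?r * f \<in> Q" using iQ(4)[OF Q(3) rc] .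
  have "g 0 + ?r * f \<in> Q" using Suc.prems(1) split Q(2) by auto
  then have "g 0 \<in> Q" using iQ(6)[OF _ rf] by fastforce
  then have g0: "g 0 = 0" using Suc.prems(3) by simp
  then have "?r * f \<in> P" using Suc.prems(1) split by simp
  then have "?r \<in> P" using primeideal_mpoly(3)[OF P rc fc] Q(4) by blast
  then have IH: "g (Suc j) \<in> Q" if "j < k" for j
    by (rule Suc.IH[of "\<lambda>j. g (Suc j)"]) (use that Suc.prems(2,3) in auto)
  show ?case
  proof (cases j)
    case 0 then show ?thesis using \<open>g 0 \<in> Q\<close> by simp
  next
    case (Suc i) then show ?thesis using IH Suc.prems(4) by simp
  qed
qed simp

definition power_product :: "('c::comm_monoid_mult) list \<Rightarrow> nat list \<Rightarrow> 'c" where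
  "power_product fs a = prod_list (map2 (^) fs a)"

definition exponents :: "nat \<Rightarrow> nat \<Rightarrow> nat list set" where
  "exponents n k = {a. set a \<subseteq> {..<k} \<and> length a = n}"

lemma power_product_simps [simp]:
  "power_product [] a = 1" "power_product (f # fs) (j # a) = f ^ j * power_product fs a"
  by (simp_all add: power_product_def)

lemma finite_exponents: "finite (exponents n k)" and card_exponents: "card (exponents n k) = k ^ n"
  unfolding exponents_def using finite_lists_length_eq[of "{..<k}" n] card_lists_length_eq[of "{..<k}" n] by auto

lemma sum_exponents_Suc: "(\<Sum>a\<in>exponents (Suc n) k. h a) = (\<Sum>j<k. \<Sum>b\<in>exponents n k. h (j # b))"
proof -
  have e: "exponents (Suc n) k = (\<lambda>(j, b). j # b) ` ({..<k} \<times> exponents n k)"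
    by (force simp: exponents_def length_Suc_conv image_iff)
  show ?thesis unfolding e
    by (subst sum.reindex) (auto simp: inj_on_def sum.cartesian_product case_prod_unfold)
qed

lemma carrier_power_product:
  "set fs \<subseteq> carrier (mpoly_ring X) \<Longrightarrow> power_product fs a \<in> carrier (mpoly_ring X)"
proof (induction fs arbitrary: a)
  case (Cons f fs)
  then show ?case
    by (cases a) (auto simp: power_product_def[of _ "[]"] intro!: carrier_mult carrier_power carrier_one)
qed (simp add: carrier_one)

text \<open>
  Elements picked from the successive differences of a chain of primes are algebraically independent, even modulo the smallest
  prime: write a relation as a polynomial in the first element; by \<open>coefficients_in_larger_prime\<close> its
  coefficients lie in the next prime, where induction applies to them.
\<close>
lemma power_products_independent:
  fixes C :: "nat \<Rightarrow> (('x \<Rightarrow>\<^sub>0 nat) \<Rightarrow>\<^sub>0 'k::field) set"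
  assumes "prime_chain X C n" "length fs = n" "\<And>i. i < n \<Longrightarrow> fs ! i \<in> C (Suc i) - C i"
    and "(\<Sum>a\<in>exponents n k. Poly_Mapping.single 0 (c a) * power_product fs a) \<in> C 0" "a \<in> exponents n k"
  shows "c a = 0"
  using assms
proof (induction n arbitrary: C fs c a)
  case 0
  have P: "primeideal (C 0) (mpoly_ring X)" using 0 by (simp add: prime_chain_def)
  have E: "exponents 0 k = {[]}" by (auto simp: exponents_def)
  have m: "Poly_Mapping.single 0 (c []) \<in> C 0" and a: "a = []" using 0 E by auto
  show ?case
  proof (rule ccontr)
    assume "c a \<noteq> 0"
    then have "Poly_Mapping.single 0 (inverse (c [])) * Poly_Mapping.single 0 (c []) = (1 :: ('x \<Rightarrow>\<^sub>0 nat) \<Rightarrow>\<^sub>0 'k)"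
      using a by (simp add: mult_single)
    moreover have "Poly_Mapping.single 0 (inverse (c [])) * Poly_Mapping.single 0 (c []) \<in> C 0"
      using ideal_mpoly(4)[OF primeideal_mpoly(1)[OF P] m] by (simp add: carrier_single)
    ultimately show False using primeideal_mpoly(2)[OF P] by simp
  qed
next
  case (Suc n)
  obtain f gs where fs: "fs = f # gs" using Suc.prems(2) by (cases fs) auto
  have P: "primeideal (C i) (mpoly_ring X)" if "i \<le> Suc n" for i using Suc.prems(1) that by (simp add: prime_chain_def)
  have sub: "C 0 \<subseteq> C 1" using Suc.prems(1) by (auto simp: prime_chain_def)
  have chain: "prime_chain X (\<lambda>i. C (Suc i)) n" using Suc.prems(1) by (simp add: prime_chain_def)
  have gs: "length gs = n" using Suc.prems(2) fs by simp
  have gsC: "gs ! i \<in> C (Suc (Suc i)) - C (Suc i)" if "i < n" for i using Suc.prems(3)[of "Suc i"] that fs by simp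
  have f: "f \<in> C 1" "f \<notin> C 0" using Suc.prems(3)[of 0] fs by auto
  have gsc: "set gs \<subseteq> carrier (mpoly_ring X)"
  proof
    fix g assume "g \<in> set gs"
    then obtain i where i: "i < n" "g = gs ! i" using gs by (auto simp: in_set_conv_nth)
    then show "g \<in> carrier (mpoly_ring X)"
      using gsC[OF i(1)] ideal_mpoly(1)[OF primeideal_mpoly(1)[OF P[of "Suc (Suc i)"]]] by auto
  qed
  define g where "g j = (\<Sum>b\<in>exponents n k. Poly_Mapping.single 0 (c (j # b)) * power_product gs b)" for j
  have IH: "c (j # b) = 0" if "g j \<in> C 1" "b \<in> exponents n k" for j b
    by (rule Suc.IH[OF chain gs gsC, of "\<lambda>b. c (j # b)"]) (use that in \<open>auto simp: g_def\<close>)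
  have "(\<Sum>j<k. f ^ j * g j) \<in> C 0"
  proof -
    have "(\<Sum>a\<in>exponents (Suc n) k. Poly_Mapping.single 0 (c a) * power_product fs a) = (\<Sum>j<k. f ^ j * g j)"
      unfolding sum_exponents_Suc fs g_def by (simp add: sum_distrib_left mult_ac)
    then show ?thesis using Suc.prems(4) by simp
  qed
  note S = this
  have P01: "primeideal (C 0) (mpoly_ring X)" "primeideal (C 1) (mpoly_ring X)" using P by simp_all
  have gc: "g j \<in> carrier (mpoly_ring X)" for j unfolding g_def
    by (intro carrier_sum carrier_mult carrier_single carrier_power_product gsc) auto
  have g0: "g j = 0" if "g j \<in> C 1" for j unfolding g_def using IH[OF that] by simp
  have gC: "g j \<in> C 1" if "j < k" for j
    by (rule coefficients_in_larger_prime[OF P01 sub f S gc g0 that])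
  obtain j b where "a = j # b" "j < k" "b \<in> exponents n k"
    using Suc.prems(5) by (auto simp: exponents_def length_Suc_conv)
  then show ?case using IH gC by simp
qed

definition exponents_bounded :: "nat \<Rightarrow> (('x \<Rightarrow>\<^sub>0 nat) \<Rightarrow>\<^sub>0 'k::field) \<Rightarrow> bool" where
  "exponents_bounded d p \<longleftrightarrow> (\<forall>m\<in>Poly_Mapping.keys p. \<forall>x. lookup m x \<le> d)"

lemma exponents_bounded_mult:
  "exponents_bounded d p \<Longrightarrow> exponents_bounded e q \<Longrightarrow> exponents_bounded (d + e) (p * q)"
  unfolding exponents_bounded_def using keys_mult[of p q] by (fastforce simp: lookup_add intro: add_mono)

lemma exponents_bounded_power: "exponents_bounded d p \<Longrightarrow> exponents_bounded (k * d) (p ^ k)"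
proof (induction k)
  case 0 then show ?case by (simp add: exponents_bounded_def)
next
  case (Suc k) then show ?case using exponents_bounded_mult[of d p "k * d"] by simp
qed

lemma exponents_bounded_mono: "exponents_bounded d p \<Longrightarrow> d \<le> e \<Longrightarrow> exponents_bounded e p"
  unfolding exponents_bounded_def by (meson order_trans)

lemma exponents_bounded_exists: "\<exists>d. exponents_bounded d (p :: ('x \<Rightarrow>\<^sub>0 nat) \<Rightarrow>\<^sub>0 'k::field)"
proof -
  have "\<exists>d. \<forall>x. lookup m x \<le> d" for m :: "'x \<Rightarrow>\<^sub>0 nat"
  proof (intro exI allI)
    fix x show "lookup m x \<le> (\<Sum>y\<in>Poly_Mapping.keys m. lookup m y)"
      by (cases "x \<in> Poly_Mapping.keys m") (auto simp: in_keys_iff intro: member_le_sum)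
  qed
  then obtain D where D: "\<And>m :: 'x \<Rightarrow>\<^sub>0 nat. \<forall>x. lookup m x \<le> D m" by metis
  have "exponents_bounded (\<Sum>m\<in>Poly_Mapping.keys p. D m) p"
    unfolding exponents_bounded_def
  proof (intro ballI allI)
    fix m x assume m: "m \<in> Poly_Mapping.keys p"
    have "lookup m x \<le> D m" using D by blast
    also have "\<dots> \<le> (\<Sum>m\<in>Poly_Mapping.keys p. D m)" using m by (intro member_le_sum) auto
    finally show "lookup m x \<le> (\<Sum>m\<in>Poly_Mapping.keys p. D m)" .
  qed
  then show ?thesis by blast
qed

lemma exponents_bounded_list: "\<exists>d. \<forall>f\<in>set fs. exponents_bounded d f"
proof (induction fs)
  case (Cons f fs)
  then obtain d e where "\<forall>f\<in>set fs. exponents_bounded d f" "exponents_bounded e f"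
    using exponents_bounded_exists by blast
  then show ?case by (intro exI[of _ "max d e"]) (auto intro: exponents_bounded_mono)
qed simp

lemma exponents_bounded_power_product:
  assumes "\<forall>f\<in>set fs. exponents_bounded e f" "set a \<subseteq> {..<k}"
  shows "exponents_bounded (length fs * (k * e)) (power_product fs a)"
  using assms
proof (induction fs arbitrary: a)
  case (Cons f fs)
  show ?case
  proof (cases a)
    case Nil
    then show ?thesis by (simp add: power_product_def exponents_bounded_def)
  next
    case (Cons j b)
    have "exponents_bounded (j * e) (f ^ j)" using Cons.prems by (simp add: exponents_bounded_power)
    then have "exponents_bounded (k * e) (f ^ j)"
      by (rule exponents_bounded_mono) (use Cons.prems Cons in auto)
    then have "exponents_bounded (k * e + length fs * (k * e)) (f ^ j * power_product fs b)"
      using Cons.IH[of b] Cons.prems Cons by (intro exponents_bounded_mult) auto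
    then show ?thesis using Cons by (simp add: algebra_simps)
  qed
qed (simp add: exponents_bounded_def)

interpretation mpoly_vs: vector_space "\<lambda>c p. Poly_Mapping.single 0 c * (p :: ('x \<Rightarrow>\<^sub>0 nat) \<Rightarrow>\<^sub>0 'k::field)"
  by unfold_locales (simp_all add: algebra_simps single_add single_zero_mult)

definition bounded_monomials :: "'x set \<Rightarrow> nat \<Rightarrow> ('x \<Rightarrow>\<^sub>0 nat) set" where
  "bounded_monomials X d = {m. Poly_Mapping.keys m \<subseteq> X \<and> (\<forall>x. lookup m x \<le> d)}"

lemma card_bounded_monomials:
  assumes "finite X"
  shows "finite (bounded_monomials X d)" "card (bounded_monomials X d) \<le> (d + 1) ^ card X"
proof -
  let ?f = "\<lambda>m :: 'a \<Rightarrow>\<^sub>0 nat. restrict (lookup m) X"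
  have inj: "inj_on ?f (bounded_monomials X d)"
  proof (rule inj_onI)
    fix m n assume "m \<in> bounded_monomials X d" "n \<in> bounded_monomials X d" and eq: "?f m = ?f n"
    then have mn: "Poly_Mapping.keys m \<subseteq> X" "Poly_Mapping.keys n \<subseteq> X" by (auto simp: bounded_monomials_def)
    show "m = n"
    proof (rule poly_mapping_eqI)
      fix x show "lookup m x = lookup n x"
      proof (cases "x \<in> X")
        case True then show ?thesis using fun_cong[OF eq, of x] by simp
      next
        case False
        then have "x \<notin> Poly_Mapping.keys m" "x \<notin> Poly_Mapping.keys n" using mn by auto
        then show ?thesis by (simp add: in_keys_iff)
      qed
    qed
  qed
  have img: "?f ` bounded_monomials X d \<subseteq> (\<Pi>\<^sub>E x\<in>X. {..d})" by (auto simp: bounded_monomials_def)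
  have fin: "finite (\<Pi>\<^sub>E x\<in>X. {..d})" using assms by (intro finite_PiE) auto
  show "finite (bounded_monomials X d)" using inj_on_finite[OF inj img fin] .
  have "card (bounded_monomials X d) \<le> card (\<Pi>\<^sub>E x\<in>X. {..d})" using card_inj_on_le[OF inj img fin] .
  then show "card (bounded_monomials X d) \<le> (d + 1) ^ card X" using assms by (simp add: card_PiE)
qed

lemma bounded_in_span:
  fixes p :: "('x \<Rightarrow>\<^sub>0 nat) \<Rightarrow>\<^sub>0 'k::field"
  assumes "p \<in> carrier (mpoly_ring X)" "exponents_bounded d p"
  shows "p \<in> mpoly_vs.span ((\<lambda>m. Poly_Mapping.single m 1) ` bounded_monomials X d)"
proof -
  have "(\<Sum>m\<in>Poly_Mapping.keys p. Poly_Mapping.single 0 (lookup p m) * Poly_Mapping.single m (1::'k)) \<in>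
    mpoly_vs.span ((\<lambda>m. Poly_Mapping.single m 1) ` bounded_monomials X d)"
  proof (rule mpoly_vs.span_sum)
    fix m assume "m \<in> Poly_Mapping.keys p"
    then have "m \<in> bounded_monomials X d" using assms by (simp add: mpoly_carrier_iff exponents_bounded_def bounded_monomials_def)
    then show "Poly_Mapping.single 0 (lookup p m) * Poly_Mapping.single m (1::'k) \<in>
      mpoly_vs.span ((\<lambda>m. Poly_Mapping.single m 1) ` bounded_monomials X d)"
      by (intro mpoly_vs.span_scale mpoly_vs.span_base) simp
  qed
  then show ?thesis by (simp add: mult_single sum_single_keys)
qed

text \<open>
  Independence is stated for families, as it arises from algebraic independence; it implies that distinct indices
  give distinct vectors.
\<close>
lemma card_independent_family_le:
  fixes F :: "'i \<Rightarrow> ('x \<Rightarrow>\<^sub>0 nat) \<Rightarrow>\<^sub>0 'k::field"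
  assumes "finite I" "finite T" "F ` I \<subseteq> mpoly_vs.span T"
    and indep: "\<And>c i. (\<Sum>i\<in>I. Poly_Mapping.single 0 (c i) * F i) = 0 \<Longrightarrow> i \<in> I \<Longrightarrow> c i = 0"
  shows "card I \<le> card T"
proof -
  have inj: "inj_on F I"
  proof (rule inj_onI, rule ccontr)
    fix i j assume ij: "i \<in> I" "j \<in> I" "F i = F j" "i \<noteq> j"
    let ?c = "\<lambda>l. if l = i then 1 else if l = j then - 1 else (0 :: 'k)"
    have "(\<Sum>l\<in>I. Poly_Mapping.single 0 (?c l) * F l) = (\<Sum>l\<in>{i, j}. Poly_Mapping.single 0 (?c l) * F l)"
      using ij assms(1) by (intro sum.mono_neutral_right) auto
    also have "\<dots> = 0" using ij by (simp add: single_uminus)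
    finally show False using indep[of ?c i] ij by simp
  qed
  have "mpoly_vs.independent (F ` I)"
    unfolding mpoly_vs.independent_explicit_finite_subsets
  proof (intro allI impI ballI)
    fix S u v assume S: "S \<subseteq> F ` I" "finite S" "(\<Sum>v\<in>S. Poly_Mapping.single 0 (u v) * v) = 0" "v \<in> S"
    let ?c = "\<lambda>i. if F i \<in> S then u (F i) else 0"
    have "(\<Sum>i\<in>I. Poly_Mapping.single 0 (?c i) * F i) = (\<Sum>w\<in>F ` I. Poly_Mapping.single 0 (if w \<in> S then u w else 0) * w)"
      by (simp add: sum.reindex[OF inj])
    also have "\<dots> = (\<Sum>w\<in>S. Poly_Mapping.single 0 (if w \<in> S then u w else 0) * w)"
      using S(1) assms(1) by (intro sum.mono_neutral_right) auto
    also have "\<dots> = 0" using S(3) by simp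
    finally have z: "(\<Sum>i\<in>I. Poly_Mapping.single 0 (?c i) * F i) = 0" .
    obtain i where "i \<in> I" "v = F i" using S by blast
    then show "u v = 0" using indep[OF z, of i] S(4) by simp
  qed
  then have "card (F ` I) \<le> card T" using mpoly_vs.independent_span_bound assms(2,3) by blast
  then show ?thesis using card_image[OF inj] by simp
qed

text \<open>
  A chain of length \<open>n\<close> gives \<open>n\<close> algebraically independent polynomials. Their \<open>k ^ n\<close> power products
  with exponents below \<open>k\<close> are linearly independent, but lie in the space of polynomials whose exponents are
  bounded by a linear function of \<open>k\<close>, and the dimension of this space grows at most like the \<open>card X\<close>-th power of \<open>k\<close>.
\<close>
theorem prime_chain_length_le:
  fixes C :: "nat \<Rightarrow> (('x \<Rightarrow>\<^sub>0 nat) \<Rightarrow>\<^sub>0 'k::field) set"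
  assumes "finite X" and chain: "prime_chain X C n"
  shows "n \<le> card X"
proof (rule ccontr)
  assume "\<not> n \<le> card X"
  then have n: "Suc (card X) \<le> n" by simp
  define fs where "fs = map (\<lambda>i. SOME f. f \<in> C (Suc i) - C i) [0..<n]"
  have len: "length fs = n" by (simp add: fs_def)
  have fs: "fs ! i \<in> C (Suc i) - C i" if "i < n" for i
  proof -
    have "\<exists>f. f \<in> C (Suc i) - C i" using chain that unfolding prime_chain_def by blast
    then show ?thesis using that someI_ex[of "\<lambda>f. f \<in> C (Suc i) - C i"] by (simp add: fs_def)
  qed
  have fsc: "set fs \<subseteq> carrier (mpoly_ring X)"
  proof
    fix f assume "f \<in> set fs"
    then obtain i where i: "i < n" "f = fs ! i" using len by (auto simp: in_set_conv_nth)
    have "primeideal (C (Suc i)) (mpoly_ring X)" using chain i(1) by (simp add: prime_chain_def)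
    then show "f \<in> carrier (mpoly_ring X)" using fs[OF i(1)] i(2) ideal_mpoly(1) primeideal_mpoly(1) by blast
  qed
  obtain e where e: "\<forall>f\<in>set fs. exponents_bounded e f" using exponents_bounded_list by blast
  have le: "k ^ n \<le> (n * (k * e) + 1) ^ card X" for k
  proof -
    let ?T = "(\<lambda>m. Poly_Mapping.single m (1 :: 'k)) ` bounded_monomials X (n * (k * e))"
    have P0: "0 \<in> C 0" using chain ideal_mpoly(2) primeideal_mpoly(1) unfolding prime_chain_def by blast
    have "card (exponents n k) \<le> card ?T"
    proof (rule card_independent_family_le)
      show "power_product fs ` exponents n k \<subseteq> mpoly_vs.span ?T"
      proof
        fix p assume "p \<in> power_product fs ` exponents n k"
        then obtain a where a: "a \<in> exponents n k" "p = power_product fs a" by blast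
        have "exponents_bounded (n * (k * e)) p"
          using exponents_bounded_power_product[OF e, of a k] a len by (simp add: exponents_def)
        then show "p \<in> mpoly_vs.span ?T" using bounded_in_span carrier_power_product[OF fsc] a(2) by blast
      qed
      fix c a assume "(\<Sum>a\<in>exponents n k. Poly_Mapping.single 0 (c a) * power_product fs a) = 0" "a \<in> exponents n k"
      then show "c a = 0" using power_products_independent[OF chain len fs, where k = k and c = c and a = a] P0 by simp
    qed (use finite_exponents card_bounded_monomials(1)[OF assms(1)] in auto)
    also have "\<dots> \<le> card (bounded_monomials X (n * (k * e)))" by (rule card_image_le) (rule card_bounded_monomials(1)[OF assms(1)])
    also have "\<dots> \<le> (n * (k * e) + 1) ^ card X" by (rule card_bounded_monomials(2)[OF assms(1)])
    finally show ?thesis by (simp add: card_exponents)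
  qed
  \<comment> \<open>The first \<open>k\<close> for which \<open>k ^ (card X + 1)\<close> exceeds \<open>(k * (n * e + 1)) ^ card X\<close>.\<close>
  define k where "k = (n * e + 1) ^ card X + 1"
  have k1: "k \<ge> 1" by (simp add: k_def)
  have "k * k ^ card X = k ^ Suc (card X)" by simp
  also have "\<dots> \<le> k ^ n" using n k1 by (rule power_increasing)
  also have "\<dots> \<le> (n * (k * e) + 1) ^ card X" by (rule le)
  also have "\<dots> \<le> (k * (n * e + 1)) ^ card X" using k1 by (intro power_mono) (auto simp: algebra_simps)
  also have "\<dots> = (n * e + 1) ^ card X * k ^ card X" by (simp only: power_mult_distrib mult.commute)
  finally have "k \<le> (n * e + 1) ^ card X" using k1 by simp
  then show False by (simp add: k_def)
qed

text \<open>
  A family of primes indexed by the subsets of \<open>E\<close> that grows strictly with each added element yields a chain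
  by adding the elements of \<open>E\<close> in any order.
\<close>
lemma prime_chain_of_family:
  fixes F :: "'e set \<Rightarrow> (('x \<Rightarrow>\<^sub>0 nat) \<Rightarrow>\<^sub>0 'k::field) set"
  assumes "finite E" and prime: "\<And>A. A \<subseteq> E \<Longrightarrow> primeideal (F A) (mpoly_ring X)"
    and step: "\<And>A e. A \<subseteq> E \<Longrightarrow> e \<in> E \<Longrightarrow> e \<notin> A \<Longrightarrow> F A \<subset> F (insert e A)"
  shows "\<exists>C. prime_chain X C (card E) \<and> C 0 = F {} \<and> C (card E) = F E"
proof -
  obtain es where es: "set es = E" "distinct es" using finite_distinct_list[OF assms(1)] by blast
  have len: "length es = card E" using es distinct_card by fastforce
  let ?C = "\<lambda>i. F (set (take i es))"
  have "?C i \<subset> ?C (Suc i)" if "i < card E" for i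
  proof -
    have "set (take (Suc i) es) = insert (es ! i) (set (take i es))"
      using that len by (simp add: take_Suc_conv_app_nth)
    moreover have "es ! i \<notin> set (take i es)"
      using that len es(2) by (auto simp: in_set_conv_nth nth_eq_iff_index_eq)
    moreover have "es ! i \<in> E" using that len es(1) by auto
    moreover have "set (take i es) \<subseteq> E" using es(1) set_take_subset by fastforce
    ultimately show ?thesis using step by simp
  qed
  moreover have "primeideal (?C i) (mpoly_ring X)" for i
    using es(1) set_take_subset by (intro prime) fastforce
  ultimately have "prime_chain X ?C (card E)" by (simp add: prime_chain_def)
  moreover have "?C 0 = F {}" "?C (card E) = F E" using es len by simp_all
  ultimately show ?thesis by blast
qed

lemma prime_chain_append:
  assumes "prime_chain X C m" "prime_chain X D n" "C m = D 0"
  shows "\<exists>B. prime_chain X B (m + n) \<and> B 0 = C 0 \<and> B (m + n) = D n"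
proof -
  define B where "B i = (if i \<le> m then C i else D (i - m))" for i
  have "primeideal (B i) (mpoly_ring X)" if "i \<le> m + n" for i
    using assms that by (auto simp: B_def prime_chain_def)
  moreover have "B i \<subset> B (Suc i)" if "i < m + n" for i
  proof -
    consider "i < m" | "i = m" | "i > m" by linarith
    then show ?thesis
    proof cases
      case 1 then show ?thesis using assms(1) by (simp add: B_def prime_chain_def)
    next
      case 2
      then have "D 0 \<subset> D (Suc 0)" using assms(2) that by (simp add: prime_chain_def)
      then show ?thesis using 2 assms(3) by (simp add: B_def)
    next
      case 3
      then have "D (i - m) \<subset> D (Suc (i - m))" using assms(2) that by (simp add: prime_chain_def)
      then show ?thesis using 3 by (simp add: B_def Suc_diff_le)
    qed
  qed
  ultimately have "prime_chain X B (m + n)" by (simp add: prime_chain_def)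
  moreover have "B 0 = C 0" "B (m + n) = D n" using assms(3) by (cases "n = 0"; simp add: B_def)+
  ultimately show ?thesis by blast
qed

text \<open>
  Explicit chains below and above \<open>P\<close> whose lengths add up to the number of variables pin down the height: a
  longer chain below \<open>P\<close>, continued by the one above, would exceed \<open>prime_chain_length_le\<close>.
\<close>
lemma prime_height_eqI:
  fixes P :: "(('x \<Rightarrow>\<^sub>0 nat) \<Rightarrow>\<^sub>0 'k::field) set"
  assumes "finite X" "prime_chain X C m" "C m = P" "prime_chain X D l" "D 0 = P" "m + l = card X"
  shows "prime_height (mpoly_ring X) P = enat m"
proof (rule antisym)
  show "prime_height (mpoly_ring X) P \<le> enat m"
    unfolding prime_height_def
  proof (rule SUP_least)
    fix n assume "n \<in> {n. \<exists>C. C n = P \<and> (\<forall>i\<le>n. primeideal (C i) (mpoly_ring X)) \<and> (\<forall>i<n. C i \<subset> C (Suc i))}"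
    then obtain C' where "C' n = P" "prime_chain X C' n" by (auto simp: prime_chain_def)
    then obtain B :: "nat \<Rightarrow> (('x \<Rightarrow>\<^sub>0 nat) \<Rightarrow>\<^sub>0 'k) set" where "prime_chain X B (n + l)"
      using prime_chain_append[of X C' n, OF _ assms(4)] assms(5) by auto
    then have "n + l \<le> card X" by (rule prime_chain_length_le[OF assms(1)])
    then show "enat n \<le> enat m" using assms(6) by simp
  qed
  show "enat m \<le> prime_height (mpoly_ring X) P"
    unfolding prime_height_def
    by (rule SUP_upper) (use assms(2,3) in \<open>auto simp: prime_chain_def\<close>)
qed

section \<open>The primes attached to vertex partitions and their heights\<close>

definition edge_vars :: "'a set \<Rightarrow> 'a edge_var set" where
  "edge_vars V = VarX ` V \<union> VarY ` V"

lemma finite_edge_vars: "finite V \<Longrightarrow> finite (edge_vars V)"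
  by (simp add: edge_vars_def)

lemma card_edge_vars: "finite V \<Longrightarrow> card (edge_vars V) = 2 * card V"
  unfolding edge_vars_def by (subst card_Un_disjoint) (auto simp: card_image inj_on_def)

lemma edge_vars_iff [simp]: "VarX i \<in> edge_vars V \<longleftrightarrow> i \<in> V" "VarY i \<in> edge_vars V \<longleftrightarrow> i \<in> V"
  by (auto simp: edge_vars_def)

text \<open>
  A parametrization of the variety of \<open>P\<^sub>S\<close>: the points \<open>(x\<^sub>i, y\<^sub>i)\<close> vanish for \<open>i \<in> S\<close> and are proportional
  within each class of \<open>r\<close>, the variable \<open>VarY (r i)\<close> serving as the common slope. So the target is the polynomial ring
  itself, with the second variables of representatives in the role of slopes.
\<close>
definition component_subst :: "'a set \<Rightarrow> ('a \<Rightarrow> 'a) \<Rightarrow> 'a edge_var \<Rightarrow> ('a edge_var \<Rightarrow>\<^sub>0 nat) \<Rightarrow>\<^sub>0 'k::field" where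
  "component_subst S r z = (case z of
     VarX i \<Rightarrow> if i \<in> S then 0 else pvar (VarX i)
   | VarY i \<Rightarrow> if i \<in> S then 0 else pvar (VarX i) * pvar (VarY (r i)))"

definition component_prime :: "'a set \<Rightarrow> 'a set \<Rightarrow> ('a \<Rightarrow> 'a) \<Rightarrow> (('a edge_var \<Rightarrow>\<^sub>0 nat) \<Rightarrow>\<^sub>0 'k::field) set" where
  "component_prime V S r = psubst_ker (edge_vars V) (component_subst S r)"

text \<open>
  Interpolates between an injective substitution and \<open>component_subst S r\<close>: only the specializations
  named in \<open>E\<close> are carried out. A representative \<open>i = r i\<close> has \<open>VarY i\<close> sent to \<open>VarX i * VarY i\<close> from the
  beginning, so that the slope of its class is available when other vertices join.
\<close>
definition partial_subst :: "'a set \<Rightarrow> ('a \<Rightarrow> 'a) \<Rightarrow> 'a edge_var set \<Rightarrow> 'a edge_var \<Rightarrow> ('a edge_var \<Rightarrow>\<^sub>0 nat) \<Rightarrow>\<^sub>0 'k::field" where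
  "partial_subst S r E z = (case z of
     VarX i \<Rightarrow> if VarX i \<in> E then 0 else pvar (VarX i)
   | VarY i \<Rightarrow> if i \<in> S then (if VarY i \<in> E then 0 else pvar (VarY i))
       else if VarY i \<in> E \<or> r i = i then pvar (VarX i) * pvar (VarY (r i)) else pvar (VarY i))"

lemma psubst_ker_psubsetI:
  assumes "\<And>x. x \<in> X \<Longrightarrow> \<tau> x = psubst \<chi> (\<sigma> x)"
    and "q \<in> carrier (mpoly_ring X)" "psubst \<tau> q = 0" "psubst \<sigma> q \<noteq> 0"
  shows "psubst_ker X \<sigma> \<subset> psubst_ker X \<tau>"
proof -
  have "psubst_ker X \<sigma> \<subseteq> psubst_ker X \<tau>" by (rule psubst_ker_subset) (rule assms(1))
  moreover have "q \<in> psubst_ker X \<tau>" "q \<notin> psubst_ker X \<sigma>" using assms by (simp_all add: psubst_ker_def)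
  ultimately show ?thesis by blast
qed

text \<open>
  Each specialization kills one variable of the target or replaces it by a product of others, which enlarges the
  kernel: by a variable for \<open>i \<in> S\<close> (two steps per vertex), and by the minor of \<open>r i\<close> and \<open>i\<close> when a vertex
  \<open>i \<noteq> r i\<close> joins its class. The number of steps is \<open>2 |S|\<close> plus the number of vertices outside \<open>S\<close> that are not
  representatives.
\<close>
lemma chain_below_component_prime:
  fixes V S :: "'a set"
  assumes "finite V" "S \<subseteq> V"
    and r: "\<And>i. i \<in> V - S \<Longrightarrow> r i \<in> V - S \<and> r (r i) = r i"
  shows "\<exists>C :: nat \<Rightarrow> (('a edge_var \<Rightarrow>\<^sub>0 nat) \<Rightarrow>\<^sub>0 'k::field) set.
     prime_chain (edge_vars V) C (card V + card S - card (r ` (V - S))) \<and>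
     C (card V + card S - card (r ` (V - S))) = component_prime V S r"
proof -
  define E where "E = VarX ` S \<union> VarY ` (S \<union> {i \<in> V - S. r i \<noteq> i})"
  define F :: "'a edge_var set \<Rightarrow> (('a edge_var \<Rightarrow>\<^sub>0 nat) \<Rightarrow>\<^sub>0 'k) set" where "F A = psubst_ker (edge_vars V) (partial_subst S r A)" for A
  have finS: "finite S" using assms finite_subset by blast
  have finE: "finite E" using assms(1) finS by (simp add: E_def)
  have step: "F A \<subset> F (insert e A)" if A: "A \<subseteq> E" "e \<in> E" "e \<notin> A" for A e
  proof -
    consider (x) i where "e = VarX i" "i \<in> S" | (y) i where "e = VarY i" "i \<in> S"
      | (m) i where "e = VarY i" "i \<in> V - S" "r i \<noteq> i" using A(2) by (auto simp: E_def)
    then show ?thesis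
    proof cases
      case x
      then have iV: "i \<in> V" using assms(2) by blast
      show ?thesis unfolding F_def
      proof (rule psubst_ker_psubsetI[where \<chi> = "pvar(VarX i := 0)" and q = "pvar (VarX i)"])
        fix z assume "z \<in> edge_vars V"
        then show "partial_subst S r (insert e A) z = psubst (pvar(VarX i := 0)) (partial_subst S r A z)"
          using x by (cases z) (auto simp: partial_subst_def psubst_mult)
      qed (use x iV A in \<open>auto simp: partial_subst_def carrier_pvar\<close>)
    next
      case y
      then have iV: "i \<in> V" using assms(2) by blast
      show ?thesis unfolding F_def
      proof (rule psubst_ker_psubsetI[where \<chi> = "pvar(VarY i := 0)" and q = "pvar (VarY i)"])
        fix z assume z: "z \<in> edge_vars V"
        show "partial_subst S r (insert e A) z = psubst (pvar(VarY i := 0)) (partial_subst S r A z)"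
        proof (cases z)
          case (VarY j)
          then have "j \<in> V" using z by simp
          then have "j \<notin> S \<Longrightarrow> r j \<noteq> i" using r[of j] y by blast
          then show ?thesis using y VarY by (auto simp: partial_subst_def psubst_mult)
        qed (use y in \<open>auto simp: partial_subst_def psubst_mult\<close>)
      qed (use y iV A in \<open>auto simp: partial_subst_def carrier_pvar\<close>)
    next
      case m
      have ri: "r i \<in> V - S" "r (r i) = r i" using r[of i] m by auto
      have xA: "VarX j \<notin> A" if "j \<notin> S" for j using A(1) that by (auto simp: E_def)
      let ?q = "pvar (VarX (r i)) * pvar (VarY i) - pvar (VarX i) * pvar (VarY (r i)) :: ('a edge_var \<Rightarrow>\<^sub>0 nat) \<Rightarrow>\<^sub>0 'k"
      have new: "psubst (partial_subst S r (insert e A)) ?q = 0"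
        using m ri xA by (auto simp: psubst_diff psubst_mult partial_subst_def mult_ac)
      \<comment> \<open>Before \<open>i\<close> joins its class, \<open>VarY i\<close> is still a free variable; setting it to zero kills only one of the two
        terms of the minor.\<close>
      have old: "psubst (partial_subst S r A) ?q \<noteq> 0"
      proof
        assume "psubst (partial_subst S r A) ?q = 0"
        then have "(pvar (VarX (r i)) * pvar (VarY i) :: ('a edge_var \<Rightarrow>\<^sub>0 nat) \<Rightarrow>\<^sub>0 'k) = 
          pvar (VarX i) * (pvar (VarX (r i)) * pvar (VarY (r i)))"
          using m ri xA A(3) by (simp add: psubst_diff psubst_mult partial_subst_def)
        then have "psubst (pvar(VarY i := 0)) (pvar (VarX (r i)) * pvar (VarY i) :: ('a edge_var \<Rightarrow>\<^sub>0 nat) \<Rightarrow>\<^sub>0 'k) = 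
          psubst (pvar(VarY i := 0)) (pvar (VarX i) * (pvar (VarX (r i)) * pvar (VarY (r i))))" by simp
        then have "(pvar (VarX i) * (pvar (VarX (r i)) * pvar (VarY (r i))) :: ('a edge_var \<Rightarrow>\<^sub>0 nat) \<Rightarrow>\<^sub>0 'k) = 0"
          using m(3) by (simp add: psubst_mult)
        then show False by (simp add: mpoly_mult_eq_0_iff)
      qed
      show ?thesis unfolding F_def
      proof (rule psubst_ker_psubsetI[OF _ _ new old, where \<chi> = "pvar(VarY i := pvar (VarX i) * pvar (VarY (r i)))"])
        fix z assume z: "z \<in> edge_vars V"
        show "partial_subst S r (insert e A) z =
          psubst (pvar(VarY i := pvar (VarX i) * pvar (VarY (r i)))) (partial_subst S r A z)"
        proof (cases z)
          case (VarY j)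
          then have "j \<in> V" using z by simp
          then have "j \<notin> S \<Longrightarrow> r j \<noteq> i" using r[of j] m ri by auto
          then show ?thesis using m VarY A(3) by (auto simp: partial_subst_def psubst_mult)
        qed (use m in \<open>auto simp: partial_subst_def psubst_mult\<close>)
      next
        show "?q \<in> carrier (mpoly_ring (edge_vars V))"
          using m ri by (intro carrier_diff carrier_mult carrier_pvar) auto
      qed
    qed
  qed
  obtain C where C: "prime_chain (edge_vars V) C (card E)" "C (card E) = F E"
    using prime_chain_of_family[OF finE, of F "edge_vars V", OF _ step] primeideal_psubst_ker
    unfolding F_def by blast
  have "component_subst S r z = psubst pvar (partial_subst S r E z)" 
      "partial_subst S r E z = psubst pvar (component_subst S r z :: ('a edge_var \<Rightarrow>\<^sub>0 nat) \<Rightarrow>\<^sub>0 'k)" if "z \<in> edge_vars V" for z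
    using that unfolding psubst_pvar_id by (cases z; auto simp: component_subst_def partial_subst_def E_def)+
  then have FE: "F E = component_prime V S r"
    unfolding F_def component_prime_def
    by (intro subset_antisym psubst_ker_subset[where \<chi> = pvar]) (auto simp: psubst_pvar_id)
  have reps: "r ` (V - S) = {i \<in> V - S. r i = i}" using r by force
  have "card E = card S + (card S + card {i \<in> V - S. r i \<noteq> i})"
  proof -
    have "card E = card S + card (S \<union> {i \<in> V - S. r i \<noteq> i})"
      unfolding E_def using finS assms(1) by (subst card_Un_disjoint) (auto simp: card_image inj_on_def)
    moreover have "card (S \<union> {i \<in> V - S. r i \<noteq> i}) = card S + card {i \<in> V - S. r i \<noteq> i}"
      using finS assms(1) by (intro card_Un_disjoint) auto
    ultimately show ?thesis by simp
  qed
  also have "card {i \<in> V - S. r i \<noteq> i} = card (V - S) - card (r ` (V - S))"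
  proof -
    have "{i \<in> V - S. r i \<noteq> i} = (V - S) - r ` (V - S)" unfolding reps by blast
    then show ?thesis using assms(1) r by (simp add: card_Diff_subset image_subset_iff)
  qed
  also have "card S + (card S + (card (V - S) - card (r ` (V - S)))) = card V + card S - card (r ` (V - S))"
  proof -
    have "card (V - S) = card V - card S" "card S \<le> card V" using assms finS by (simp_all add: card_Diff_subset card_mono)
    moreover have "card (r ` (V - S)) \<le> card (V - S)" using assms(1) by (simp add: card_image_le)
    ultimately show ?thesis by linarith
  qed
  finally have "card E = card V + card S - card (r ` (V - S))" .
  then show ?thesis using C unfolding FE by (intro exI[of _ C]) simp
qed

text \<open>
  Above the component prime, the variables of the target are killed one at a time. The slopes have to go first: once
  \<open>VarX (r i)\<close> is zero, killing the slope \<open>VarY (r i)\<close> need not enlarge the kernel any more.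
\<close>
lemma chain_above_component_prime:
  fixes V S :: "'a set"
  assumes "finite V" "S \<subseteq> V"
    and r: "\<And>i. i \<in> V - S \<Longrightarrow> r i \<in> V - S \<and> r (r i) = r i"
  shows "\<exists>D :: nat \<Rightarrow> (('a edge_var \<Rightarrow>\<^sub>0 nat) \<Rightarrow>\<^sub>0 'k::field) set.
     prime_chain (edge_vars V) D (card (r ` (V - S)) + card (V - S)) \<and> D 0 = component_prime V S r"
proof -
  let ?kill = "\<lambda>A z. if z \<in> A then 0 else pvar z :: ('a edge_var \<Rightarrow>\<^sub>0 nat) \<Rightarrow>\<^sub>0 'k"
  define \<tau> where "\<tau> A z = psubst (?kill A) (component_subst S r z)" for A z
  define F where "F A = psubst_ker (edge_vars V) (\<tau> A)" for A
  have psub: "F A \<subset> F (insert e A)" if "q \<in> edge_vars V" "\<tau> A q \<noteq> 0" "\<tau> (insert e A) q = 0" for A e q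
    unfolding F_def
  proof (rule psubst_ker_psubsetI[where \<chi> = "?kill {e}" and q = "pvar q"])
    fix z :: "'a edge_var"
    have "(\<lambda>x. psubst (?kill {e}) (?kill A x)) = ?kill (insert e A)" by auto
    then show "\<tau> (insert e A) z = psubst (?kill {e}) (\<tau> A z)" unfolding \<tau>_def psubst_psubst by simp
  qed (use that in \<open>auto simp: carrier_pvar\<close>)
  let ?Y = "VarY ` r ` (V - S)" and ?X = "VarX ` (V - S)"
  have "\<exists>C. prime_chain (edge_vars V) C (card ?Y) \<and> C 0 = F {} \<and> C (card ?Y) = F ?Y"
  proof (rule prime_chain_of_family)
    fix A e assume A: "A \<subseteq> ?Y" "e \<in> ?Y" "e \<notin> A"
    then obtain i where i: "i \<in> V - S" "e = VarY (r i)" by auto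
    have "r i \<in> V - S" "r (r i) = r i" using r i by auto
    moreover have "VarX (r i) \<notin> A" using A(1) by auto
    ultimately show "F A \<subset> F (insert e A)"
      using A(3) i by (intro psub[of "VarY (r i)"])
        (auto simp: \<tau>_def component_subst_def psubst_mult mpoly_mult_eq_0_iff)
  qed (use assms(1) primeideal_psubst_ker F_def in auto)
  then obtain C where C: "prime_chain (edge_vars V) C (card ?Y)" "C 0 = F {}" "C (card ?Y) = F ?Y" by blast
  have "\<exists>C. prime_chain (edge_vars V) C (card ?X) \<and> C 0 = F (?Y \<union> {}) \<and> C (card ?X) = F (?Y \<union> ?X)"
  proof (rule prime_chain_of_family[where F = "\<lambda>A. F (?Y \<union> A)"])
    fix A e assume A: "A \<subseteq> ?X" "e \<in> ?X" "e \<notin> A"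
    then obtain i where i: "i \<in> V - S" "e = VarX i" by auto
    then have "F (?Y \<union> A) \<subset> F (insert e (?Y \<union> A))"
      using A(3) by (intro psub[of "VarX i"]) (auto simp: \<tau>_def component_subst_def)
    then show "F (?Y \<union> A) \<subset> F (?Y \<union> insert e A)" by simp
  qed (use assms(1) primeideal_psubst_ker F_def in auto)
  then obtain C' where C': "prime_chain (edge_vars V) C' (card ?X)" "C' 0 = F ?Y" by auto
  obtain D where D: "prime_chain (edge_vars V) D (card ?Y + card ?X)" "D 0 = F {}"
    using prime_chain_append[OF C(1) C'(1)] C(2,3) C'(2) by auto
  moreover have "\<tau> {} = component_subst S r" by (rule ext) (simp add: \<tau>_def psubst_pvar_id)
  then have "F {} = component_prime V S r" by (simp add: F_def component_prime_def)
  moreover have "card ?Y = card (r ` (V - S))" "card ?X = card (V - S)"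
    by (simp_all add: card_image inj_on_def)
  ultimately show ?thesis by (intro exI[of _ D]) simp
qed

theorem height_component_prime:
  fixes V S :: "'a set"
  assumes "finite V" "S \<subseteq> V"
    and r: "\<And>i. i \<in> V - S \<Longrightarrow> r i \<in> V - S \<and> r (r i) = r i"
  shows "prime_height (mpoly_ring (edge_vars V)) (component_prime V S r :: (('a edge_var \<Rightarrow>\<^sub>0 nat) \<Rightarrow>\<^sub>0 'k::field) set)
    = enat (card V + card S - card (r ` (V - S)))"
proof -
  obtain C D :: "nat \<Rightarrow> (('a edge_var \<Rightarrow>\<^sub>0 nat) \<Rightarrow>\<^sub>0 'k) set" where
    C: "prime_chain (edge_vars V) C (card V + card S - card (r ` (V - S)))"
       "C (card V + card S - card (r ` (V - S))) = component_prime V S r" and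
    D: "prime_chain (edge_vars V) D (card (r ` (V - S)) + card (V - S))" "D 0 = component_prime V S r"
    using chain_below_component_prime[OF assms] chain_above_component_prime[OF assms] by blast
  have finS: "finite S" using assms finite_subset by blast
  have "card (V - S) = card V - card S" "card S \<le> card V" using assms finS by (simp_all add: card_Diff_subset card_mono)
  moreover have "card (r ` (V - S)) \<le> card (V - S)" using assms(1) by (simp add: card_image_le)
  ultimately have total: "card V + card S - card (r ` (V - S)) + (card (r ` (V - S)) + card (V - S)) = card (edge_vars V)"
    using card_edge_vars[OF assms(1)] by linarith
  show ?thesis by (rule prime_height_eqI[OF finite_edge_vars[OF assms(1)] C D total])
qed

section \<open>Generators of the component primes\<close>

definition total_degree :: "('x \<Rightarrow>\<^sub>0 nat) \<Rightarrow> nat" where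
  "total_degree m = (\<Sum>x\<in>Poly_Mapping.keys m. lookup m x)"

lemma total_degree_add: "total_degree (m + n) = total_degree m + total_degree n"
  unfolding total_degree_def
proof -
  let ?A = "Poly_Mapping.keys m \<union> Poly_Mapping.keys n"
  have "(\<Sum>x\<in>Poly_Mapping.keys m. lookup m x) = (\<Sum>x\<in>?A. lookup m x)"
    "(\<Sum>x\<in>Poly_Mapping.keys n. lookup n x) = (\<Sum>x\<in>?A. lookup n x)"
    by (rule sum.mono_neutral_left; auto simp: in_keys_iff)+
  then show "(\<Sum>x\<in>Poly_Mapping.keys (m + n). lookup (m + n) x) =
    (\<Sum>x\<in>Poly_Mapping.keys m. lookup m x) + (\<Sum>x\<in>Poly_Mapping.keys n. lookup n x)"
    by (simp add: keys_add_nat lookup_add sum.distrib)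
qed

lemma total_degree_single [simp]: "total_degree (Poly_Mapping.single x k) = k"
  by (cases "k = 0") (simp_all add: total_degree_def)

lemma monomial_nonempty: "m \<noteq> 0 \<Longrightarrow> \<exists>x. x \<in> Poly_Mapping.keys m"
  using keys_eq_empty[of m] by blast

lemma monomial_split:
  assumes "x \<in> Poly_Mapping.keys (m :: 'x \<Rightarrow>\<^sub>0 nat)"
  obtains m' where "m = Poly_Mapping.single x 1 + m'" 
proof
  show "m = Poly_Mapping.single x 1 + (m - Poly_Mapping.single x 1)"
    using assms by (intro poly_mapping_eqI) (auto simp: lookup_add lookup_minus lookup_single when_def in_keys_iff)
qed

lemma single_add_one: "Poly_Mapping.single (m + n) (1 :: 'k::field) = Poly_Mapping.single m 1 * Poly_Mapping.single n 1"
  by (simp add: mult_single)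

abbreviation minor :: "'a \<Rightarrow> 'a \<Rightarrow> (('a edge_var \<Rightarrow>\<^sub>0 nat) \<Rightarrow>\<^sub>0 'k::field)" where
  "minor i j \<equiv> pvar (VarX i) * pvar (VarY j) - pvar (VarX j) * pvar (VarY i)"

text \<open>
  An ideal that contains the evident elements of a component prime: the variables of \<open>S\<close> and the
  minors within the classes of \<open>r\<close>. The aim is that it contains all of the component prime.
\<close>
locale component_ideal =
  fixes V S :: "'a set" and r :: "'a \<Rightarrow> 'a" and Q :: "(('a edge_var \<Rightarrow>\<^sub>0 nat) \<Rightarrow>\<^sub>0 'k::field) set"
  assumes ideal: "ideal Q (mpoly_ring (edge_vars V))"
    and vars: "\<And>i. i \<in> S \<Longrightarrow> pvar (VarX i) \<in> Q \<and> pvar (VarY i) \<in> Q"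
    and minors: "\<And>i j. i \<in> V - S \<Longrightarrow> j \<in> V - S \<Longrightarrow> r i = r j \<Longrightarrow> minor i j \<in> Q"
begin

abbreviation \<sigma> :: "'a edge_var \<Rightarrow> ('a edge_var \<Rightarrow>\<^sub>0 nat) \<Rightarrow>\<^sub>0 'k" where "\<sigma> \<equiv> component_subst S r"

lemmas idl = ideal_mpoly[OF ideal]

text \<open>
  Exchanging the roles of \<open>i\<close> and \<open>j\<close> in \<open>x\<^sub>i y\<^sub>j\<close> changes a monomial by a multiple of a minor.
\<close>
lemma swap_monomial:
  assumes n: "Poly_Mapping.keys n \<subseteq> edge_vars V" "VarX i \<in> Poly_Mapping.keys n" "VarY j \<in> Poly_Mapping.keys n"
    and ij: "i \<notin> S" "j \<notin> S" "r i = r j"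
  obtains n' where "Poly_Mapping.keys n' \<subseteq> edge_vars V" "VarY i \<in> Poly_Mapping.keys n'"
    "msubst \<sigma> n' = msubst \<sigma> n" "total_degree n' = total_degree n"
    "Poly_Mapping.single n 1 - Poly_Mapping.single n' 1 \<in> Q"
proof -
  obtain n1 where n1: "n = Poly_Mapping.single (VarX i) 1 + n1" using n(2) by (rule monomial_split)
  have "VarY j \<in> Poly_Mapping.keys n1" using n(3) unfolding n1 keys_add_nat by simp
  then obtain n0 where n0: "n1 = Poly_Mapping.single (VarY j) 1 + n0" by (rule monomial_split)
  define n' where "n' = Poly_Mapping.single (VarX j) 1 + (Poly_Mapping.single (VarY i) 1 + n0)"
  have keys: "i \<in> V" "j \<in> V" "Poly_Mapping.keys n0 \<subseteq> edge_vars V"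
    using n(1) unfolding n1 n0 keys_add_nat by auto
  have "Poly_Mapping.single n 1 - Poly_Mapping.single n' (1::'k) = Poly_Mapping.single n0 1 * minor i j"
    unfolding n1 n0 n'_def single_add_one pvar_def by (simp add: algebra_simps)
  moreover have "minor i j \<in> Q" using minors keys ij by blast
  then have "Poly_Mapping.single n0 1 * minor i j \<in> Q" by (rule idl(4)) (rule carrier_single[OF keys(3)])
  ultimately have "Poly_Mapping.single n 1 - Poly_Mapping.single n' (1::'k) \<in> Q" by simp
  moreover have "msubst \<sigma> n' = msubst \<sigma> n"
    unfolding n1 n0 n'_def msubst_add using ij by (simp add: component_subst_def mult_ac)
  moreover have "total_degree n' = total_degree n"
    unfolding n1 n0 n'_def total_degree_add by simp
  moreover have "Poly_Mapping.keys n' \<subseteq> edge_vars V" "VarY i \<in> Poly_Mapping.keys n'"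
    using keys unfolding n'_def keys_add_nat by auto
  ultimately show ?thesis using that by blast
qed

text \<open>
  Setting a variable \<open>v\<close> of the target to zero detects whether \<open>v\<close> occurs in the image of a monomial. Monomials with
  the same image are compared in this way, without computing exponents of images.
\<close>
lemma killed_variable:
  assumes "msubst \<sigma> m = msubst \<sigma> n" "x \<in> Poly_Mapping.keys m" "psubst (pvar(v := 0)) (\<sigma> x) = 0"
  shows "\<exists>y\<in>Poly_Mapping.keys n. psubst (pvar(v := 0)) (\<sigma> y) = 0"
proof -
  have "psubst (pvar(v := 0)) (msubst \<sigma> m) = 0"
    unfolding psubst_msubst msubst_eq_0 using assms(2,3) by blast
  then have "psubst (pvar(v := 0)) (msubst \<sigma> n) = 0" using assms(1) by simp
  then show ?thesis unfolding psubst_msubst msubst_eq_0 .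
qed

lemma subst_nonzero:
  assumes "msubst \<sigma> m \<noteq> 0" "Poly_Mapping.keys m \<subseteq> edge_vars V"
  shows "VarX i \<in> Poly_Mapping.keys m \<Longrightarrow> i \<in> V - S" "VarY i \<in> Poly_Mapping.keys m \<Longrightarrow> i \<in> V - S"
proof -
  have "\<sigma> x \<noteq> 0" if "x \<in> Poly_Mapping.keys m" for x using assms(1) that msubst_eq_0 by blast
  then show "VarX i \<in> Poly_Mapping.keys m \<Longrightarrow> i \<in> V - S" "VarY i \<in> Poly_Mapping.keys m \<Longrightarrow> i \<in> V - S"
    using assms(2) by (force simp: component_subst_def)+
qed

lemma kill_VarX: 
  "msubst \<sigma> m = msubst \<sigma> n \<Longrightarrow> msubst \<sigma> n \<noteq> 0 \<Longrightarrow> x = VarX i \<or> x = VarY i \<Longrightarrow> x \<in> Poly_Mapping.keys m \<Longrightarrow>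
    VarX i \<in> Poly_Mapping.keys n \<or> VarY i \<in> Poly_Mapping.keys n"
proof -
  assume a: "msubst \<sigma> m = msubst \<sigma> n" "msubst \<sigma> n \<noteq> 0" "x = VarX i \<or> x = VarY i" "x \<in> Poly_Mapping.keys m"
  have "psubst (pvar(VarX i := 0)) (\<sigma> x) = 0" using a(3) by (auto simp: component_subst_def psubst_mult)
  then obtain y where y: "y \<in> Poly_Mapping.keys n" "psubst (pvar(VarX i := 0)) (\<sigma> y) = 0"
    using killed_variable a by blast
  have "\<sigma> y \<noteq> 0" using a(2) y(1) msubst_eq_0 by blast
  then show ?thesis using y
    by (cases y) (auto simp: component_subst_def psubst_mult mpoly_mult_eq_0_iff split: if_splits)
qed

lemma kill_VarY: 
  assumes "msubst \<sigma> m = msubst \<sigma> n" "msubst \<sigma> n \<noteq> 0" "VarY i \<in> Poly_Mapping.keys m"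
  shows "\<exists>j. j \<notin> S \<and> r j = r i \<and> VarY j \<in> Poly_Mapping.keys n"
proof -
  have "psubst (pvar(VarY (r i) := 0)) (\<sigma> (VarY i)) = 0" by (simp add: component_subst_def psubst_mult)
  then obtain y where y: "y \<in> Poly_Mapping.keys n" "psubst (pvar(VarY (r i) := 0)) (\<sigma> y) = 0"
    using killed_variable assms by blast
  have "\<sigma> y \<noteq> 0" using assms(2) y(1) msubst_eq_0 by blast
  then show ?thesis using y
    by (cases y) (auto simp: component_subst_def psubst_mult mpoly_mult_eq_0_iff split: if_splits)
qed

text \<open>
  Two monomials with the same image differ by an element of the ideal. If they share a variable, it can be cancelled.
  If they share none and one contains \<open>x\<^sub>i\<close>, then comparing occurrences of \<open>x\<^sub>i\<close> and of the slope of \<open>i\<close> in the images shows that the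
  other contains \<open>y\<^sub>i\<close> and the first contains some \<open>y\<^sub>j\<close> with \<open>j\<close> in the class of \<open>i\<close>. A swap of \<open>i\<close> and \<open>j\<close> then creates the
  shared variable \<open>y\<^sub>i\<close>.
\<close>
lemma binomial_in_ideal:
  assumes "msubst \<sigma> m = msubst \<sigma> n" "msubst \<sigma> n \<noteq> 0"
    "Poly_Mapping.keys m \<subseteq> edge_vars V" "Poly_Mapping.keys n \<subseteq> edge_vars V"
  shows "Poly_Mapping.single m 1 - Poly_Mapping.single n 1 \<in> Q"
  using assms
proof (induction "total_degree m" arbitrary: m n rule: less_induct)
  case less
  have shared: "Poly_Mapping.single m' 1 - Poly_Mapping.single n' 1 \<in> Q"
    if sh: "x \<in> Poly_Mapping.keys m'" "x \<in> Poly_Mapping.keys n'" "msubst \<sigma> m' = msubst \<sigma> n'" "msubst \<sigma> n' \<noteq> 0"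
      "total_degree m' = total_degree m" 
      "Poly_Mapping.keys m' \<subseteq> edge_vars V" "Poly_Mapping.keys n' \<subseteq> edge_vars V" for x m' n'
  proof -
    obtain m1 where m1: "m' = Poly_Mapping.single x 1 + m1" using sh(1) by (rule monomial_split)
    obtain n1 where n1: "n' = Poly_Mapping.single x 1 + n1" using sh(2) by (rule monomial_split)
    have sx: "\<sigma> x \<noteq> 0" using sh(2,4) msubst_eq_0 by blast
    have "\<sigma> x * msubst \<sigma> m1 = \<sigma> x * msubst \<sigma> n1" using sh(3) unfolding m1 n1 msubst_add by simp
    then have eq: "msubst \<sigma> m1 = msubst \<sigma> n1" using sx by (rule mpoly_mult_left_cancel)
    have nz: "msubst \<sigma> n1 \<noteq> 0" using sh(4) unfolding n1 msubst_add by auto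
    have keys: "x \<in> edge_vars V" "Poly_Mapping.keys m1 \<subseteq> edge_vars V" "Poly_Mapping.keys n1 \<subseteq> edge_vars V"
      using sh(6,7) unfolding m1 n1 keys_add_nat by auto
    have "total_degree m1 < total_degree m" using sh(5) unfolding m1 total_degree_add by simp
    then have "Poly_Mapping.single m1 1 - Poly_Mapping.single n1 1 \<in> Q" using less.hyps eq nz keys by blast
    then have "pvar x * (Poly_Mapping.single m1 1 - Poly_Mapping.single n1 1) \<in> Q"
      using idl(4) carrier_pvar[OF keys(1)] by blast
    moreover have "pvar x * (Poly_Mapping.single m1 1 - Poly_Mapping.single n1 1) = 
      Poly_Mapping.single m' 1 - Poly_Mapping.single n' (1 :: 'k)"
      unfolding m1 n1 single_add_one pvar_def by (simp add: right_diff_distrib)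
    ultimately show ?thesis by simp
  qed
  note mn = less.prems
  show ?case
  proof (cases "\<exists>x. x \<in> Poly_Mapping.keys m \<and> x \<in> Poly_Mapping.keys n")
    case True then show ?thesis using shared mn by blast
  next
    case disj: False
    show ?thesis
    proof (cases "m = 0")
      case True
      have "n = 0"
      proof (rule ccontr)
        assume "n \<noteq> 0"
        then obtain x where x: "x \<in> Poly_Mapping.keys n" using monomial_nonempty by blast
        obtain i where "x = VarX i \<or> x = VarY i" by (cases x) auto
        then show False using kill_VarX[of n m x i] mn x True by auto
      qed
      then show ?thesis using True idl(2) by simp
    next
      case False
      then obtain x where x: "x \<in> Poly_Mapping.keys m" using monomial_nonempty by blast
      show ?thesis
      proof (cases x)
        case (VarX i)
        then have i: "i \<in> V - S" "VarX i \<in> Poly_Mapping.keys m" using subst_nonzero(1)[of m i] mn x by auto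
        have ny: "VarY i \<in> Poly_Mapping.keys n" using kill_VarX[of m n x i] mn x VarX disj by blast
        obtain j where j: "j \<notin> S" "r j = r i" "VarY j \<in> Poly_Mapping.keys m"
          using kill_VarY[of n m i] mn ny by auto
        obtain m' where m': "Poly_Mapping.keys m' \<subseteq> edge_vars V" "VarY i \<in> Poly_Mapping.keys m'"
          "msubst \<sigma> m' = msubst \<sigma> m" "total_degree m' = total_degree m"
          "Poly_Mapping.single m 1 - Poly_Mapping.single m' 1 \<in> Q"
          using swap_monomial[OF mn(3) i(2) j(3)] i j by auto
        have "Poly_Mapping.single m' 1 - Poly_Mapping.single n 1 \<in> Q"
          by (rule shared[OF m'(2) ny]) (use m' mn in auto)
        from idl(3)[OF m'(5) this] show ?thesis by simp
      next
        case (VarY i)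
        then have i: "i \<in> V - S" using subst_nonzero(2)[of m i] mn x by auto
        have nx: "VarX i \<in> Poly_Mapping.keys n" using kill_VarX[of m n x i] mn x VarY disj by blast
        obtain j where j: "j \<notin> S" "r j = r i" "VarY j \<in> Poly_Mapping.keys n"
          using kill_VarY[of m n i] mn x VarY by auto
        obtain n' where n': "Poly_Mapping.keys n' \<subseteq> edge_vars V" "VarY i \<in> Poly_Mapping.keys n'"
          "msubst \<sigma> n' = msubst \<sigma> n" "total_degree n' = total_degree n"
          "Poly_Mapping.single n 1 - Poly_Mapping.single n' 1 \<in> Q"
          using swap_monomial[OF mn(4) nx j(3)] i j by auto
        have "Poly_Mapping.single m 1 - Poly_Mapping.single n' 1 \<in> Q"
          by (rule shared[of "VarY i"]) (use n' mn x VarY in auto)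
        from idl(6)[OF this n'(5)] show ?thesis by simp
      qed
    qed
  qed
qed

lemma msubst_is_monomial: "msubst \<sigma> m = 0 \<or> (\<exists>\<mu>. msubst \<sigma> m = Poly_Mapping.single \<mu> 1)"
proof (cases "msubst \<sigma> m = 0")
  case False
  have "\<exists>\<mu>. \<sigma> x = Poly_Mapping.single \<mu> 1" if "x \<in> Poly_Mapping.keys m" for x
  proof -
    have "\<sigma> x \<noteq> 0" using False msubst_eq_0 that by blast
    then show ?thesis
      by (cases x) (auto simp: component_subst_def pvar_def mult_single split: if_splits)
  qed
  then obtain \<mu> where "\<And>x. x \<in> Poly_Mapping.keys m \<Longrightarrow> \<sigma> x = Poly_Mapping.single (\<mu> x) 1" by metis
  moreover have "Poly_Mapping.single \<nu> (1::'k) ^ k = Poly_Mapping.single (\<Sum>i<k. \<nu>) 1" for \<nu> :: "'a edge_var \<Rightarrow>\<^sub>0 nat" and k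
    using prod_single_one[where I = "{..<k}" and f = "\<lambda>_. \<nu>" and ?'k = 'k] by simp
  ultimately have "msubst \<sigma> m = (\<Prod>x\<in>Poly_Mapping.keys m. Poly_Mapping.single (\<Sum>i<lookup m x. \<mu> x) 1)"
    unfolding msubst_def by (intro prod.cong) auto
  then show ?thesis unfolding prod_single_one by blast
qed simp

text \<open>
  The substitution maps monomials to monomials or zero. So a monomial of an element of the kernel either maps to zero
  and contains a variable of \<open>S\<close>, or its image has to be cancelled by that of another monomial of the
  same element. Both cases allow removing the monomial modulo \<open>Q\<close>.
\<close>
theorem component_prime_subset: "component_prime V S r \<subseteq> Q"
proof
  fix p :: "('a edge_var \<Rightarrow>\<^sub>0 nat) \<Rightarrow>\<^sub>0 'k"
  assume "p \<in> component_prime V S r"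
  then show "p \<in> Q"
  proof (induction "card (Poly_Mapping.keys p)" arbitrary: p rule: less_induct)
    case less
    have pc: "\<And>m. m \<in> Poly_Mapping.keys p \<Longrightarrow> Poly_Mapping.keys m \<subseteq> edge_vars V" and p0: "psubst \<sigma> p = 0"
      and pcar: "p \<in> carrier (mpoly_ring (edge_vars V))"
      using less.prems by (auto simp: component_prime_def psubst_ker_def mpoly_carrier_iff)
    show ?case
    proof (cases "p = 0")
      case True then show ?thesis using idl(2) by simp
    next
      case False
      then obtain m where m: "m \<in> Poly_Mapping.keys p" using monomial_nonempty by blast
      let ?c = "lookup p m"
      have c: "?c \<noteq> 0" using m by (simp add: in_keys_iff)
      have reduce: "p \<in> Q" if q: "q \<in> Q" "psubst \<sigma> q = 0" "Poly_Mapping.keys (p - q) \<subseteq> Poly_Mapping.keys p - {m}" for q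
      proof -
        have "card (Poly_Mapping.keys (p - q)) < card (Poly_Mapping.keys p)"
          using q(3) m by (intro psubset_card_mono) auto
        moreover have "p - q \<in> carrier (mpoly_ring (edge_vars V))"
          by (rule carrier_diff[OF pcar]) (use q(1) idl(1) in blast)
        then have "p - q \<in> component_prime V S r"
          using q(2) p0 by (simp add: component_prime_def psubst_ker_def psubst_diff)
        ultimately have "p - q \<in> Q" by (rule less.hyps)
        from idl(3)[OF this q(1)] show ?thesis by simp
      qed
      show ?thesis
      proof (cases "msubst \<sigma> m = 0")
        case True
        then obtain x where x: "x \<in> Poly_Mapping.keys m" "\<sigma> x = 0" unfolding msubst_eq_0 by blast
        then have "pvar x \<in> Q" using vars
          by (cases x) (auto simp: component_subst_def mpoly_mult_eq_0_iff split: if_splits)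
        obtain m' where m': "m = Poly_Mapping.single x 1 + m'" using x(1) by (rule monomial_split)
        have "Poly_Mapping.keys m' \<subseteq> edge_vars V" using pc[OF m] unfolding m' keys_add_nat by blast
        then have "Poly_Mapping.single m' ?c * pvar x \<in> Q" using idl(4)[OF \<open>pvar x \<in> Q\<close>] carrier_single by blast
        moreover have "Poly_Mapping.single m' ?c * pvar x = Poly_Mapping.single m ?c"
          unfolding pvar_def mult_single m' by (simp add: add.commute)
        ultimately have "Poly_Mapping.single m ?c \<in> Q" by simp
        then show ?thesis
        proof (rule reduce)
          show "psubst \<sigma> (Poly_Mapping.single m ?c) = 0" using True by (simp add: psubst_single)
          show "Poly_Mapping.keys (p - Poly_Mapping.single m ?c) \<subseteq> Poly_Mapping.keys p - {m}"
            by (auto simp: in_keys_iff lookup_minus lookup_single when_def split: if_splits)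
        qed
      next
        case False
        then obtain \<mu> where \<mu>: "msubst \<sigma> m = Poly_Mapping.single \<mu> 1" using msubst_is_monomial by blast
        have "\<exists>n\<in>Poly_Mapping.keys p. n \<noteq> m \<and> msubst \<sigma> n = msubst \<sigma> m"
        proof (rule ccontr)
          assume no: "\<not> ?thesis"
          have "lookup (psubst \<sigma> p) \<mu> = (\<Sum>n\<in>Poly_Mapping.keys p. lookup (Poly_Mapping.single 0 (lookup p n) * msubst \<sigma> n) \<mu>)"
            by (simp add: psubst_def lookup_sum)
          also have "\<dots> = (\<Sum>n\<in>Poly_Mapping.keys p. if n = m then ?c else 0)"
          proof (rule sum.cong[OF refl])
            fix n assume n: "n \<in> Poly_Mapping.keys p"
            show "lookup (Poly_Mapping.single 0 (lookup p n) * msubst \<sigma> n) \<mu> = (if n = m then ?c else 0)"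
            proof (cases "n = m")
              case True then show ?thesis using \<mu> by (simp add: mult_single)
            next
              case False
              then have "msubst \<sigma> n \<noteq> Poly_Mapping.single \<mu> 1" using no n \<mu> by auto
              then show ?thesis using False msubst_is_monomial[of n]
                by (auto simp: mult_single lookup_single when_def)
            qed
          qed
          also have "\<dots> = ?c" using m by simp
          finally show False using p0 c by simp
        qed
        then obtain n where n: "n \<in> Poly_Mapping.keys p" "n \<noteq> m" "msubst \<sigma> m = msubst \<sigma> n" by metis
        have "Poly_Mapping.single m 1 - Poly_Mapping.single n 1 \<in> Q"
          using binomial_in_ideal[OF n(3)] False n pc m by simp
        then have q: "Poly_Mapping.single 0 ?c * (Poly_Mapping.single m 1 - Poly_Mapping.single n 1) \<in> Q"
          using idl(4) carrier_single[of 0 "edge_vars V" ?c] by simp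
        have e: "Poly_Mapping.single 0 ?c * (Poly_Mapping.single m 1 - Poly_Mapping.single n 1) =
          Poly_Mapping.single m ?c - Poly_Mapping.single n ?c"
          by (simp add: right_diff_distrib mult_single)
        from q show ?thesis unfolding e
        proof (rule reduce)
          show "psubst \<sigma> (Poly_Mapping.single m ?c - Poly_Mapping.single n ?c) = 0"
            using n by (simp add: psubst_diff psubst_single)
          show "Poly_Mapping.keys (p - (Poly_Mapping.single m ?c - Poly_Mapping.single n ?c)) \<subseteq> Poly_Mapping.keys p - {m}"
            using n by (auto simp: in_keys_iff lookup_minus lookup_single when_def split: if_splits)
        qed
      qed
    qed
  qed
qed

end

section \<open>Minimal primes of binomial edge ideals\<close>

context adjacency begin

definition rep :: "'a set \<Rightarrow> 'a \<Rightarrow> 'a" where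
  "rep U i = (SOME j. j \<in> conn U `` {i})"

lemma rep_props:
  assumes "i \<in> U"
  shows "(i, rep U i) \<in> conn U" "rep U i \<in> U" "rep U (rep U i) = rep U i"
proof -
  have "rep U i \<in> conn U `` {i}" unfolding rep_def by (rule someI[of _ i]) (simp add: assms conn_refl)
  then show 1: "(i, rep U i) \<in> conn U" by simp
  then show "rep U i \<in> U" by (rule conn_in)
  show "rep U (rep U i) = rep U i"
    unfolding rep_def[of U "rep U i"] equiv_class_eq[OF equiv_conn 1, symmetric] by (simp only: rep_def)
qed

lemma rep_eq_iff:
  assumes "i \<in> U" "j \<in> U"
  shows "rep U i = rep U j \<longleftrightarrow> (i, j) \<in> conn U"
proof
  assume "rep U i = rep U j"
  then have "(i, rep U i) \<in> conn U" "(rep U i, j) \<in> conn U"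
    using rep_props(1)[OF assms(1)] conn_sym[OF rep_props(1)[OF assms(2)]] by simp_all
  then show "(i, j) \<in> conn U" by (rule conn_trans)
next
  assume "(i, j) \<in> conn U"
  then show "rep U i = rep U j" using equiv_class_eq[OF equiv_conn] by (simp add: rep_def)
qed

lemma card_rep: "card (rep U ` U) = component_count U"
proof -
  let ?g = "\<lambda>X. SOME j. j \<in> X"
  have "U // conn U = (\<lambda>x. conn U `` {x}) ` U" by (auto simp: quotient_def)
  then have "rep U ` U = ?g ` (U // conn U)" by (simp only: rep_def[abs_def] image_image)
  moreover have "inj_on ?g (U // conn U)"
  proof (rule inj_onI)
    fix X Y assume X: "X \<in> U // conn U" and Y: "Y \<in> U // conn U" and eq: "?g X = ?g Y"
    have "?g X \<in> X" "?g Y \<in> Y" unfolding some_in_eq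
      by (rule in_quotient_imp_non_empty[OF equiv_conn X], rule in_quotient_imp_non_empty[OF equiv_conn Y])
    then show "X = Y" using quotient_disj[OF equiv_conn X Y] eq by auto
  qed
  ultimately show ?thesis by (simp add: card_image component_count_def)
qed

end

lemma pvar_inject: "pvar x = (pvar y :: ('x \<Rightarrow>\<^sub>0 nat) \<Rightarrow>\<^sub>0 'k::field) \<Longrightarrow> x = y"
proof (rule ccontr)
  assume eq: "pvar x = (pvar y :: ('x \<Rightarrow>\<^sub>0 nat) \<Rightarrow>\<^sub>0 'k)" and ne: "x \<noteq> y"
  have "psubst (pvar(x := 0)) (pvar x) = psubst (pvar(x := 0)) (pvar y :: ('x \<Rightarrow>\<^sub>0 nat) \<Rightarrow>\<^sub>0 'k)" using eq by simp
  then show False using ne by (simp add: eq_commute[of 0])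
qed

text \<open>
  The type argument fixes the coefficient field, which does not occur in the graph.
\<close>
locale graph_on = adjacency adj for adj :: "'a \<Rightarrow> 'a \<Rightarrow> bool" (infix \<open>\<sim>\<close> 50) +
  fixes V :: "'a set" and K :: "'k::field itself"
  assumes finite_V: "finite V" and adj_V: "x \<sim> y \<Longrightarrow> x \<in> V \<and> y \<in> V"
begin

abbreviation R :: "(('a edge_var \<Rightarrow>\<^sub>0 nat) \<Rightarrow>\<^sub>0 'k) ring" where "R \<equiv> mpoly_ring (edge_vars V)"

definition edge_ideal :: "(('a edge_var \<Rightarrow>\<^sub>0 nat) \<Rightarrow>\<^sub>0 'k) set" where
  "edge_ideal = Idl\<^bsub>R\<^esub> {minor i j | i j. i \<sim> j}"

definition cut_prime :: "'a set \<Rightarrow> (('a edge_var \<Rightarrow>\<^sub>0 nat) \<Rightarrow>\<^sub>0 'k) set" where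
  "cut_prime S = component_prime V S (rep (V - S))"

lemma primeideal_cut_prime: "primeideal (cut_prime S) R"
  unfolding cut_prime_def component_prime_def by (rule primeideal_psubst_ker)

lemma minor_carrier: "i \<in> V \<Longrightarrow> j \<in> V \<Longrightarrow> (minor i j :: ('a edge_var \<Rightarrow>\<^sub>0 nat) \<Rightarrow>\<^sub>0 'k) \<in> carrier R"
  by (intro carrier_diff carrier_mult carrier_pvar) auto

lemma edge_ideal_subset_iff:
  assumes "ideal Q R"
  shows "edge_ideal \<subseteq> Q \<longleftrightarrow> (\<forall>i j. i \<sim> j \<longrightarrow> minor i j \<in> Q)"
proof -
  interpret ring R using cring_mpoly_ring by (rule cring.axioms(1))
  have "{minor i j | i j. i \<sim> j} \<subseteq> carrier R" using minor_carrier adj_V by blast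
  then show ?thesis unfolding edge_ideal_def using Idl_subset_ideal[OF assms] by blast
qed

lemma VarX_in_cut_prime: "i \<in> V \<Longrightarrow> pvar (VarX i) \<in> cut_prime S \<longleftrightarrow> i \<in> S"
  by (simp add: cut_prime_def component_prime_def psubst_ker_def component_subst_def carrier_pvar)

lemma VarY_in_cut_prime: "i \<in> V \<Longrightarrow> i \<in> S \<Longrightarrow> pvar (VarY i) \<in> cut_prime S"
  by (simp add: cut_prime_def component_prime_def psubst_ker_def component_subst_def carrier_pvar)

lemma minor_in_cut_prime:
  assumes "i \<in> V - S" "j \<in> V - S"
  shows "minor i j \<in> cut_prime S \<longleftrightarrow> (i, j) \<in> conn (V - S)"
proof -
  let ?r = "rep (V - S)"
  have "minor i j \<in> cut_prime S \<longleftrightarrow> psubst (component_subst S ?r) (minor i j) = (0 :: ('a edge_var \<Rightarrow>\<^sub>0 nat) \<Rightarrow>\<^sub>0 'k)"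
    using minor_carrier assms by (simp add: cut_prime_def component_prime_def psubst_ker_def)
  also have "psubst (component_subst S ?r) (minor i j) = 
     pvar (VarX i) * (pvar (VarX j) * (pvar (VarY (?r j)) - pvar (VarY (?r i)) :: ('a edge_var \<Rightarrow>\<^sub>0 nat) \<Rightarrow>\<^sub>0 'k))"
    using assms by (simp add: psubst_diff psubst_mult component_subst_def algebra_simps)
  also have "\<dots> = 0 \<longleftrightarrow> ?r i = ?r j" using pvar_inject by (fastforce simp: mpoly_mult_eq_0_iff)
  also have "\<dots> \<longleftrightarrow> (i, j) \<in> conn (V - S)" using assms by (rule rep_eq_iff)
  finally show ?thesis .
qed

lemma minor_in_cut_prime_deleted:
  assumes "i \<in> V" "j \<in> V" "i \<in> S"
  shows "minor i j \<in> cut_prime S" "minor j i \<in> cut_prime S"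
  using minor_carrier assms by (simp_all add: cut_prime_def component_prime_def psubst_ker_def psubst_diff psubst_mult component_subst_def)

lemma edge_ideal_subset_cut_prime: "edge_ideal \<subseteq> cut_prime S"
  unfolding edge_ideal_subset_iff[OF primeideal_mpoly(1)[OF primeideal_cut_prime]]
proof (intro allI impI)
  fix i j assume ij: "i \<sim> j"
  then have V: "i \<in> V" "j \<in> V" using adj_V by auto
  consider "i \<in> S" | "j \<in> S" | "i \<in> V - S" "j \<in> V - S" using V by blast
  then show "minor i j \<in> cut_prime S"
  proof cases
    case 3
    then have "(i, j) \<in> conn (V - S)" using ij by (rule conn_step)
    then show ?thesis using minor_in_cut_prime[OF 3] by simp
  qed (use minor_in_cut_prime_deleted V in blast)+
qed

lemma cut_prime_subset:
  assumes "ideal Q R" "S \<subseteq> V" "\<And>i. i \<in> S \<Longrightarrow> pvar (VarX i) \<in> Q \<and> pvar (VarY i) \<in> Q"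
    "\<And>i j. (i, j) \<in> conn (V - S) \<Longrightarrow> minor i j \<in> Q"
  shows "cut_prime S \<subseteq> Q"
proof -
  interpret component_ideal V S "rep (V - S)" Q
  proof (rule component_ideal.intro)
    show "ideal Q R" by (fact assms(1))
    show "pvar (VarX i) \<in> Q \<and> pvar (VarY i) \<in> Q" if "i \<in> S" for i using assms(3) that .
    show "minor i j \<in> Q" if "i \<in> V - S" "j \<in> V - S" "rep (V - S) i = rep (V - S) j" for i j
      using that rep_eq_iff assms(4) by simp
  qed
  show ?thesis unfolding cut_prime_def by (rule component_prime_subset)
qed

text \<open>
  Along a walk, \<open>y\<^sub>j (x\<^sub>i y\<^sub>k - x\<^sub>k y\<^sub>i) = y\<^sub>k (x\<^sub>i y\<^sub>j - x\<^sub>j y\<^sub>i) + y\<^sub>i (x\<^sub>j y\<^sub>k - x\<^sub>k y\<^sub>j)\<close>, and similarly with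
  \<open>x\<close> for \<open>y\<close> in the factors. As \<open>x\<^sub>j\<close> and \<open>y\<^sub>j\<close> are not both in the prime ideal, one of them can be cancelled.
\<close>
lemma minor_in_prime:
  assumes Q: "primeideal Q R" "edge_ideal \<subseteq> Q" and T: "T = {i \<in> V. pvar (VarX i) \<in> Q \<and> pvar (VarY i) \<in> Q}"
    and "(i, j) \<in> conn (V - T)"
  shows "minor i j \<in> Q"
proof -
  note I = ideal_mpoly[OF primeideal_mpoly(1)[OF Q(1)]]
  from assms(4) have "i \<in> V" by (auto dest: conn_in(1))
  from assms(4) show ?thesis
  proof (induction rule: conn_induct)
    case base show ?case using I(2) by simp
  next
    case (step j k)
    have V: "j \<in> V" "k \<in> V" using step.hyps by auto
    have jk: "minor j k \<in> Q" using step.hyps Q(2) edge_ideal_subset_iff[OF primeideal_mpoly(1)[OF Q(1)]] by blast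
    have c: "pvar (VarX l) \<in> carrier R" "pvar (VarY l) \<in> carrier R" if "l \<in> V" for l
      using that by (simp_all add: carrier_pvar)
    have "pvar (VarX k) * minor i j + pvar (VarX i) * minor j k \<in> Q"
      using I(3)[OF I(4)[OF step.IH c(1)[OF V(2)]] I(4)[OF jk c(1)[OF \<open>i \<in> V\<close>]]] .
    then have x: "pvar (VarX j) * minor i k \<in> Q" by (simp add: algebra_simps)
    have "pvar (VarY k) * minor i j + pvar (VarY i) * minor j k \<in> Q"
      using I(3)[OF I(4)[OF step.IH c(2)[OF V(2)]] I(4)[OF jk c(2)[OF \<open>i \<in> V\<close>]]] .
    then have y: "pvar (VarY j) * minor i k \<in> Q" by (simp add: algebra_simps)
    have "\<not> (pvar (VarX j) \<in> Q \<and> pvar (VarY j) \<in> Q)" using step.hyps T by blast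
    then show ?case
      using primeideal_mpoly(3)[OF Q(1) c(1)[OF V(1)] minor_carrier[OF \<open>i \<in> V\<close> V(2)] x]
        primeideal_mpoly(3)[OF Q(1) c(2)[OF V(1)] minor_carrier[OF \<open>i \<in> V\<close> V(2)] y] by blast
  qed
qed

lemma cut_prime_subset_prime:
  assumes Q: "primeideal Q R" "edge_ideal \<subseteq> Q" and T: "T = {i \<in> V. pvar (VarX i) \<in> Q \<and> pvar (VarY i) \<in> Q}"
  shows "cut_prime T \<subseteq> Q"
  by (rule cut_prime_subset[OF primeideal_mpoly(1)[OF Q(1)]]) (use T minor_in_prime[OF Q T] in auto)

text \<open>
  A prime \<open>Q\<close> between \<open>edge_ideal\<close> and \<open>cut_prime S\<close> contains \<open>cut_prime T\<close>, where \<open>T \<subseteq> S\<close> collects the vertices whose variables lie in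
  \<open>Q\<close>. If some \<open>s \<in> S\<close> were missing from \<open>T\<close>, then two components of \<open>V - S\<close> would be joined through \<open>s\<close>, and \<open>Q\<close> would
  contain a minor that \<open>cut_prime S\<close> does not.
\<close>
lemma cutset_minimal_prime:
  assumes S: "cutset V S"
  shows "cut_prime S \<in> minimal_primes R edge_ideal"
  unfolding minimal_primes_def
proof (intro CollectI conjI allI impI)
  show "primeideal (cut_prime S) R" "edge_ideal \<subseteq> cut_prime S" by (rule primeideal_cut_prime edge_ideal_subset_cut_prime)+
  fix Q assume "primeideal Q R \<and> edge_ideal \<subseteq> Q \<and> Q \<subseteq> cut_prime S"
  then have Q: "primeideal Q R" "edge_ideal \<subseteq> Q" "Q \<subseteq> cut_prime S" by auto
  have SV: "S \<subseteq> V" using S by (simp add: cutset_def)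
  define T where "T = {i \<in> V. pvar (VarX i) \<in> Q \<and> pvar (VarY i) \<in> Q}"
  have "T \<subseteq> S" using Q(3) VarX_in_cut_prime by (auto simp: T_def)
  moreover have "S \<subseteq> T"
  proof
    fix s assume s: "s \<in> S"
    show "s \<in> T"
    proof (rule ccontr)
      assume sT: "s \<notin> T"
      obtain i j where ij: "i \<in> V - S" "j \<in> V - S" "s \<sim> i" "s \<sim> j" "(i, j) \<notin> conn (V - S)"
        using S s unfolding cutset_def separates_def by blast
      have "i \<in> V - T" "j \<in> V - T" "s \<in> V - T" using ij \<open>T \<subseteq> S\<close> s sT SV by auto
      then have "(i, s) \<in> conn (V - T)" "(s, j) \<in> conn (V - T)" using ij adj_sym conn_step by simp_all
      then have "(i, j) \<in> conn (V - T)" by (rule conn_trans)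
      then have "minor i j \<in> Q" by (rule minor_in_prime[OF Q(1,2) T_def])
      then have "minor i j \<in> cut_prime S" using Q(3) by (rule subsetD[rotated])
      then show False using minor_in_cut_prime[OF ij(1,2)] ij(5) by simp
    qed
  qed
  ultimately have "T = S" by blast
  then have "cut_prime S \<subseteq> Q" using cut_prime_subset_prime[OF Q(1,2) T_def] by simp
  then show "Q = cut_prime S" using Q(3) by blast
qed

text \<open>
  A minimal prime equals \<open>cut_prime T\<close> for the set \<open>T\<close> of vertices whose variables it contains. If some \<open>s \<in> T\<close> joined no two components,
  \<open>cut_prime (T - {s})\<close> would be a strictly smaller prime over \<open>edge_ideal\<close>.
\<close>
lemma minimal_prime_cutset:
  assumes "Q \<in> minimal_primes R edge_ideal"
  shows "\<exists>T. cutset V T \<and> Q = cut_prime T"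
proof -
  have Q: "primeideal Q R" "edge_ideal \<subseteq> Q" and min: "\<And>Q'. primeideal Q' R \<Longrightarrow> edge_ideal \<subseteq> Q' \<Longrightarrow> Q' \<subseteq> Q \<Longrightarrow> Q' = Q"
  proof -
    have *: "primeideal Q R \<and> edge_ideal \<subseteq> Q \<and> (\<forall>Q'. primeideal Q' R \<and> edge_ideal \<subseteq> Q' \<and> Q' \<subseteq> Q \<longrightarrow> Q' = Q)"
      using assms unfolding minimal_primes_def by (rule CollectD)
    then show "primeideal Q R" "edge_ideal \<subseteq> Q" by simp_all
    show "Q' = Q" if "primeideal Q' R" "edge_ideal \<subseteq> Q'" "Q' \<subseteq> Q" for Q'
      using *[THEN conjunct2, THEN conjunct2, rule_format, of Q'] that by simp
  qed
  define T where "T = {i \<in> V. pvar (VarX i) \<in> Q \<and> pvar (VarY i) \<in> Q}"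
  have TV: "T \<subseteq> V" by (auto simp: T_def)
  have eq: "cut_prime T = Q" using min[OF primeideal_cut_prime edge_ideal_subset_cut_prime cut_prime_subset_prime[OF Q T_def]] .
  have "separates s (V - T)" if s: "s \<in> T" for s
  proof (rule ccontr)
    assume n: "\<not> separates s (V - T)"
    have sV: "s \<in> V" using s TV by blast
    have e: "V - (T - {s}) = insert s (V - T)" using s TV by blast
    have "cut_prime (T - {s}) \<subseteq> cut_prime T"
    proof (rule cut_prime_subset[OF primeideal_mpoly(1)[OF primeideal_cut_prime]])
      show "T - {s} \<subseteq> V" using TV by blast
      show "pvar (VarX i) \<in> cut_prime T \<and> pvar (VarY i) \<in> cut_prime T" if "i \<in> T - {s}" for i
        using that TV VarX_in_cut_prime VarY_in_cut_prime by blast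
      fix i j assume c: "(i, j) \<in> conn (V - (T - {s}))"
      then have ij: "i \<in> insert s (V - T)" "j \<in> insert s (V - T)" unfolding e by (auto dest: conn_in)
      consider "i = s" | "j = s" | "i \<in> V - T" "j \<in> V - T" using ij by blast
      then show "minor i j \<in> cut_prime T"
      proof cases
        case 3
        then have "(i, j) \<in> conn (V - T)" using conn_insert_nonseparating[OF n] c e by simp
        then show ?thesis using minor_in_cut_prime[OF 3] by simp
      qed (use minor_in_cut_prime_deleted s sV ij TV in blast)+
    qed
    then have "cut_prime (T - {s}) = cut_prime T" using min[OF primeideal_cut_prime edge_ideal_subset_cut_prime] eq by simp
    then show False using VarX_in_cut_prime[OF sV] s by blast
  qed
  then have "cutset V T" using TV by (simp add: cutset_def)
  then show ?thesis using eq by blast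
qed

lemma component_count_le_card: "finite U \<Longrightarrow> component_count U \<le> card U"
  using card_image_le[of U "rep U"] by (simp add: card_rep)

lemma height_cut_prime:
  assumes "S \<subseteq> V"
  shows "prime_height R (cut_prime S) = enat (card V + card S - component_count (V - S))"
  unfolding cut_prime_def
  by (subst height_component_prime[OF finite_V assms]) (use rep_props(2,3)[of _ "V - S"] in \<open>auto simp: card_rep\<close>)

text \<open>
  The empty set is a cut set, so equality of all heights \<open>n + |S| - c(S)\<close> means equality with the one for \<open>S = {}\<close>.
\<close>
theorem unmixed_iff:
  "unmixed_ideal R edge_ideal \<longleftrightarrow> (\<forall>S. cutset V S \<longrightarrow> component_count (V - S) = card S + component_count V)"
proof -
  have arith: "card V + card S - component_count (V - S) = card V - component_count V \<longleftrightarrow> component_count (V - S) = card S + component_count V" if "S \<subseteq> V" for S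
  proof -
    have "finite S" using that finite_V finite_subset by blast
    then have "card (V - S) = card V - card S" "card S \<le> card V"
      using that finite_V by (simp_all add: card_Diff_subset card_mono)
    moreover have "component_count (V - S) \<le> card (V - S)" "component_count V \<le> card V" using finite_V by (intro component_count_le_card; simp)+
    ultimately show ?thesis by arith
  qed
  have empty: "cutset V {}" by (simp add: cutset_def)
  show ?thesis
  proof
    assume u: "unmixed_ideal R edge_ideal"
    show "\<forall>S. cutset V S \<longrightarrow> component_count (V - S) = card S + component_count V"
    proof (intro allI impI)
      fix S assume S: "cutset V S"
      then have SV: "S \<subseteq> V" by (simp add: cutset_def)
      have "prime_height R (cut_prime S) = prime_height R (cut_prime {})"
        using u[unfolded unmixed_ideal_def, rule_format, OF cutset_minimal_prime[OF S] cutset_minimal_prime[OF empty]] .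
      then show "component_count (V - S) = card S + component_count V" using height_cut_prime[OF SV] height_cut_prime[of "{}"] arith[OF SV] by simp
    qed
  next
    assume a: "\<forall>S. cutset V S \<longrightarrow> component_count (V - S) = card S + component_count V"
    have "prime_height R Q = enat (card V - component_count V)" if q: "Q \<in> minimal_primes R edge_ideal" for Q
    proof -
      from minimal_prime_cutset[OF q] obtain T where "cutset V T \<and> Q = cut_prime T" ..
      then have T: "cutset V T" "Q = cut_prime T" by (rule conjunct1, rule conjunct2)
      have TV: "T \<subseteq> V" using T(1) by (simp add: cutset_def)
      have "component_count (V - T) = card T + component_count V" using a[rule_format, OF T(1)] .
      then show ?thesis using height_cut_prime[OF TV] T(2) arith[OF TV] by simp
    qed
    then show "unmixed_ideal R edge_ideal" unfolding unmixed_ideal_def by simp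
  qed
qed

end

section \<open>The theorem for finite simple graphs\<close>

context adjacency begin

text \<open>
  Transfers connectivity and cut sets between a graph and its induced subgraphs.
\<close>
lemma restrict_adjacency:
  assumes "adjacency adj'" and agree: "\<And>x y. x \<in> W \<Longrightarrow> y \<in> W \<Longrightarrow> adj' x y \<longleftrightarrow> x \<sim> y"
  shows "U \<subseteq> W \<Longrightarrow> adjacency.conn adj' U = conn U" "U \<subseteq> W \<Longrightarrow> adjacency.component_count adj' U = component_count U"
    "adjacency.cutset adj' W S \<longleftrightarrow> cutset W S"
proof -
  interpret B: adjacency adj' by fact
  show c: "B.conn U = conn U" if "U \<subseteq> W" for U
  proof -
    have "{(a, b). a \<in> U \<and> b \<in> U \<and> adj' a b} = {(a, b). a \<in> U \<and> b \<in> U \<and> a \<sim> b}"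
      using agree that by blast
    then show ?thesis by (simp add: B.conn_def conn_def)
  qed
  show "B.component_count U = component_count U" if "U \<subseteq> W" for U using c[OF that] by (simp add: B.component_count_def component_count_def)
  have "B.separates s (W - S) \<longleftrightarrow> separates s (W - S)" if "s \<in> W"
    for s unfolding B.separates_def separates_def using c[of "W - S"] agree that by auto
  then show "B.cutset W S \<longleftrightarrow> cutset W S" unfolding B.cutset_def cutset_def by blast
qed

end

lemma adjacency_graph:
  assumes "Digraph.graph G" shows "adjacency (\<lambda>u v. u \<rightarrow>\<^bsub>G\<^esub> v)"
proof -
  interpret G: graph G by fact
  show ?thesis
  proof
    show "v \<rightarrow>\<^bsub>G\<^esub> u" if "u \<rightarrow>\<^bsub>G\<^esub> v" for u v using arcs_ends_symmetric[OF G.sym_arcs that] .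
    show "\<not> u \<rightarrow>\<^bsub>G\<^esub> u" for u using G.no_loops by (auto simp: arcs_ends_conv)
  qed
qed

lemma graph_induce_subgraph:
  assumes "Digraph.graph G" "W \<subseteq> verts G" shows "Digraph.graph (G \<restriction> W)"
proof -
  interpret G: graph G by fact
  have "symmetric (G \<restriction> W)"
    using induced_graph_imp_symmetric[OF G.sym_arcs G.induced_induce[OF assms(2)]] .
  then show ?thesis
    using assms(2) G.no_loops G.no_multi_arcs
    by unfold_locales (auto simp: arc_to_ends_def intro: finite_subset)
qed

lemma induce_subgraph_adj: "u \<rightarrow>\<^bsub>G \<restriction> W\<^esub> v \<longleftrightarrow> u \<in> W \<and> v \<in> W \<and> u \<rightarrow>\<^bsub>G\<^esub> v"
  by (auto simp: arcs_ends_conv)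

lemma reachable_iff_conn:
  assumes "Digraph.graph G"
  shows "u \<rightarrow>\<^sup>*\<^bsub>G\<^esub> v \<longleftrightarrow> (u, v) \<in> adjacency.conn (\<lambda>u v. u \<rightarrow>\<^bsub>G\<^esub> v) (verts G)"
proof -
  interpret G: graph G by fact
  interpret adjacency "\<lambda>u v. u \<rightarrow>\<^bsub>G\<^esub> v" using assms by (rule adjacency_graph)
  show ?thesis
  proof
    assume "u \<rightarrow>\<^sup>*\<^bsub>G\<^esub> v"
    then show "(u, v) \<in> conn (verts G)"
    proof (induction rule: G.reachable_induct)
      case (step x y)
      then have "(x, y) \<in> conn (verts G)" by (intro conn_step) (auto dest: G.adj_in_verts)
      then show ?case using step.IH conn_trans by blast
    qed (rule conn_refl)
  next
    assume "(u, v) \<in> conn (verts G)"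
    then show "u \<rightarrow>\<^sup>*\<^bsub>G\<^esub> v"
    proof (induction rule: conn_induct)
      case base
      then show ?case using conn_in(1)[OF \<open>(u, v) \<in> conn (verts G)\<close>] by simp
    next
      case (step y z) then show ?case by (meson G.reachable_adj_trans)
    qed
  qed
qed

lemma num_components_graph:
  assumes "Digraph.graph G"
  shows "num_components G = adjacency.component_count (\<lambda>u v. u \<rightarrow>\<^bsub>G\<^esub> v) (verts G)"
proof -
  interpret G: graph G by fact
  interpret adjacency "\<lambda>u v. u \<rightarrow>\<^bsub>G\<^esub> v" using assms by (rule adjacency_graph)
  have "G.scc_of u = conn (verts G) `` {u}" for u
    using conn_sym[of _ _ "verts G"] by (auto simp: G.scc_of_def reachable_iff_conn[OF assms])
  then have "G.sccs_verts = verts G // conn (verts G)"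
    by (auto simp: G.sccs_verts_conv_scc_of quotient_def)
  then show ?thesis by (simp add: num_components_def component_count_def G.card_sccs_verts[symmetric])
qed

lemma num_components_del_verts:
  assumes "Digraph.graph G"
  shows "num_components (del_verts G S) = adjacency.component_count (\<lambda>u v. u \<rightarrow>\<^bsub>G\<^esub> v) (verts G - S)"
proof -
  interpret adjacency "\<lambda>u v. u \<rightarrow>\<^bsub>G\<^esub> v" using assms by (rule adjacency_graph)
  let ?H = "G \<restriction> (verts G - S)"
  have H: "Digraph.graph ?H" using assms by (rule graph_induce_subgraph) blast
  have "num_components ?H = adjacency.component_count (\<lambda>u v. u \<rightarrow>\<^bsub>?H\<^esub> v) (verts G - S)"
    using num_components_graph[OF H] by simp
  also have "\<dots> = component_count (verts G - S)"
    by (rule restrict_adjacency(2)[OF adjacency_graph[OF H], of "verts G - S"]) (auto simp: induce_subgraph_adj)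
  finally show ?thesis by (simp add: del_verts_def)
qed

lemma cut_set_iff_cutset:
  assumes "Digraph.graph G"
  shows "cut_set G S \<longleftrightarrow> adjacency.cutset (\<lambda>u v. u \<rightarrow>\<^bsub>G\<^esub> v) (verts G) S"
proof -
  interpret G: graph G by fact
  interpret adjacency "\<lambda>u v. u \<rightarrow>\<^bsub>G\<^esub> v" using assms by (rule adjacency_graph)
  have "num_components (del_verts G (S - {s})) < num_components (del_verts G S) \<longleftrightarrow> separates s (verts G - S)"
    if "S \<subseteq> verts G" "s \<in> S" for s
  proof -
    have "verts G - (S - {s}) = insert s (verts G - S)" using that by blast
    then show ?thesis
      using component_count_insert_less_iff[of "verts G - S" s] that by (simp add: num_components_del_verts[OF assms])
  qed
  then show ?thesis unfolding cut_set_def cutset_def by blast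
qed

lemma unmixed_graph_iff:
  assumes "Digraph.graph G"
  shows "unmixed_ideal (edge_ring TYPE('k::field) G) (binomial_edge_ideal TYPE('k) G) \<longleftrightarrow>
    (\<forall>S. adjacency.cutset (\<lambda>u v. u \<rightarrow>\<^bsub>G\<^esub> v) (verts G) S \<longrightarrow>
      adjacency.component_count (\<lambda>u v. u \<rightarrow>\<^bsub>G\<^esub> v) (verts G - S) = card S + adjacency.component_count (\<lambda>u v. u \<rightarrow>\<^bsub>G\<^esub> v) (verts G))"
proof -
  interpret G: graph G by fact
  interpret graph_on "\<lambda>u v. u \<rightarrow>\<^bsub>G\<^esub> v" "verts G" "TYPE('k)"
    using adjacency_graph[OF assms] G.adj_in_verts by (intro graph_on.intro graph_on_axioms.intro) auto
  have "edge_ring TYPE('k) G = R" by (simp add: edge_ring_def edge_vars_def)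
  moreover have "binomial_edge_ideal TYPE('k) G = edge_ideal" 
    by (simp add: binomial_edge_ideal_def edge_ideal_def edge_ring_def edge_vars_def)
  ultimately show ?thesis using unmixed_iff by simp
qed

theorem proposition6p3:
  fixes G :: "('a, 'b) pre_digraph"
  assumes "Digraph.graph G"
    and "Digraph_Component.connected G"
    and "\<not> complete_digraph (card (verts G)) G"
    and "chordal_graph G"
    and "accessible_graph TYPE('k::field) G"
  shows "\<exists>v. cut_vertex G v \<and>
           unmixed_ideal (edge_ring TYPE('k) (del_verts G {v}))
             (binomial_edge_ideal TYPE('k) (del_verts G {v}))"
proof -
  interpret G: graph G by fact
  interpret adjacency "\<lambda>u v. u \<rightarrow>\<^bsub>G\<^esub> v" using assms(1) by (rule adjacency_graph)
  let ?V = "verts G"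
  have sc: "strongly_connected G"
    using G.symmetric_connected_imp_strongly_connected[OF G.sym_arcs assms(2)] .
  then have connV: "(x, y) \<in> conn ?V" if "x \<in> ?V" "y \<in> ?V" for x y
    using that reachable_iff_conn[OF assms(1)] by (simp add: strongly_connected_def)
  have nc1: "component_count ?V = 1" using sc connV by (intro component_count_connected) (auto simp: strongly_connected_def)
  have tight: "component_count (?V - S) = card S + 1" if "cutset ?V S" for S
    using assms(5) that unmixed_graph_iff[OF assms(1), where ?'k = 'k] nc1
    by (simp add: accessible_graph_def unmixed_graph_def)
  have acc: "\<exists>s\<in>S. cutset ?V (S - {s})" if "cutset ?V S" "S \<noteq> {}" for S
    using assms(5) that by (simp add: accessible_graph_def cut_set_iff_cutset[OF assms(1)])
  have chordal: "chordal_on ?V"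
  proof (rule chordal_onI)
    fix vs assume vs: "4 \<le> length vs" "distinct vs" "set vs \<subseteq> ?V"
      "\<And>i j. i < length vs \<Longrightarrow> j < length vs \<Longrightarrow>
        vs ! i \<rightarrow>\<^bsub>G\<^esub> vs ! j \<longleftrightarrow> j = Suc i mod length vs \<or> i = Suc j mod length vs"
    then have "induced_cycle G vs" by (simp add: induced_cycle_def)
    then have "length vs = 3" using assms(4) by (simp add: chordal_graph_def)
    then show False using vs(1) by simp
  qed
  obtain a b where ab: "a \<in> ?V" "b \<in> ?V" "a \<noteq> b" "\<not> a \<rightarrow>\<^bsub>G\<^esub> b"
  proof (rule ccontr)
    assume n: "\<not> thesis"
    have "arcs_ends G = {(u, v). (u, v) \<in> ?V \<times> ?V \<and> u \<noteq> v}"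
      using n that adj_irrefl G.adj_in_verts by auto
    then show False using assms(1,3) by (simp add: complete_digraph_def)
  qed
  obtain v where v: "v \<in> ?V" "cutset ?V {v}" "\<And>H. \<not> bad_side ?V v H"
    using chordal_accessible_has_good_cut_vertex[OF G.finite_verts connV ab chordal tight acc] by blast
  have good: "component_count (?V - {v} - S) = card S + 2" if "cutset (?V - {v}) S" for S
    by (rule no_bad_side_cut_vertex[OF G.finite_verts tight v that])
  have nc2: "component_count (?V - {v}) = 2" using good[of "{}"] by (simp add: cutset_def)
  let ?H = "G \<restriction> (?V - {v})"
  have H: "Digraph.graph ?H" using assms(1) by (rule graph_induce_subgraph) blast
  note restrict = restrict_adjacency[OF adjacency_graph[OF H], of "?V - {v}"]
  have agree: "x \<rightarrow>\<^bsub>?H\<^esub> y \<longleftrightarrow> x \<rightarrow>\<^bsub>G\<^esub> y" if "x \<in> ?V - {v}" "y \<in> ?V - {v}" for x y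
    using that by (simp add: induce_subgraph_adj)
  have "unmixed_ideal (edge_ring TYPE('k) ?H) (binomial_edge_ideal TYPE('k) ?H)"
    unfolding unmixed_graph_iff[OF H]
    using good nc2 restrict(2)[OF agree] restrict(3)[OF agree] by (simp add: Diff_subset)
  moreover have "cut_vertex G v"
    unfolding cut_vertex_def num_components_del_verts[OF assms(1)] num_components_graph[OF assms(1)]
    using v(1) nc1 nc2 by simp
  ultimately show ?thesis unfolding del_verts_def by blast
qed

end
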